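(* Let $X^f$ be an $\mathbb{R}^N$-valued random variable with probability density function $\pi_{X^f}$, let $\pi_Y(y|x)$ be a likelihood function, let $y_0\in\mathbb{R}^K$ be a fixed observation, and let $\pi_{X^a}(\cdot|y_0)$ be the posterior density given by $$\pi_{X^a}(x|y_0)=\frac{\pi_Y(y_0|x)\,\pi_{X^f}(x)}{\int_{\mathbb{R}^N}\pi_Y(y_0|x)\,\pi_{X^f}(x)\,dx}.$$ Assume that the ensemble $\mathcal{X}_M^f=\{x_i^f\}_{i=1}^M$ consists of realizations $x_i^f = X_i^f(\omega)$ of $M$ independent and identically distributed random variables $X_i^f:\Omega\to\mathbb{R}^N$ with density $\pi_{X^f}$. For each $M$, let $\mathcal{X}_M^a=\{\bar x_j^a\}_{j=1}^M$ be the transformed ensemble $\bar x_j^a=\sum_{i=1}^M p_{ij}x_i^f$, where $p_{ij}=M t^\ast_{ij}$ and $\mathbf{T}^\ast=(t^\ast_{ij})$ is an optimal coupling as defined in the context, and define the map $\Psi_M:\mathcal{X}_M^f\to\mathcal{X}_M^a$ by $\bar x_j^a=\Psi_M(x_j^f)$, $j=1,\ldots,M$. Then the maps $\Psi_M$ converge weakly, as $M\to\infty$, to a map $\Psi:\mathbb{R}^N\to\mathbb{R}^N$. Furthermore, the random variable $X^a=\Psi(X^f)$ has distribution with density $\pi_{X^a}(\cdot|y_0)$, and the expected distance $\mathbb{E}\big[\|X^f-\Psi(X^f)\|^2\big]$ between $X^f$ and $X^a$ is minimal among all maps $\Phi:\mathbb{R}^N\to\mathbb{R}^N$ for which $\Phi(X^f)$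 has density $\pi_{X^a}(\cdot|y_0)$.
   Context: Importance weights: given $x_1^f,\ldots,x_M^f\in\mathbb{R}^N$ and $y_0$, set $$w_i=\frac{\pi_Y(y_0|x_i^f)}{\sum_{l=1}^M\pi_Y(y_0|x_l^f)},\qquad i=1,\ldots,M.$$ Optimal coupling: a coupling is an $M\times M$ matrix $\mathbf{T}=(t_{ij})$ with $t_{ij}\ge 0$, $\sum_{i=1}^M t_{ij}=1/M$ for all $j$, and $\sum_{j=1}^M t_{ij}=w_i$ for all $i$. An optimal coupling $\mathbf{T}^\ast=(t_{ij}^\ast)$ is a coupling that minimizes $\sum_{i,j=1}^M t_{ij}\,\|x_i^f-x_j^f\|^2$ among all couplings ($\|\cdot\|$ is the Euclidean norm). Put $p_{ij}=M\,t_{ij}^\ast$, so that $\sum_{i=1}^M p_{ij}=1$ for every $j$. The "distance" is the squared Euclidean distance $d(x,x')=\|x-x'\|^2$. Weak convergence of the maps $\Psi_M$ to $\Psi$ is understood as weak convergence of the induced couplings: the probability measures $\frac1M\sum_{j=1}^M\delta_{(x_j^f,\Psi_M(x_j^f))}$ on $\mathbb{R}^N\times\mathbb{R}^N$ converge weakly to the law of $(X^f,\Psi(X^f))$, for almost every realization $\omega$ of an i.i.d. sequence $(X_i^f)_{i\ge1}$ with density $\pi_{X^f}$. It is assumed that the posterior density is well defined, i.e. $0<\int_{\mathbb{R}^N}\pi_Y(y_0|x)\pi_{X^f}(x)\,dx<\infty$. *)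

theory Defs
  imports "HOL-Probability.Probability"
begin

definition posterior_density ::
  "('y \<Rightarrow> 'x::euclidean_space \<Rightarrow> real) \<Rightarrow> ('x \<Rightarrow> real) \<Rightarrow> 'y \<Rightarrow> 'x \<Rightarrow> real" where
  "posterior_density lik prior y x =
     lik y x * prior x / (\<integral>z. lik y z * prior z \<partial>lborel)"

text \<open>Ensembles are the first \<open>M\<close> terms of a sequence \<open>x\<close>, and \<open>M \<times> M\<close> matrices are functions
  on pairs of naturals; indices run over \<open>{..<M}\<close>.
  In what follows \<open>L\<close> is the likelihood as a function of the state, at the fixed observation.\<close>

definition importance_weight :: "('x \<Rightarrow> real) \<Rightarrow> (nat \<Rightarrow> 'x) \<Rightarrow> nat \<Rightarrow> nat \<Rightarrow> real" where
  "importance_weight L x M i = L (x i) / (\<Sum>l<M. L (x l))"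

definition coupling :: "nat \<Rightarrow> (nat \<Rightarrow> real) \<Rightarrow> (nat \<Rightarrow> nat \<Rightarrow> real) \<Rightarrow> bool" where
  "coupling M w t \<longleftrightarrow>
     (\<forall>i<M. \<forall>j<M. 0 \<le> t i j) \<and>
     (\<forall>j<M. (\<Sum>i<M. t i j) = 1 / real M) \<and>
     (\<forall>i<M. (\<Sum>j<M. t i j) = w i)"

definition transport_cost ::
  "nat \<Rightarrow> (nat \<Rightarrow> 'x::real_normed_vector) \<Rightarrow> (nat \<Rightarrow> nat \<Rightarrow> real) \<Rightarrow> real" where
  "transport_cost M x t = (\<Sum>i<M. \<Sum>j<M. t i j * (norm (x i - x j))\<^sup>2)"

definition optimal_coupling ::
  "nat \<Rightarrow> (nat \<Rightarrow> real) \<Rightarrow> (nat \<Rightarrow> 'x::real_normed_vector) \<Rightarrow> (nat \<Rightarrow> nat \<Rightarrow> real) \<Rightarrow> bool" where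
  "optimal_coupling M w x t \<longleftrightarrow>
     coupling M w t \<and> (\<forall>s. coupling M w s \<longrightarrow> transport_cost M x t \<le> transport_cost M x s)"

definition transformed_ensemble ::
  "nat \<Rightarrow> (nat \<Rightarrow> 'x::real_vector) \<Rightarrow> (nat \<Rightarrow> nat \<Rightarrow> real) \<Rightarrow> nat \<Rightarrow> 'x" where
  "transformed_ensemble M x t j = (\<Sum>i<M. (real M * t i j) *\<^sub>R x i)"

text \<open>Only the values of \<open>psi\<close> on the ensemble are prescribed. Optimal couplings need not be
  unique, so this is a relation. It makes sense only if the weights are defined,
  i.e. if \<open>(\<Sum>l<M. L (x l)) \<noteq> 0\<close>.\<close>

definition ensemble_transform_map ::
  "('x::real_normed_vector \<Rightarrow> real) \<Rightarrow> nat \<Rightarrow> (nat \<Rightarrow> 'x) \<Rightarrow> ('x \<Rightarrow> 'x) \<Rightarrow> bool" where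
  "ensemble_transform_map L M x psi \<longleftrightarrow>
     (\<exists>t. optimal_coupling M (importance_weight L x M) x t \<and>
          (\<forall>j<M. psi (x j) = transformed_ensemble M x t j))"

text \<open>The measure \<open>1/M \<Sum>\<^sub>j \<delta>\<close>, with Dirac masses at the points \<open>(x j, psi (x j))\<close>, \<open>j < M\<close>.\<close>

definition empirical_coupling ::
  "nat \<Rightarrow> (nat \<Rightarrow> 'x::topological_space) \<Rightarrow> ('x \<Rightarrow> 'x) \<Rightarrow> ('x \<times> 'x) measure" where
  "empirical_coupling M x psi =
     distr (uniform_count_measure {..<M}) borel (\<lambda>j. (x j, psi (x j)))"

text \<open>The library's \<open>weak_conv_m\<close> covers only measures on the real line.\<close>

definition weakly_converges ::
  "(nat \<Rightarrow> 'a::topological_space measure) \<Rightarrow> 'a measure \<Rightarrow> bool" where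
  "weakly_converges \<mu> \<nu> \<longleftrightarrow>
     (\<forall>f :: 'a \<Rightarrow> real. continuous_on UNIV f \<and> bounded (range f) \<longrightarrow>
        (\<lambda>n. \<integral>z. f z \<partial>\<mu> n) \<longlonglongrightarrow> (\<integral>z. f z \<partial>\<nu>))"

end

theory Submission
  imports Defs
begin

text \<open>
  The costs may have infinite expectation, so the proof rests on cyclical monotonicity, which makes
  sense without moments and survives limits, instead of on the value of the transport problem.

  \<^emph>\<open>Compactness.\<close> An optimal coupling of a finite ensemble charges a cyclically monotone set of pairs
  (source, target), because mass could otherwise be moved along a cycle at a profit. By the strong
  law of large numbers, almost every realisation makes the marginals of these couplings converge
  weakly to the prior \<open>\<mu>\<close> and the posterior \<open>\<nu>\<close>. Along a subsequence the supports converge, in the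
  sense of Kuratowski, to a closed cyclically monotone set \<open>\<Gamma>\<close>. A monotone relation is single-valued
  off a Lebesgue null set and locally bounded inside the convex hull of its domain. Hence there is a
  map \<open>\<Psi>\<close> such that at \<open>\<mu>\<close>-almost every \<open>a\<close> all pairs \<open>(x, y)\<close> in the \<open>k\<close>-th support with \<open>x\<close> near \<open>a\<close>
  have \<open>y\<close> near \<open>\<Psi> a\<close>, for large \<open>k\<close>. As balls are convex, this passes from the couplings to the
  barycentric maps \<open>\<Psi>\<^sub>M\<close>, and it implies weak convergence to the law of \<open>(X, \<Psi> X)\<close>; for the couplings
  themselves it shows that \<open>\<Psi>\<close> carries \<open>\<mu>\<close> to \<open>\<nu>\<close>
  (\<open>monotone_plans_converge_along_subsequence\<close>, \<open>weak_limit_of_convergent_graphs\<close>).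

  \<^emph>\<open>Uniqueness.\<close> Rockafellar's construction gives functions with \<open>x \<bullet> y \<le> f x + g y\<close>, and equality on
  the graph of the transport map. For two transports of \<open>\<mu>\<close> to \<open>\<nu>\<close> with potentials \<open>f1, g1\<close> and
  \<open>f2, g2\<close> the sum of \<open>f1 x - f2 x\<close> and \<open>g1 y - g2 y\<close> is nonpositive on one graph and nonnegative on
  the other. Composing both summands with the arctangent makes them integrable, and as the integral
  depends on the marginals only, it vanishes; so both graphs lie in one monotone relation, and the
  maps agree almost everywhere (\<open>cyclically_monotone_transport_unique\<close>). Therefore \<open>\<Psi>\<close> depends
  neither on the subsequence nor on the realisation, and the whole sequence converges.

  \<^emph>\<open>Minimality.\<close> The same potentials give \<open>p x + q y \<le> (norm (x - y))\<^sup>2\<close> with equality on the graph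
  of \<open>\<Psi>\<close>. The integral of truncations of \<open>p\<close> and \<open>q\<close> is the same for all competitors, and Fatou's lemma
  removes the truncation (\<open>cyclically_monotone_minimal_cost\<close>).
\<close>

section \<open>The strong law of large numbers\<close>

context prob_space begin

text \<open>An i.i.d. process is stationary; the maximal inequality rests on this.\<close>
lemma iid_shift_law:
  fixes Y :: "nat \<Rightarrow> 'a \<Rightarrow> real"
  assumes indep: "indep_vars (\<lambda>_. borel) Y UNIV"
    and ident: "\<And>i. distr M borel (Y i) = distr M borel (Y 0)"
  shows "distr M (PiM UNIV (\<lambda>_. borel)) (\<lambda>\<omega> i. Y (Suc i) \<omega>)
       = distr M (PiM UNIV (\<lambda>_. borel)) (\<lambda>\<omega> i. Y i \<omega>)"
proof -
  have [measurable]: "Y i \<in> borel_measurable M" for i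
    using indep unfolding indep_vars_def by blast
  define D where "D = distr M borel (Y 0)"
  have D: "prob_space D" "sets D = sets borel" unfolding D_def by (auto intro: prob_space_distr)
  have s: "sets (PiM (UNIV::nat set) (\<lambda>_. borel :: real measure)) = sets (PiM UNIV (\<lambda>_. D))"
    by (intro sets_PiM_cong) (auto simp: D)
  have law: "distr M (PiM UNIV (\<lambda>_. borel)) (\<lambda>\<omega> i. Y i \<omega>) = PiM UNIV (\<lambda>_. D)"
    using indep_vars_iff_distr_eq_PiM'[where I=UNIV and M'="\<lambda>_. borel" and X=Y] indep
    by (simp add: ident[folded D_def] restrict_UNIV)
  have m1: "(\<lambda>\<omega> i. Y i \<omega>) \<in> M \<rightarrow>\<^sub>M PiM UNIV (\<lambda>_. borel)"
    by (rule measurable_PiM_single') auto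
  have m2: "(\<lambda>\<omega> i. \<omega> (Suc i)) \<in> PiM UNIV (\<lambda>_. borel) \<rightarrow>\<^sub>M PiM UNIV (\<lambda>_. borel :: real measure)"
    by (rule measurable_PiM_single') auto
  have "distr M (PiM UNIV (\<lambda>_. borel)) (\<lambda>\<omega> i. Y (Suc i) \<omega>)
     = distr (distr M (PiM UNIV (\<lambda>_. borel)) (\<lambda>\<omega> i. Y i \<omega>)) (PiM UNIV (\<lambda>_. borel)) (\<lambda>\<omega> i. \<omega> (Suc i))"
    by (subst distr_distr[OF m2 m1]) (simp add: comp_def)
  also have "\<dots> = distr (PiM UNIV (\<lambda>_. D)) (PiM UNIV (\<lambda>_. D)) (\<lambda>\<omega> i. \<omega> (Suc i))"
    unfolding law using s by (intro distr_cong) auto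
  also have "\<dots> = PiM UNIV (\<lambda>_. D)"
    using distr_PiM_reindex[where K=UNIV and M="\<lambda>_. D" and f=Suc and I=UNIV] D by (simp add: restrict_UNIV)
  finally show ?thesis by (simp add: law)
qed

text \<open>Garsia's argument. The running maximum \<open>G\<close> of the partial sums of \<open>W i - \<epsilon>\<close> is at most
  \<open>W 0 - \<epsilon>\<close> plus the running maximum of the shifted process wherever \<open>G\<close> is positive, and both
  maxima have the same expectation by stationarity. So \<open>W 0 - \<epsilon>\<close> has nonnegative expectation on the
  event that \<open>G\<close> is positive, which is the event in the statement.\<close>
lemma maximal_inequality_finite:
  fixes W :: "nat \<Rightarrow> 'a \<Rightarrow> real"
  assumes indep: "indep_vars (\<lambda>_. borel) W UNIV"
    and ident: "\<And>i. distr M borel (W i) = distr M borel (W 0)"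
    and int: "integrable M (W 0)" and nonneg: "\<And>\<omega>. 0 \<le> W 0 \<omega>"
    and "0 < \<epsilon>"
  shows "\<epsilon> * prob {\<omega> \<in> space M. \<exists>n\<le>N. (\<Sum>i<n. W i \<omega>) > \<epsilon> * real n} \<le> expectation (W 0)"
proof -
  have W[measurable]: "W i \<in> borel_measurable M" for i
    using indep unfolding indep_vars_def by blast
  \<comment> \<open>The empty sum is included in the maximum, so \<open>G\<close> is nonnegative.\<close>
  define G :: "(nat \<Rightarrow> real) \<Rightarrow> real" where "G = (\<lambda>v. MAX n\<in>{..N}. (\<Sum>i<n. v i - \<epsilon>))"
  have G[measurable]: "G \<in> borel_measurable (PiM UNIV (\<lambda>_. borel))"
    unfolding G_def by (intro borel_measurable_Max) auto
  define G1 where "G1 = (\<lambda>\<omega>. G (\<lambda>i. W i \<omega>))"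
  define G2 where "G2 = (\<lambda>\<omega>. G (\<lambda>i. W (Suc i) \<omega>))"
  have m1[measurable]: "(\<lambda>\<omega> i. W i \<omega>) \<in> M \<rightarrow>\<^sub>M PiM UNIV (\<lambda>_. borel)"
    by (rule measurable_PiM_single') auto
  have m2[measurable]: "(\<lambda>\<omega> i. W (Suc i) \<omega>) \<in> M \<rightarrow>\<^sub>M PiM UNIV (\<lambda>_. borel)"
    by (rule measurable_PiM_single') auto
  have G1m[measurable]: "G1 \<in> borel_measurable M" unfolding G1_def by measurable
  have G2m[measurable]: "G2 \<in> borel_measurable M" unfolding G2_def by measurable
  have ge: "(\<Sum>i<n. v i - \<epsilon>) \<le> G v" if "n \<le> N" for n v
    unfolding G_def using that by (intro Max_ge) auto
  have attained: "\<exists>n\<le>N. G v = (\<Sum>i<n. v i - \<epsilon>)" for v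
  proof -
    have "G v \<in> (\<lambda>n. \<Sum>i<n. v i - \<epsilon>) ` {..N}" unfolding G_def by (rule Max_in) auto
    then show ?thesis by auto
  qed
  have G0: "0 \<le> G v" for v using ge[of 0 v] by simp
  have intW: "integrable M (W i)" for i
  proof -
    have "integrable (distr M borel (W i)) (\<lambda>x. x)"
      unfolding ident[of i] using int by (subst integrable_distr_eq) auto
    then show ?thesis by (subst (asm) integrable_distr_eq) auto
  qed
  have intG1: "integrable M G1"
  proof (rule Bochner_Integration.integrable_bound)
    show "integrable M (\<lambda>\<omega>. \<Sum>i<N. \<bar>W i \<omega> - \<epsilon>\<bar>)" using intW by auto
    have "\<bar>G1 \<omega>\<bar> \<le> (\<Sum>i<N. \<bar>W i \<omega> - \<epsilon>\<bar>)" for \<omega>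
    proof -
      obtain n where n: "n \<le> N" "G1 \<omega> = (\<Sum>i<n. W i \<omega> - \<epsilon>)"
        using attained[of "\<lambda>i. W i \<omega>"] unfolding G1_def by auto
      have "\<bar>G1 \<omega>\<bar> \<le> (\<Sum>i<n. \<bar>W i \<omega> - \<epsilon>\<bar>)" unfolding n by (rule sum_abs)
      also have "\<dots> \<le> (\<Sum>i<N. \<bar>W i \<omega> - \<epsilon>\<bar>)" using n by (intro sum_mono2) auto
      finally show ?thesis .
    qed
    then show "AE \<omega> in M. norm (G1 \<omega>) \<le> norm (\<Sum>i<N. \<bar>W i \<omega> - \<epsilon>\<bar>)"
      by (intro AE_I2) (simp add: sum_nonneg)
  qed simp
  have G12: "integrable M G2 \<and> expectation G2 = expectation G1"
  proof -
    have "integrable (distr M (PiM UNIV (\<lambda>_. borel)) (\<lambda>\<omega> i. W i \<omega>)) G"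
      using intG1 by (subst integrable_distr_eq) (auto simp: G1_def)
    then have "integrable M G2"
      unfolding iid_shift_law[OF indep ident, symmetric]
      by (subst (asm) integrable_distr_eq) (auto simp: G2_def)
    moreover have "expectation G2 = (\<integral>v. G v \<partial>distr M (PiM UNIV (\<lambda>_. borel)) (\<lambda>\<omega> i. W (Suc i) \<omega>))"
      unfolding G2_def by (subst integral_distr) auto
    moreover have "\<dots> = expectation G1"
      unfolding iid_shift_law[OF indep ident] G1_def by (subst integral_distr) auto
    ultimately show ?thesis by simp
  qed
  define E where "E = {\<omega> \<in> space M. \<exists>n\<le>N. (\<Sum>i<n. W i \<omega>) > \<epsilon> * real n}"
  have E: "E = {\<omega> \<in> space M. 0 < G1 \<omega>}"
  proof -
    have "(\<exists>n\<le>N. (\<Sum>i<n. W i \<omega>) > \<epsilon> * real n) \<longleftrightarrow> 0 < G1 \<omega>" for \<omega>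
    proof
      assume "\<exists>n\<le>N. (\<Sum>i<n. W i \<omega>) > \<epsilon> * real n"
      then obtain n where "n \<le> N" "(\<Sum>i<n. W i \<omega>) > \<epsilon> * real n" by blast
      then show "0 < G1 \<omega>" using ge[of n "\<lambda>i. W i \<omega>"] unfolding G1_def
        by (simp add: sum_subtractf algebra_simps)
    next
      assume *: "0 < G1 \<omega>"
      obtain n where n: "n \<le> N" "G1 \<omega> = (\<Sum>i<n. W i \<omega> - \<epsilon>)"
        using attained[of "\<lambda>i. W i \<omega>"] unfolding G1_def by auto
      then show "\<exists>n\<le>N. (\<Sum>i<n. W i \<omega>) > \<epsilon> * real n"
        using * by (intro exI[of _ n]) (simp add: sum_subtractf algebra_simps)
    qed
    then show ?thesis by (auto simp: E_def)
  qed
  have Em[measurable]: "E \<in> sets M" unfolding E by measurable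
  have key: "G1 \<omega> \<le> (W 0 \<omega> - \<epsilon>) * indicator E \<omega> + G2 \<omega>" if "\<omega> \<in> space M" for \<omega>
  proof (cases "0 < G1 \<omega>")
    case True
    obtain n where n: "n \<le> N" "G1 \<omega> = (\<Sum>i<n. W i \<omega> - \<epsilon>)"
      using attained[of "\<lambda>i. W i \<omega>"] unfolding G1_def by auto
    with True obtain m where m: "n = Suc m" by (cases n) auto
    have "G1 \<omega> = (W 0 \<omega> - \<epsilon>) + (\<Sum>i<m. W (Suc i) \<omega> - \<epsilon>)"
      unfolding n m by (simp add: sum.lessThan_Suc_shift del: sum.lessThan_Suc)
    also have "(\<Sum>i<m. W (Suc i) \<omega> - \<epsilon>) \<le> G2 \<omega>"
      unfolding G2_def using ge[of m "\<lambda>i. W (Suc i) \<omega>"] n m by simp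
    finally show ?thesis using True that by (simp add: E)
  next
    case False
    then show ?thesis using that order_trans[OF _ G0, of "G1 \<omega>"] by (simp add: E G2_def)
  qed
  have i1: "integrable M (\<lambda>\<omega>. (W 0 \<omega> - \<epsilon>) * indicator E \<omega>)"
    using integrable_real_mult_indicator[OF Em, of "\<lambda>\<omega>. W 0 \<omega> - \<epsilon>"] int
    by (simp add: mult.commute)
  have i2: "integrable M (\<lambda>\<omega>. W 0 \<omega> * indicator E \<omega>)"
    using integrable_real_mult_indicator[OF Em, of "W 0"] int
    by (simp add: mult.commute)
  have "expectation G1 \<le> expectation (\<lambda>\<omega>. (W 0 \<omega> - \<epsilon>) * indicator E \<omega> + G2 \<omega>)"
    using intG1 i1 G12 by (intro integral_mono) (auto intro: key)
  also have "\<dots> = expectation (\<lambda>\<omega>. (W 0 \<omega> - \<epsilon>) * indicator E \<omega>) + expectation G1"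
    using i1 G12 by simp
  also have "expectation (\<lambda>\<omega>. (W 0 \<omega> - \<epsilon>) * indicator E \<omega>)
      = expectation (\<lambda>\<omega>. W 0 \<omega> * indicator E \<omega>) - \<epsilon> * prob E"
    unfolding left_diff_distrib
    by (subst Bochner_Integration.integral_diff) (use i2 Em in \<open>auto simp: emeasure_eq_measure\<close>)
  finally have "\<epsilon> * prob E \<le> expectation (\<lambda>\<omega>. W 0 \<omega> * indicator E \<omega>)" by simp
  also have "\<dots> \<le> expectation (W 0)"
    using i2 int nonneg by (intro integral_mono) (auto simp: indicator_def)
  finally show ?thesis unfolding E_def .
qed

lemma maximal_inequality:
  fixes W :: "nat \<Rightarrow> 'a \<Rightarrow> real"
  assumes indep: "indep_vars (\<lambda>_. borel) W UNIV"
    and ident: "\<And>i. distr M borel (W i) = distr M borel (W 0)"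
    and int: "integrable M (W 0)" and nonneg: "\<And>\<omega>. 0 \<le> W 0 \<omega>"
    and "0 < \<epsilon>"
  shows "\<epsilon> * prob {\<omega> \<in> space M. \<exists>n. (\<Sum>i<n. W i \<omega>) > \<epsilon> * real n} \<le> expectation (W 0)"
proof -
  have W[measurable]: "W i \<in> borel_measurable M" for i
    using indep unfolding indep_vars_def by blast
  define A where "A = (\<lambda>N. {\<omega> \<in> space M. \<exists>n\<le>N. (\<Sum>i<n. W i \<omega>) > \<epsilon> * real n})"
  have A: "A N \<in> sets M" for N unfolding A_def by measurable
  have U: "{\<omega> \<in> space M. \<exists>n. (\<Sum>i<n. W i \<omega>) > \<epsilon> * real n} = (\<Union>N. A N)"
    by (auto simp: A_def)
  have "incseq A" unfolding A_def incseq_def by (auto intro: order_trans)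
  then have "(\<lambda>N. prob (A N)) \<longlonglongrightarrow> prob (\<Union>N. A N)"
    using A by (intro finite_Lim_measure_incseq) auto
  then have "(\<lambda>N. \<epsilon> * prob (A N)) \<longlonglongrightarrow> \<epsilon> * prob (\<Union>N. A N)"
    by (intro tendsto_intros)
  then show ?thesis unfolding U
    using maximal_inequality_finite[OF assms]
    by (intro LIMSEQ_le_const2) (auto simp: A_def)
qed

text \<open>Hoeffding's inequality makes the deviation probabilities summable, and the Borel-Cantelli lemma
  applies.\<close>
lemma strong_law_bounded:
  fixes Y :: "nat \<Rightarrow> 'a \<Rightarrow> real"
  assumes indep: "indep_vars (\<lambda>_. borel) Y UNIV"
    and ident: "\<And>i. distr M borel (Y i) = distr M borel (Y 0)"
    and bound: "\<And>\<omega>. \<bar>Y 0 \<omega>\<bar> \<le> B"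
  shows "AE \<omega> in M. (\<lambda>n. (\<Sum>i<n. Y i \<omega>) / real n) \<longlonglongrightarrow> expectation (Y 0)"
proof -
  have Y[measurable]: "Y i \<in> borel_measurable M" for i
    using indep unfolding indep_vars_def by blast
  \<comment> \<open>Hoeffding's inequality wants an interval of positive length, also for constant variables.\<close>
  define b where "b = \<bar>B\<bar> + 1"
  have b: "b > 0" "\<bar>Y 0 \<omega>\<bar> \<le> b" for \<omega> using bound[of \<omega>] by (auto simp: b_def)
  define A where "A = (\<lambda>\<epsilon> n. {\<omega> \<in> space M. \<bar>(\<Sum>i<n. Y i \<omega>) / real n - expectation (Y 0)\<bar> \<ge> \<epsilon>})"
  have ae: "AE \<omega> in M. \<forall>\<^sub>F n in sequentially. \<omega> \<in> space M - A \<epsilon> n" if "\<epsilon> > 0" for \<epsilon>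
  proof (rule borel_cantelli_AE1)
    show "A \<epsilon> n \<in> sets M" for n unfolding A_def by measurable
    show "emeasure M (A \<epsilon> n) < \<infinity>" for n by (simp add: emeasure_eq_measure)
    define q where "q = exp (- 2 * \<epsilon>\<^sup>2 / (b - (-b))\<^sup>2)"
    have q: "0 \<le> q" "q < 1" using \<open>\<epsilon> > 0\<close> b by (auto simp: q_def divide_neg_pos)
    have tail: "prob (A \<epsilon> n) \<le> 2 * q ^ n" if "n > 0" for n
    proof -
      interpret Hoeffding_ineq_iid M "{..<n}" Y "Y 0" "-b" b "expectation (Y 0)"
      proof unfold_locales
        show "indep_vars (\<lambda>_. borel) Y {..<n}" by (rule indep_vars_subset[OF indep]) simp
        show "distr M borel (Y i) = distr M borel (Y 0)" for i by (rule ident)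
        have "Y 0 x \<in> {-b..b}" for x using b(2)[of x] by (simp add: abs_le_iff)
        then show "AE x in M. Y 0 x \<in> {-b..b}" by simp
      qed simp_all
      have "\<epsilon> \<ge> 0" "- b < b" "{..<n} \<noteq> {}" using that b(1) \<open>\<epsilon> > 0\<close> by auto
      from Hoeffding_ineq_abs_ge'[OF this]
      have "prob (A \<epsilon> n) \<le> 2 * exp (-2 * real n * \<epsilon>\<^sup>2 / (b - (-b))\<^sup>2)"
        unfolding A_def card_lessThan .
      also have "exp (-2 * real n * \<epsilon>\<^sup>2 / (b - (-b))\<^sup>2) = q ^ n"
        unfolding q_def exp_of_nat_mult[symmetric] by (simp add: mult_ac)
      finally show ?thesis .
    qed
    show "summable (\<lambda>n. prob (A \<epsilon> n))"
    proof (rule summable_comparison_test')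
      show "summable (\<lambda>n. 2 * q ^ n)" using q by (intro summable_mult summable_geometric) simp
      show "norm (prob (A \<epsilon> n)) \<le> 2 * q ^ n" if "n \<ge> 1" for n
        using tail[of n] that by (simp add: measure_nonneg)
    qed
  qed
  have "AE \<omega> in M. \<forall>k. \<forall>\<^sub>F n in sequentially. \<omega> \<in> space M - A (1 / real (Suc k)) n"
    unfolding AE_all_countable by (intro allI ae) simp
  then show ?thesis
  proof eventually_elim
    case (elim \<omega>)
    show ?case
    proof (rule tendstoI)
      fix e :: real assume "e > 0"
      then obtain k where k: "1 / real (Suc k) < e" using nat_approx_posE by blast
      show "\<forall>\<^sub>F n in sequentially. dist ((\<Sum>i<n. Y i \<omega>) / real n) (expectation (Y 0)) < e"
        using elim[rule_format, of k] by eventually_elim (use k in \<open>auto simp: A_def dist_real_def\<close>)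
    qed
  qed
qed

text \<open>Truncation reduces the integrable case to the bounded one. The maximal inequality controls the
  averages of the truncated parts for all sample sizes at once: the probability that they ever exceed
  \<open>\<epsilon>\<close> tends to 0 as the truncation level grows, so almost every sample path has a level at which
  they never do.\<close>
theorem strong_law_of_large_numbers:
  fixes Y :: "nat \<Rightarrow> 'a \<Rightarrow> real"
  assumes indep: "indep_vars (\<lambda>_. borel) Y UNIV"
    and ident: "\<And>i. distr M borel (Y i) = distr M borel (Y 0)"
    and int: "integrable M (Y 0)"
  shows "AE \<omega> in M. (\<lambda>n. (\<Sum>i<n. Y i \<omega>) / real n) \<longlonglongrightarrow> expectation (Y 0)"
proof -
  have Y[measurable]: "Y i \<in> borel_measurable M" for i
    using indep unfolding indep_vars_def by blast
  define c :: "nat \<Rightarrow> real \<Rightarrow> real" where "c = (\<lambda>k y. max (- real k) (min (real k) y))"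
  have c[measurable]: "c k \<in> borel_measurable borel" for k unfolding c_def by measurable
  define d where "d = (\<lambda>k y. \<bar>y - c k y\<bar>)"
  have d[measurable]: "d k \<in> borel_measurable borel" for k unfolding d_def by measurable
  have ident': "distr M borel (\<lambda>\<omega>. h (Y i \<omega>)) = distr M borel (\<lambda>\<omega>. h (Y 0 \<omega>))"
    if [measurable]: "h \<in> borel_measurable borel" for h :: "real \<Rightarrow> real" and i
    using arg_cong[OF ident[of i], of "\<lambda>D. distr D borel h"] by (simp add: distr_distr comp_def)
  have dY: "integrable M (\<lambda>\<omega>. d k (Y 0 \<omega>))" for k
    using int by (rule Bochner_Integration.integrable_bound) (auto simp: d_def c_def)
  have d0: "(\<lambda>k. expectation (\<lambda>\<omega>. d k (Y 0 \<omega>))) \<longlonglongrightarrow> expectation (\<lambda>\<omega>. 0)"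
  proof (rule integral_dominated_convergence[where w = "\<lambda>\<omega>. \<bar>Y 0 \<omega>\<bar>"])
    have "(\<lambda>k. d k y) \<longlonglongrightarrow> 0" for y
    proof (rule tendsto_eventually)
      obtain K where "\<bar>y\<bar> \<le> real K" using real_arch_simple by blast
      then show "\<forall>\<^sub>F k in sequentially. d k y = 0"
        by (intro eventually_sequentiallyI[of K]) (auto simp: d_def c_def)
    qed
    then show "AE \<omega> in M. (\<lambda>k. d k (Y 0 \<omega>)) \<longlonglongrightarrow> 0" by simp
  qed (use int in \<open>auto simp: d_def c_def\<close>)
  define A where "A = (\<lambda>\<epsilon> k. {\<omega> \<in> space M. \<exists>n. (\<Sum>i<n. d k (Y i \<omega>)) > \<epsilon> * real n})"
  have Am[measurable]: "A \<epsilon> k \<in> sets M" for \<epsilon> k unfolding A_def by measurable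
  have A: "\<epsilon> * prob (A \<epsilon> k) \<le> expectation (\<lambda>\<omega>. d k (Y 0 \<omega>))" if "\<epsilon> > 0" for \<epsilon> k
    unfolding A_def
  proof (rule maximal_inequality[where W = "\<lambda>i \<omega>. d k (Y i \<omega>)"])
    show "indep_vars (\<lambda>_. borel) (\<lambda>i \<omega>. d k (Y i \<omega>)) UNIV"
      by (rule indep_vars_compose2[OF indep]) auto
    show "distr M borel (\<lambda>\<omega>. d k (Y i \<omega>)) = distr M borel (\<lambda>\<omega>. d k (Y 0 \<omega>))" for i
      by (rule ident') auto
  qed (use dY that in \<open>auto simp: d_def\<close>)
  have bdd: "AE \<omega> in M. (\<lambda>n. (\<Sum>i<n. c k (Y i \<omega>)) / real n) \<longlonglongrightarrow> expectation (\<lambda>\<omega>. c k (Y 0 \<omega>))" for k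
  proof (rule strong_law_bounded[where Y = "\<lambda>i \<omega>. c k (Y i \<omega>)" and B = "real k"])
    show "indep_vars (\<lambda>_. borel) (\<lambda>i \<omega>. c k (Y i \<omega>)) UNIV"
      by (rule indep_vars_compose2[OF indep]) auto
    show "distr M borel (\<lambda>\<omega>. c k (Y i \<omega>)) = distr M borel (\<lambda>\<omega>. c k (Y 0 \<omega>))" for i
      by (rule ident') auto
  qed (auto simp: c_def)
  have ae: "AE \<omega> in M. \<forall>\<^sub>F n in sequentially. \<bar>(\<Sum>i<n. Y i \<omega>) / real n - expectation (Y 0)\<bar> < 3 * \<epsilon>"
    if e: "\<epsilon> > 0" for \<epsilon>
  proof -
    obtain K where K: "\<And>k. k \<ge> K \<Longrightarrow> expectation (\<lambda>\<omega>. d k (Y 0 \<omega>)) < \<epsilon>"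
      using order_tendstoD(2)[OF d0, of \<epsilon>] e unfolding eventually_sequentially by auto
    have "(\<Inter>k\<in>{K..}. A \<epsilon> k) \<in> null_sets M"
    proof -
      have m: "(\<Inter>k\<in>{K..}. A \<epsilon> k) \<in> sets M" by (intro sets.countable_INT') auto
      have "prob (\<Inter>k\<in>{K..}. A \<epsilon> k) \<le> expectation (\<lambda>\<omega>. d k (Y 0 \<omega>)) / \<epsilon>" if "k \<ge> K" for k
      proof -
        have "prob (\<Inter>k\<in>{K..}. A \<epsilon> k) \<le> prob (A \<epsilon> k)"
          using that by (intro finite_measure_mono) auto
        also have "\<dots> \<le> expectation (\<lambda>\<omega>. d k (Y 0 \<omega>)) / \<epsilon>"
          using A[OF e, of k] e by (simp add: field_simps)
        finally show ?thesis .
      qed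
      moreover have "(\<lambda>k. expectation (\<lambda>\<omega>. d k (Y 0 \<omega>)) / \<epsilon>) \<longlonglongrightarrow> 0 / \<epsilon>"
        using d0 e by (intro tendsto_intros) auto
      ultimately have "prob (\<Inter>k\<in>{K..}. A \<epsilon> k) \<le> 0 / \<epsilon>"
        by (intro LIMSEQ_le_const) auto
      then have "prob (\<Inter>k\<in>{K..}. A \<epsilon> k) = 0" by (simp add: measure_le_0_iff)
      with m show ?thesis by (simp add: null_sets_def emeasure_eq_measure)
    qed
    then have "AE \<omega> in M. \<omega> \<notin> (\<Inter>k\<in>{K..}. A \<epsilon> k)" by (rule AE_not_in)
    moreover have "AE \<omega> in M. \<forall>k. (\<lambda>n. (\<Sum>i<n. c k (Y i \<omega>)) / real n) \<longlonglongrightarrow> expectation (\<lambda>\<omega>. c k (Y 0 \<omega>))"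
      unfolding AE_all_countable using bdd by blast
    ultimately show ?thesis using AE_space
    proof eventually_elim
      case (elim \<omega>)
      then obtain k where k: "k \<ge> K" "\<omega> \<notin> A \<epsilon> k" by blast
      have small: "(\<Sum>i<n. d k (Y i \<omega>)) \<le> \<epsilon> * real n" for n
        using k(2) elim(3) by (auto simp: A_def not_less)
      have ci: "integrable M (\<lambda>\<omega>. c k (Y 0 \<omega>))"
        using int by (rule Bochner_Integration.integrable_bound) (auto simp: c_def)
      have "\<bar>expectation (Y 0) - expectation (\<lambda>\<omega>. c k (Y 0 \<omega>))\<bar> = \<bar>expectation (\<lambda>\<omega>. Y 0 \<omega> - c k (Y 0 \<omega>))\<bar>"
        using int ci by simp
      also have "\<dots> \<le> expectation (\<lambda>\<omega>. d k (Y 0 \<omega>))"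
        unfolding d_def by (rule integral_abs_bound)
      also have "\<dots> < \<epsilon>" using K k by auto
      finally have mean: "\<bar>expectation (Y 0) - expectation (\<lambda>\<omega>. c k (Y 0 \<omega>))\<bar> < \<epsilon>" .
      have "\<forall>\<^sub>F n in sequentially. dist ((\<Sum>i<n. c k (Y i \<omega>)) / real n) (expectation (\<lambda>\<omega>. c k (Y 0 \<omega>))) < \<epsilon>"
        using elim(2) e by (auto intro: tendstoD)
      then show ?case
      proof eventually_elim
        case (elim n)
        have "\<bar>(\<Sum>i<n. Y i \<omega>) / real n - (\<Sum>i<n. c k (Y i \<omega>)) / real n\<bar>
            = \<bar>\<Sum>i<n. Y i \<omega> - c k (Y i \<omega>)\<bar> / real n"
          by (simp add: sum_subtractf diff_divide_distrib[symmetric])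
        also have "\<dots> \<le> (\<Sum>i<n. d k (Y i \<omega>)) / real n"
          unfolding d_def by (intro divide_right_mono sum_abs) auto
        also have "\<dots> \<le> \<epsilon>" using small[of n] e by (cases "n = 0") (auto simp: field_simps)
        finally show ?case using elim mean unfolding dist_real_def by linarith
      qed
    qed
  qed
  have "AE \<omega> in M. \<forall>j. \<forall>\<^sub>F n in sequentially.
     \<bar>(\<Sum>i<n. Y i \<omega>) / real n - expectation (Y 0)\<bar> < 3 * (1 / real (Suc j))"
    unfolding AE_all_countable by (intro allI ae) simp
  then show ?thesis
  proof eventually_elim
    case (elim \<omega>)
    show ?case
    proof (rule tendstoI)
      fix e :: real assume "e > 0"
      then obtain j where j: "1 / real (Suc j) < e / 3" using nat_approx_posE[of "e/3"] by auto
      show "\<forall>\<^sub>F n in sequentially. dist ((\<Sum>i<n. Y i \<omega>) / real n) (expectation (Y 0)) < e"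
        using elim[rule_format, of j] by eventually_elim (use j in \<open>auto simp: dist_real_def\<close>)
    qed
  qed
qed

end

section \<open>Weighted empirical measures of independent samples\<close>

text \<open>A countable family that tests weak convergence from below: finite maxima of rational multiples of
  indicators of basic open sets. Countability lets one null set serve all test functions.\<close>
lemma countable_lower_approximation:
  obtains h :: "nat \<Rightarrow> 'a::{second_countable_topology, t2_space} \<Rightarrow> real" where
    "\<And>n. h n \<in> borel_measurable borel" "\<And>n x. 0 \<le> h n x" "\<And>n. \<exists>B. \<forall>x. h n x \<le> B"
    "\<And>f. continuous_on UNIV f \<Longrightarrow> (\<And>x. 0 \<le> f x) \<Longrightarrow>
       \<exists>s. \<forall>x. (\<lambda>k. h (s k) x) \<longlonglongrightarrow> f x \<and> (\<forall>k :: nat. h (s k) x \<le> f x)"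
proof -
  obtain \<B> :: "'a set set" where \<B>: "countable \<B>" "topological_basis \<B>"
    using ex_countable_basis by blast
  define I where "I = {q :: rat. 0 \<le> q} \<times> \<B>"
  have "countable I" unfolding I_def using \<B> by auto
  have "\<B> \<noteq> {}" using topological_basisE[OF \<B>(2), of UNIV undefined] by auto
  then have "I \<noteq> {}" by (auto simp: I_def)
  define g :: "nat \<Rightarrow> 'a \<Rightarrow> real" where
    "g = (\<lambda>n x. real_of_rat (fst (from_nat_into I n)) * indicator (snd (from_nat_into I n)) x)"
  have inI: "from_nat_into I n \<in> I" for n using \<open>I \<noteq> {}\<close> by (rule from_nat_into)
  have "open (snd (from_nat_into I n))" for n
    using inI[of n] topological_basis_open[OF \<B>(2)] by (auto simp: I_def)
  then have g_meas: "g n \<in> borel_measurable borel" for n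
    unfolding g_def by (intro borel_measurable_times borel_measurable_indicator borel_open) auto
  have q0: "0 \<le> fst (from_nat_into I n)" for n using inI[of n] by (auto simp: I_def)
  have g_bound: "g n x \<le> real_of_rat (fst (from_nat_into I n))" for n x
    using q0[of n] by (auto simp: g_def indicator_def)
  define h where "h = (\<lambda>n x. Max (insert 0 ((\<lambda>i. g i x) ` set_decode n)))"
  have h_ge: "g i x \<le> h n x" if "i \<in> set_decode n" for i n x
    unfolding h_def using that by (intro Max_ge) auto
  have h_le: "h n x \<le> c" if "0 \<le> c" "\<And>i. i \<in> set_decode n \<Longrightarrow> g i x \<le> c" for n x c
    unfolding h_def using that by (subst Max_le_iff) auto
  have h0: "0 \<le> h n x" for n x unfolding h_def by (intro Max_ge) auto
  show ?thesis
  proof (rule that)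
    have "h n = (\<lambda>x. Max ((\<lambda>i. case i of None \<Rightarrow> 0 | Some i \<Rightarrow> g i x) ` insert None (Some ` set_decode n)))" for n
      unfolding h_def by (simp add: image_image)
    then show "h n \<in> borel_measurable borel" for n
      using g_meas by (simp only:, intro borel_measurable_Max) (auto split: option.splits)
    show "0 \<le> h n x" for n x by (rule h0)
    show "\<exists>B. \<forall>x. h n x \<le> B" for n
    proof (intro exI allI h_le)
      show "0 \<le> (\<Sum>i\<in>set_decode n. real_of_rat (fst (from_nat_into I i)))"
        using q0 by (intro sum_nonneg) auto
      fix x i assume "i \<in> set_decode n"
      then show "g i x \<le> (\<Sum>i\<in>set_decode n. real_of_rat (fst (from_nat_into I i)))"
        using q0 by (intro order_trans[OF g_bound] member_le_sum) auto
    qed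
    fix f :: "'a \<Rightarrow> real" assume cont: "continuous_on UNIV f" and f0: "\<And>x. 0 \<le> f x"
    define s where "s = (\<lambda>k. set_encode {i. i \<le> k \<and> (\<forall>x. g i x \<le> f x)})"
    have s: "set_decode (s k) = {i. i \<le> k \<and> (\<forall>x. g i x \<le> f x)}" for k
      unfolding s_def by (rule set_encode_inverse) simp
    have le: "h (s k) x \<le> f x" for k x by (rule h_le) (auto simp: s f0)
    have "(\<lambda>k. h (s k) x) \<longlonglongrightarrow> f x" for x
    proof (rule order_tendstoI)
      fix c assume c: "c < f x"
      show "\<forall>\<^sub>F k in sequentially. c < h (s k) x"
      proof (cases "c < 0")
        case True
        then show ?thesis using h0[of _ x] by (auto intro: always_eventually less_le_trans)
      next
        case False
        obtain q where q: "c < real_of_rat q" "real_of_rat q < f x" using of_rat_dense[OF c] by blast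
        have "open {y. real_of_rat q < f y}" by (intro open_Collect_less cont continuous_on_const)
        then obtain U where U: "U \<in> \<B>" "x \<in> U" "U \<subseteq> {y. real_of_rat q < f y}"
          using topological_basisE[OF \<B>(2), of "{y. real_of_rat q < f y}" x] q by auto
        have "0 \<le> real_of_rat q" using q False by linarith
        then have "(q, U) \<in> I" using U by (auto simp: I_def)
        then obtain i where i: "from_nat_into I i = (q, U)"
          using from_nat_into_surj[OF \<open>countable I\<close>] by blast
        have "g i y \<le> f y" for y using U f0[of y] by (auto simp: g_def i indicator_def)
        then have mem: "i \<in> set_decode (s k)" if "i \<le> k" for k using that by (simp add: s)
        have "c < g i x" using U q by (simp add: g_def i)
        then show ?thesis
          using h_ge[OF mem] by (intro eventually_sequentiallyI[of i]) (auto intro: less_le_trans)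
      qed
    next
      fix c assume "f x < c"
      then show "\<forall>\<^sub>F k in sequentially. h (s k) x < c"
        using le by (auto intro: always_eventually le_less_trans)
    qed
    then show "\<exists>s. \<forall>x. (\<lambda>k. h (s k) x) \<longlonglongrightarrow> f x \<and> (\<forall>k :: nat. h (s k) x \<le> f x)"
      using le by blast
  qed
qed

text \<open>The strong law for the countable family bounds the lower limit of the averages of every nonnegative
  continuous \<open>f\<close> from below. Applied to \<open>B + f\<close> and \<open>B - f\<close>, where \<open>B\<close> bounds \<open>f\<close>, this gives
  convergence.\<close>
lemma (in prob_space) AE_weighted_empirical_convergence:
  fixes X :: "nat \<Rightarrow> 'a \<Rightarrow> 'b::{second_countable_topology, t2_space}"
  assumes indep: "indep_vars (\<lambda>_. borel) X UNIV" and law: "\<And>i. distr M borel (X i) = \<mu>"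
    and G: "integrable \<mu> G" and G0: "\<And>x. 0 \<le> G x"
  shows "AE \<omega> in M. \<forall>f. continuous_on UNIV f \<longrightarrow> bounded (range f) \<longrightarrow>
     (\<lambda>n. (\<Sum>i<n. G (X i \<omega>) * f (X i \<omega>)) / real n) \<longlonglongrightarrow> (\<integral>x. G x * f x \<partial>\<mu>)"
proof -
  have [measurable]: "X i \<in> borel_measurable M" for i
    using indep unfolding indep_vars_def by blast
  have sets[measurable_cong]: "sets \<mu> = sets borel" using law[of 0, symmetric] by simp
  have Gm[measurable]: "G \<in> borel_measurable borel"
    using borel_measurable_integrable[OF G] by simp
  obtain h :: "nat \<Rightarrow> 'b \<Rightarrow> real" where h[measurable]: "\<And>n. h n \<in> borel_measurable borel"
    and h0: "\<And>n x. 0 \<le> h n x" and hB: "\<And>n. \<exists>B. \<forall>x. h n x \<le> B"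
    and approx: "\<And>f. continuous_on UNIV f \<Longrightarrow> (\<And>x. 0 \<le> f x) \<Longrightarrow>
       \<exists>s. \<forall>x. (\<lambda>k. h (s k) x) \<longlonglongrightarrow> f x \<and> (\<forall>k :: nat. h (s k) x \<le> f x)"
    by (rule countable_lower_approximation[where 'a = 'b]) blast
  have int: "integrable \<mu> (\<lambda>x. G x * f x)"
    if [measurable]: "f \<in> borel_measurable borel" and "\<And>x. \<bar>f x\<bar> \<le> B" for f B
  proof (rule Bochner_Integration.integrable_bound)
    show "integrable \<mu> (\<lambda>x. G x * B)" using G by simp
    show "AE x in \<mu>. norm (G x * f x) \<le> norm (G x * B)"
      using that(2) G0 by (intro AE_I2) (auto simp: abs_mult intro!: mult_left_mono order_trans[OF _ abs_ge_self])
  qed (use sets in measurable)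
  have slln: "AE \<omega> in M. (\<lambda>n. (\<Sum>i<n. G (X i \<omega>) * f (X i \<omega>)) / real n) \<longlonglongrightarrow> (\<integral>x. G x * f x \<partial>\<mu>)"
    if f[measurable]: "f \<in> borel_measurable borel" and "\<And>x. \<bar>f x\<bar> \<le> B" for f B
  proof -
    have "AE \<omega> in M. (\<lambda>n. (\<Sum>i<n. G (X i \<omega>) * f (X i \<omega>)) / real n)
        \<longlonglongrightarrow> expectation (\<lambda>\<omega>. G (X 0 \<omega>) * f (X 0 \<omega>))"
    proof (rule strong_law_of_large_numbers[where Y = "\<lambda>i \<omega>. G (X i \<omega>) * f (X i \<omega>)"])
      show "indep_vars (\<lambda>_. borel) (\<lambda>i \<omega>. G (X i \<omega>) * f (X i \<omega>)) UNIV"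
        by (rule indep_vars_compose2[OF indep, of "\<lambda>_ x. G x * f x"]) simp
      have "distr M borel (\<lambda>\<omega>. G (X i \<omega>) * f (X i \<omega>)) = distr \<mu> borel (\<lambda>x. G x * f x)" for i
        unfolding law[of i, symmetric] by (simp add: distr_distr comp_def)
      then show "distr M borel (\<lambda>\<omega>. G (X i \<omega>) * f (X i \<omega>)) = distr M borel (\<lambda>\<omega>. G (X 0 \<omega>) * f (X 0 \<omega>))" for i
        by simp
      show "integrable M (\<lambda>\<omega>. G (X 0 \<omega>) * f (X 0 \<omega>))"
        using int[OF that] unfolding law[of 0, symmetric] by (subst (asm) integrable_distr_eq) auto
    qed
    also have "expectation (\<lambda>\<omega>. G (X 0 \<omega>) * f (X 0 \<omega>)) = (\<integral>x. G x * f x \<partial>\<mu>)"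
      unfolding law[of 0, symmetric] by (simp add: integral_distr)
    finally show ?thesis .
  qed
  have "AE \<omega> in M. (\<lambda>n. (\<Sum>i<n. G (X i \<omega>) * 1) / real n) \<longlonglongrightarrow> (\<integral>x. G x * 1 \<partial>\<mu>)"
    by (rule slln[of _ 1]) auto
  moreover have "AE \<omega> in M. \<forall>m. (\<lambda>n. (\<Sum>i<n. G (X i \<omega>) * h m (X i \<omega>)) / real n) \<longlonglongrightarrow> (\<integral>x. G x * h m x \<partial>\<mu>)"
    unfolding AE_all_countable
  proof
    fix m obtain B where "\<And>x. h m x \<le> B" using hB by blast
    then show "AE \<omega> in M. (\<lambda>n. (\<Sum>i<n. G (X i \<omega>) * h m (X i \<omega>)) / real n) \<longlonglongrightarrow> (\<integral>x. G x * h m x \<partial>\<mu>)"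
      by (intro slln[of _ B]) (auto simp: h0)
  qed
  ultimately show ?thesis
  proof eventually_elim
    case (elim \<omega>)
    define A where "A = (\<lambda>f n. (\<Sum>i<n. G (X i \<omega>) * f (X i \<omega>)) / real n)"
    have A_mono: "A f n \<le> A g n" if "\<And>x. f x \<le> g x" for f g n
      unfolding A_def using G0 that by (intro divide_right_mono sum_mono mult_left_mono) auto
    have lower: "\<forall>\<^sub>F n in sequentially. c < A f n"
      if cont: "continuous_on UNIV f" and f0: "\<And>x. 0 \<le> f x" and fB: "\<And>x. f x \<le> B"
        and c: "c < (\<integral>x. G x * f x \<partial>\<mu>)" for f B c
    proof -
      have [measurable]: "f \<in> borel_measurable borel" using cont by (rule borel_measurable_continuous_onI)
      obtain s where s: "\<And>x. (\<lambda>k. h (s k) x) \<longlonglongrightarrow> f x" "\<And>x k. h (s k) x \<le> f x"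
        using approx[OF cont f0] by blast
      have "(\<lambda>k. \<integral>x. G x * h (s k) x \<partial>\<mu>) \<longlonglongrightarrow> (\<integral>x. G x * f x \<partial>\<mu>)"
      proof (rule integral_dominated_convergence[where w = "\<lambda>x. G x * f x"])
        show "integrable \<mu> (\<lambda>x. G x * f x)" by (rule int[of f B]) (use f0 fB in auto)
        show "AE x in \<mu>. (\<lambda>k. G x * h (s k) x) \<longlonglongrightarrow> G x * f x"
          by (intro AE_I2 tendsto_mult tendsto_const s)
        show "AE x in \<mu>. norm (G x * h (s k) x) \<le> G x * f x" for k
          using G0 s(2) h0 by (intro AE_I2) (auto simp: abs_mult intro!: mult_left_mono)
      qed (use sets in measurable)
      from eventually_happens'[OF sequentially_bot order_tendstoD(1)[OF this c]]
      obtain k where k: "c < (\<integral>x. G x * h (s k) x \<partial>\<mu>)" by blast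
      have "\<forall>\<^sub>F n in sequentially. c < A (h (s k)) n"
        using order_tendstoD(1)[OF elim(2)[rule_format, of "s k"] k] unfolding A_def .
      then show ?thesis by eventually_elim (use A_mono[of "h (s k)" f] s(2) in \<open>auto intro: less_le_trans\<close>)
    qed
    show ?case
    proof (intro allI impI)
      fix f :: "'b \<Rightarrow> real" assume cont: "continuous_on UNIV f" and "bounded (range f)"
      then obtain B where B: "\<And>x. \<bar>f x\<bar> \<le> B" by (auto simp: bounded_iff)
      have [measurable]: "f \<in> borel_measurable borel" using cont by (rule borel_measurable_continuous_onI)
      have fi: "integrable \<mu> (\<lambda>x. G x * f x)" by (rule int[of f B]) (use B in auto)
      have one: "(\<lambda>n. B * A (\<lambda>_. 1) n) \<longlonglongrightarrow> B * (\<integral>x. G x \<partial>\<mu>)"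
        using elim(1) unfolding A_def by (intro tendsto_intros) simp
      have Ap: "A (\<lambda>x. B + f x) n = B * A (\<lambda>_. 1) n + A f n"
        and Am: "A (\<lambda>x. B - f x) n = B * A (\<lambda>_. 1) n - A f n" for n
        by (simp_all add: A_def algebra_simps sum.distrib sum_subtractf sum_distrib_left add_divide_distrib diff_divide_distrib)
      have Ip: "(\<integral>x. G x * (B + f x) \<partial>\<mu>) = B * (\<integral>x. G x \<partial>\<mu>) + (\<integral>x. G x * f x \<partial>\<mu>)"
        and Im: "(\<integral>x. G x * (B - f x) \<partial>\<mu>) = B * (\<integral>x. G x \<partial>\<mu>) - (\<integral>x. G x * f x \<partial>\<mu>)"
        using G fi by (simp_all add: algebra_simps)
      have ab: "- B \<le> f x" "f x \<le> B" for x using B[of x] by (auto simp: abs_le_iff)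
      have lowp: "\<forall>\<^sub>F n in sequentially. c < A (\<lambda>x. B + f x) n" if "c < (\<integral>x. G x * (B + f x) \<partial>\<mu>)" for c
      proof (rule lower[of _ "2 * B"])
        show "0 \<le> B + f x" "B + f x \<le> 2 * B" for x using ab[of x] by auto
      qed (intro continuous_intros cont that)+
      have lowm: "\<forall>\<^sub>F n in sequentially. c < A (\<lambda>x. B - f x) n" if "c < (\<integral>x. G x * (B - f x) \<partial>\<mu>)" for c
      proof (rule lower[of _ "2 * B"])
        show "0 \<le> B - f x" "B - f x \<le> 2 * B" for x using ab[of x] by auto
      qed (intro continuous_intros cont that)+
      have "A f \<longlonglongrightarrow> (\<integral>x. G x * f x \<partial>\<mu>)"
      proof (rule tendstoI)
        fix e :: real assume e: "0 < e"
        have "\<forall>\<^sub>F n in sequentially. dist (B * A (\<lambda>_. 1) n) (B * (\<integral>x. G x \<partial>\<mu>)) < e / 2"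
          using one e by (intro tendstoD) auto
        moreover have "\<forall>\<^sub>F n in sequentially. (\<integral>x. G x * (B + f x) \<partial>\<mu>) - e / 2 < A (\<lambda>x. B + f x) n"
          using e by (intro lowp) auto
        moreover have "\<forall>\<^sub>F n in sequentially. (\<integral>x. G x * (B - f x) \<partial>\<mu>) - e / 2 < A (\<lambda>x. B - f x) n"
          using e by (intro lowm) auto
        ultimately show "\<forall>\<^sub>F n in sequentially. dist (A f n) (\<integral>x. G x * f x \<partial>\<mu>) < e"
        proof eventually_elim
          case (elim n)
          then show ?case unfolding Ap Am Ip Im dist_real_def abs_less_iff by linarith
        qed
      qed
      then show "(\<lambda>n. (\<Sum>i<n. G (X i \<omega>) * f (X i \<omega>)) / real n) \<longlonglongrightarrow> (\<integral>x. G x * f x \<partial>\<mu>)"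
        unfolding A_def .
    qed
  qed
qed

section \<open>Cyclically monotone relations and their potentials\<close>

text \<open>A cycle of length \<open>n\<close> is a chain of \<open>n\<close> links that returns to its first point, which avoids indices
  modulo \<open>n\<close>.\<close>
definition cyclically_monotone :: "('a::real_inner \<times> 'a) set \<Rightarrow> bool" where
  "cyclically_monotone \<Gamma> \<longleftrightarrow>
     (\<forall>n z. (\<forall>i\<le>n. z i \<in> \<Gamma>) \<and> z n = z 0 \<longrightarrow>
        (\<Sum>i<n. snd (z i) \<bullet> (fst (z (Suc i)) - fst (z i))) \<le> 0)"

definition monotone_relation :: "('a::real_inner \<times> 'a) set \<Rightarrow> bool" where
  "monotone_relation \<Gamma> \<longleftrightarrow>
     (\<forall>x y x' y'. (x, y) \<in> \<Gamma> \<longrightarrow> (x', y') \<in> \<Gamma> \<longrightarrow> 0 \<le> (y' - y) \<bullet> (x' - x))"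

lemma cyclically_monotone_imp_monotone:
  assumes "cyclically_monotone \<Gamma>"
  shows "monotone_relation \<Gamma>"
  unfolding monotone_relation_def
proof (intro allI impI)
  fix x y x' y' assume xy: "(x, y) \<in> \<Gamma>" "(x', y') \<in> \<Gamma>"
  define z where "z = (\<lambda>i::nat. if i = 1 then (x', y') else (x, y))"
  have "(\<Sum>i<2. snd (z i) \<bullet> (fst (z (Suc i)) - fst (z i))) \<le> 0"
    using assms[unfolded cyclically_monotone_def, rule_format, of 2 z] xy by (auto simp: z_def)
  then show "0 \<le> (y' - y) \<bullet> (x' - x)"
    by (simp add: z_def numeral_2_eq_2 algebra_simps)
qed

lemma monotone_relation_closure:
  assumes "monotone_relation \<Gamma>"
  shows "monotone_relation (closure \<Gamma>)"
proof -
  let ?C = "{p :: ('a \<times> 'a) \<times> 'a \<times> 'a. 0 \<le> (snd (snd p) - snd (fst p)) \<bullet> (fst (snd p) - fst (fst p))}"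
  have "closed ?C" by (intro closed_Collect_le continuous_intros)
  moreover have "\<Gamma> \<times> \<Gamma> \<subseteq> ?C" using assms by (auto simp: monotone_relation_def)
  ultimately have "closure \<Gamma> \<times> closure \<Gamma> \<subseteq> ?C"
    unfolding closure_Times[symmetric] by (simp add: closure_minimal)
  then have "((x, y), (x', y')) \<in> ?C" if "(x, y) \<in> closure \<Gamma>" "(x', y') \<in> closure \<Gamma>" for x y x' y'
    using that by blast
  then show ?thesis by (simp add: monotone_relation_def)
qed

text \<open>The family may be uncountable: the supremum is lower semicontinuous.\<close>
lemma SUP_continuous_measurable:
  fixes h :: "'i \<Rightarrow> 'a::topological_space \<Rightarrow> real"
  assumes "\<And>i. i \<in> I \<Longrightarrow> continuous_on UNIV (h i)"
  shows "(\<lambda>x. SUP i\<in>I. ereal (h i x)) \<in> borel_measurable borel"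
proof (rule borel_measurableI_greater)
  fix y :: ereal
  have "open {x. y < ereal (h i x)}" if "i \<in> I" for i
    by (intro open_Collect_less continuous_intros assms that)
  then have "open (\<Union>i\<in>I. {x. y < ereal (h i x)})" by auto
  also have "(\<Union>i\<in>I. {x. y < ereal (h i x)}) = {x \<in> space borel. y < (SUP i\<in>I. ereal (h i x))}"
    by (auto simp: less_SUP_iff)
  finally show "{x \<in> space borel. y < (SUP i\<in>I. ereal (h i x))} \<in> sets borel" by (rule borel_open)
qed

text \<open>Rockafellar's theorem. Fixing a point of \<open>\<Gamma>\<close>, \<open>f\<close> is the supremum, over all chains in \<open>\<Gamma>\<close> that start
  there, of the affine functions \<open>a\<close> that add up the increments along the chain; cyclical
  monotonicity keeps it finite on the domain of \<open>\<Gamma>\<close>. The function \<open>g\<close> is its convex conjugate. The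
  sets \<open>D\<close> and \<open>E\<close> are those where the two are finite, which allows real-valued potentials.\<close>
lemma cyclically_monotone_potentials:
  fixes \<Gamma> :: "('a::euclidean_space \<times> 'a) set"
  assumes cm: "cyclically_monotone \<Gamma>"
  obtains f g :: "'a \<Rightarrow> real" and D E where
    "f \<in> borel_measurable borel" "g \<in> borel_measurable borel" "D \<in> sets borel" "E \<in> sets borel"
    "\<And>x y. x \<in> D \<Longrightarrow> y \<in> E \<Longrightarrow> x \<bullet> y \<le> f x + g y"
    "\<And>x y. (x, y) \<in> \<Gamma> \<Longrightarrow> x \<in> D \<and> y \<in> E \<and> f x + g y = x \<bullet> y"
proof (cases "\<Gamma> = {}")
  case True
  then show ?thesis by (intro that[of "\<lambda>_. 0" "\<lambda>_. 0" "{}" "{}"]) auto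
next
  case False
  then obtain x0 y0 where 0: "(x0, y0) \<in> \<Gamma>" by auto
  define C where "C = {(n, z :: nat \<Rightarrow> 'a \<times> 'a). z 0 = (x0, y0) \<and> (\<forall>i\<le>n. z i \<in> \<Gamma>)}"
  define a :: "nat \<times> (nat \<Rightarrow> 'a \<times> 'a) \<Rightarrow> 'a \<Rightarrow> real" where
    "a = (\<lambda>(n, z) x. (\<Sum>i<n. snd (z i) \<bullet> (fst (z (Suc i)) - fst (z i))) + snd (z n) \<bullet> (x - fst (z n)))"
  define \<phi> where "\<phi> = (\<lambda>x. SUP c\<in>C. ereal (a c x))"
  have \<phi>_ge: "ereal (a c x) \<le> \<phi> x" if "c \<in> C" for c x
    unfolding \<phi>_def using that by (rule SUP_upper)
  have c0: "(0, \<lambda>_. (x0, y0)) \<in> C" using 0 by (simp add: C_def)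
  have \<phi>_gt: "\<phi> x \<noteq> - \<infinity>" for x
    using \<phi>_ge[OF c0, of x] by auto
  have \<phi>_meas[measurable]: "\<phi> \<in> borel_measurable borel"
    unfolding \<phi>_def by (rule SUP_continuous_measurable) (auto simp: a_def intro!: continuous_intros)
  \<comment> \<open>Appending a point of \<open>\<Gamma>\<close> to a chain shows that its second component is a subgradient at the first.\<close>
  have sub: "\<phi> x' + ereal (y' \<bullet> (x - x')) \<le> \<phi> x" if "(x', y') \<in> \<Gamma>" for x x' y'
  proof -
    have "ereal (a c x') \<le> \<phi> x - ereal (y' \<bullet> (x - x'))" if c: "c \<in> C" for c
    proof -
      obtain n z where nz: "c = (n, z)" by force
      define c' where "c' = (Suc n, z(Suc n := (x', y')))"
      have "c' \<in> C" using c \<open>(x', y') \<in> \<Gamma>\<close> by (auto simp: c'_def C_def nz le_Suc_eq)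
      moreover have "a c' x = a c x' + y' \<bullet> (x - x')"
        by (simp add: a_def c'_def nz)
      ultimately have "ereal (a c x' + y' \<bullet> (x - x')) \<le> \<phi> x" using \<phi>_ge by metis
      then show ?thesis by (cases "\<phi> x") auto
    qed
    then have "\<phi> x' \<le> \<phi> x - ereal (y' \<bullet> (x - x'))"
      unfolding \<phi>_def by (intro SUP_least) auto
    then show ?thesis by (cases "\<phi> x"; cases "\<phi> x'") auto
  qed
  have \<phi>0: "\<phi> x0 \<le> 0"
    unfolding \<phi>_def
  proof (rule SUP_least)
    fix c assume c: "c \<in> C"
    obtain n z where nz: "c = (n, z)" by force
    define z' where "z' = z(Suc n := (x0, y0))"
    have "(\<Sum>i<Suc n. snd (z' i) \<bullet> (fst (z' (Suc i)) - fst (z' i))) \<le> 0"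
      using cm[unfolded cyclically_monotone_def, rule_format, of "Suc n" z'] c 0
      by (auto simp: z'_def C_def nz le_Suc_eq)
    then show "ereal (a c x0) \<le> 0" using c by (simp add: a_def nz z'_def C_def)
  qed
  have fin: "\<phi> x < \<infinity>" if "(x, y) \<in> \<Gamma>" for x y
    using sub[OF that, of x0] \<phi>0 by (cases "\<phi> x") auto
  define D where "D = {x. \<phi> x < \<infinity>}"
  define f where "f = (\<lambda>x. real_of_ereal (\<phi> x))"
  have f: "\<phi> x = ereal (f x)" if "x \<in> D" for x
    using that \<phi>_gt[of x] by (cases "\<phi> x") (auto simp: D_def f_def)
  define \<psi> where "\<psi> = (\<lambda>y. SUP x\<in>D. ereal (x \<bullet> y - f x))"
  have \<psi>_meas[measurable]: "\<psi> \<in> borel_measurable borel"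
    unfolding \<psi>_def by (rule SUP_continuous_measurable) (auto intro!: continuous_intros)
  have \<psi>_ge: "ereal (x \<bullet> y - f x) \<le> \<psi> y" if "x \<in> D" for x y
    unfolding \<psi>_def using that by (rule SUP_upper)
  have x0D: "x0 \<in> D" using fin[OF 0] by (simp add: D_def)
  define E where "E = {y. \<psi> y < \<infinity>}"
  define g where "g = (\<lambda>y. real_of_ereal (\<psi> y))"
  have g: "\<psi> y = ereal (g y)" if "y \<in> E" for y
    using that \<psi>_ge[OF x0D, of y] by (cases "\<psi> y") (auto simp: E_def g_def)
  show ?thesis
  proof (rule that)
    show "f \<in> borel_measurable borel" "g \<in> borel_measurable borel"
      unfolding f_def g_def by measurable
    show "D \<in> sets borel" "E \<in> sets borel" unfolding D_def E_def by measurable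
    show "x \<bullet> y \<le> f x + g y" if "x \<in> D" "y \<in> E" for x y
      using \<psi>_ge[OF that(1), of y] g[OF that(2)] by simp
    show "x \<in> D \<and> y \<in> E \<and> f x + g y = x \<bullet> y" if xy: "(x, y) \<in> \<Gamma>" for x y
    proof -
      have x: "x \<in> D" using fin[OF xy] by (simp add: D_def)
      have "\<psi> y \<le> ereal (x \<bullet> y - f x)" unfolding \<psi>_def
      proof (rule SUP_least)
        fix x' assume x': "x' \<in> D"
        have "f x + y \<bullet> (x' - x) \<le> f x'" using sub[OF xy, of x'] by (simp add: f[OF x] f[OF x'])
        then show "ereal (x' \<bullet> y - f x') \<le> ereal (x \<bullet> y - f x)"
          by (simp add: algebra_simps inner_commute)
      qed
      then have e: "\<psi> y = ereal (x \<bullet> y - f x)" using \<psi>_ge[OF x, of y] by simp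
      then have "y \<in> E" by (simp add: E_def)
      with x e g show ?thesis by simp
    qed
  qed
qed

section \<open>Monotone relations are single-valued almost everywhere\<close>

text \<open>The translates of \<open>K\<close> by \<open>b / 1\<close>, \<open>b / 2\<close>, \<open>b / 3\<close>, ... are disjoint, have equal measure and lie in one
  ball.\<close>
lemma compact_meeting_lines_once_null:
  fixes K :: "'a::euclidean_space set"
  assumes K: "compact K"
    and once: "\<And>x s. x \<in> K \<Longrightarrow> x + s *\<^sub>R b \<in> K \<Longrightarrow> s = 0"
  shows "K \<in> null_sets lborel"
proof -
  obtain R where R: "\<And>x. x \<in> K \<Longrightarrow> norm x \<le> R"
    using compact_imp_bounded[OF K] by (auto simp: bounded_iff)
  define t where "t = (\<lambda>n. - (1 / real (Suc n)) *\<^sub>R b)"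
  define T where "T = (\<lambda>n. (+) (t n) -` K)"
  have Kb[measurable]: "K \<in> sets borel" using K by (simp add: borel_compact)
  have T: "T n \<in> sets borel" for n
    unfolding T_def using measurable_sets_borel[OF _ Kb, of "(+) (t n)"] by simp
  have eT: "emeasure lborel (T n) = emeasure lborel K" for n
  proof -
    have "emeasure lborel K = emeasure (distr lborel borel ((+) (t n))) K"
      by (simp only: lborel_distr_plus)
    also have "\<dots> = emeasure lborel (T n)" by (subst emeasure_distr) (auto simp: T_def)
    finally show ?thesis by simp
  qed
  have disj: "disjoint_family_on T I" for I
    unfolding disjoint_family_on_def
  proof (intro ballI impI equals0I)
    fix m n x assume mn: "m \<noteq> n" and x: "x \<in> T m \<inter> T n"
    have "t m + x + (1 / real (Suc m) - 1 / real (Suc n)) *\<^sub>R b = t n + x"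
      by (simp add: t_def scaleR_left_diff_distrib)
    then have "t m + x + (1 / real (Suc m) - 1 / real (Suc n)) *\<^sub>R b \<in> K"
      using x by (metis Int_iff T_def vimage_eq)
    moreover have "t m + x \<in> K" using x by (simp add: T_def)
    ultimately have "1 / real (Suc m) - 1 / real (Suc n) = 0" by (rule once[rotated])
    then show False using mn by simp
  qed
  have sub: "T n \<subseteq> cball 0 (R + norm b)" for n
  proof
    fix x assume x: "x \<in> T n"
    have "norm (t n + x) \<le> R" using R x by (simp add: T_def)
    moreover have "norm (t n) \<le> norm b" unfolding t_def
      using mult_left_mono[of 1 "1 + real n" "norm b"] by (simp add: divide_le_eq)
    moreover have "norm x \<le> norm (t n + x) + norm (t n)"
      using norm_triangle_ineq4[of "t n + x" "t n"] by simp
    ultimately show "x \<in> cball 0 (R + norm b)" by simp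
  qed
  define B where "B = measure lborel (cball (0::'a) (R + norm b))"
  have B: "emeasure lborel (cball (0::'a) (R + norm b)) = ennreal B"
    unfolding B_def by (rule emeasure_eq_ennreal_measure) (use emeasure_compact_finite[of "cball (0::'a) (R + norm b)"] in auto)
  define c where "c = measure lborel K"
  have c: "emeasure lborel K = ennreal c" "c \<ge> 0"
    unfolding c_def by (rule emeasure_eq_ennreal_measure) (use emeasure_compact_finite[OF K] in auto)
  have "real n * c \<le> B" for n
  proof -
    have "ennreal (real n * c) = (\<Sum>i<n. emeasure lborel (T i))"
      using c by (simp add: eT ennreal_mult ennreal_of_nat_eq_real_of_nat)
    also have "\<dots> = emeasure lborel (\<Union>i<n. T i)"
      by (rule sum_emeasure) (use T disj in auto)
    also have "\<dots> \<le> ennreal B" unfolding B[symmetric] by (rule emeasure_mono) (use sub in auto)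
    finally show ?thesis by (simp add: B_def)
  qed
  then have "c = 0" using c(2) by (metis reals_Archimedean3 less_eq_real_def not_less)
  then show ?thesis using c Kb by (simp add: null_sets_def)
qed

text \<open>If \<open>x\<close> has two images that differ in the coordinate \<open>b\<close>, then two rationals \<open>q < q'\<close> separate them in
  this coordinate. Monotonicity on the line through \<open>x\<close> in direction \<open>b\<close> orders the images, so for
  fixed \<open>b\<close>, \<open>q\<close>, \<open>q'\<close> every such line contains at most one \<open>x\<close>. Passing to the closure of \<open>\<Gamma>\<close>, which is
  again monotone, makes the exceptional set a countable union of compact sets.\<close>
lemma monotone_relation_single_valued:
  fixes \<Gamma> :: "('a::euclidean_space \<times> 'a) set"
  assumes "monotone_relation \<Gamma>"
  obtains N where "N \<in> null_sets lborel"
    "\<And>x y y'. (x, y) \<in> \<Gamma> \<Longrightarrow> (x, y') \<in> \<Gamma> \<Longrightarrow> x \<notin> N \<Longrightarrow> y = y'"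
proof -
  define \<Delta> where "\<Delta> = closure \<Gamma>"
  have \<Delta>: "closed \<Delta>" "\<Gamma> \<subseteq> \<Delta>" by (auto simp: \<Delta>_def closure_subset)
  have mono: "0 \<le> (y' - y) \<bullet> (x' - x)" if "(x, y) \<in> \<Delta>" "(x', y') \<in> \<Delta>" for x y x' y'
    using monotone_relation_closure[OF assms] that unfolding \<Delta>_def monotone_relation_def by blast
  \<comment> \<open>Triples (point, lower image, upper image); the bound \<open>R\<close> makes the set compact.\<close>
  define P where "P = (\<lambda>b q q' (R::nat). {p :: 'a \<times> 'a \<times> 'a. p \<in> cball 0 R \<and> (fst p, fst (snd p)) \<in> \<Delta> \<and>
     (fst p, snd (snd p)) \<in> \<Delta> \<and> fst (snd p) \<bullet> b \<le> real_of_rat q \<and> real_of_rat q' \<le> snd (snd p) \<bullet> b})"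
  have P: "compact (P b q q' R)" for b q q' R
  proof -
    have "P b q q' R = cball 0 (real R) \<inter> (((\<lambda>p. (fst p, fst (snd p))) -` \<Delta>) \<inter> (((\<lambda>p. (fst p, snd (snd p))) -` \<Delta>)
       \<inter> ({p. fst (snd p) \<bullet> b \<le> real_of_rat q} \<inter> {p. real_of_rat q' \<le> snd (snd p) \<bullet> b})))"
      unfolding P_def by auto
    also have "compact \<dots>"
      by (intro compact_Int_closed compact_cball closed_Int closed_vimage \<Delta> closed_Collect_le continuous_intros)
    finally show ?thesis .
  qed
  define I where "I = {(b, q :: rat, q', R :: nat). b \<in> (Basis :: 'a set) \<and> q < q'}"
  have null: "fst ` P b q q' R \<in> null_sets lborel" if "q < q'" for b q q' R
  proof (rule compact_meeting_lines_once_null)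
    show "compact (fst ` P b q q' R)" by (intro compact_continuous_image P continuous_intros)
    fix x s assume "x \<in> fst ` P b q q' R" "x + s *\<^sub>R b \<in> fst ` P b q q' R"
    then obtain y y' z z' where xy: "(x, y) \<in> \<Delta>" "(x, y') \<in> \<Delta>" "(x + s *\<^sub>R b, z) \<in> \<Delta>" "(x + s *\<^sub>R b, z') \<in> \<Delta>"
      and q: "y \<bullet> b \<le> real_of_rat q" "z \<bullet> b \<le> real_of_rat q" "real_of_rat q' \<le> y' \<bullet> b" "real_of_rat q' \<le> z' \<bullet> b"
      unfolding P_def by auto
    have qq: "real_of_rat q < real_of_rat q'" using that by (simp add: of_rat_less)
    have 1: "0 \<le> s * (z \<bullet> b - y' \<bullet> b)" using mono[OF xy(2,3)] by (simp add: inner_diff_left)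
    have 2: "0 \<le> s * (z' \<bullet> b - y \<bullet> b)" using mono[OF xy(1,4)] by (simp add: inner_diff_left)
    have "z \<bullet> b - y' \<bullet> b < 0" "0 < z' \<bullet> b - y \<bullet> b" using q qq by auto
    then have "s * (z \<bullet> b - y' \<bullet> b) < 0" if "0 < s" using that by (intro mult_pos_neg)
    moreover have "s * (z' \<bullet> b - y \<bullet> b) < 0" if "s < 0"
      using that \<open>0 < z' \<bullet> b - y \<bullet> b\<close> by (intro mult_neg_pos)
    ultimately show "s = 0" using 1 2 by force
  qed
  define N where "N = (\<Union>(b, q, q', R)\<in>I. fst ` P b q q' R)"
  show ?thesis
  proof (rule that)
    have "countable (Basis :: 'a set)" by (rule countable_finite) simp
    then have "countable ((Basis :: 'a set) \<times> (UNIV :: rat set) \<times> (UNIV :: rat set) \<times> (UNIV :: nat set))"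
      by (intro countable_SIGMA) auto
    then have "countable I" by (rule countable_subset[rotated]) (auto simp: I_def)
    then show "N \<in> null_sets lborel"
      unfolding N_def by (intro null_sets_UN') (auto simp: I_def intro: null)
    show "y = y'" if "(x, y) \<in> \<Gamma>" "(x, y') \<in> \<Gamma>" "x \<notin> N" for x y y'
    proof (rule ccontr)
      assume "y \<noteq> y'"
      have *: False if y: "(x, y) \<in> \<Delta>" "(x, y') \<in> \<Delta>" and b: "b \<in> Basis" "y \<bullet> b < y' \<bullet> b" for y y' b
      proof -
        obtain r where r: "y \<bullet> b < real_of_rat r" "real_of_rat r < y' \<bullet> b"
          using of_rat_dense[OF b(2)] by blast
        obtain r' where r': "real_of_rat r < real_of_rat r'" "real_of_rat r' < y' \<bullet> b"
          using of_rat_dense[OF r(2)] by blast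
        obtain R :: nat where R: "norm (x, y, y') \<le> real R" using real_arch_simple by blast
        have "(x, y, y') \<in> P b r r' R" using y r r' R by (auto simp: P_def)
        then have "x \<in> fst ` P b r r' R" by force
        moreover have "(b, r, r', R) \<in> I" using b r' by (auto simp: I_def of_rat_less)
        ultimately show False using \<open>x \<notin> N\<close> unfolding N_def by blast
      qed
      obtain b where b: "b \<in> Basis" "y \<bullet> b \<noteq> y' \<bullet> b" using \<open>y \<noteq> y'\<close> euclidean_eqI by blast
      then show False using *[of y y' b] *[of y' y b] that(1,2) \<Delta>(2) by (meson linorder_less_linear subsetD)
    qed
  qed
qed

section \<open>Uniqueness and minimality of cyclically monotone transport\<close>

lemma AE_distr_transfer:
  assumes "distr M borel T = distr M borel U" and [measurable]: "T \<in> borel_measurable M" "U \<in> borel_measurable M"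
    and [measurable]: "E \<in> sets borel" and "AE x in M. U x \<in> E"
  shows "AE x in M. T x \<in> E"
proof -
  have "AE y in distr M borel U. y \<in> E" using assms(5) by (subst AE_distr_iff) auto
  then show ?thesis unfolding assms(1)[symmetric] by (subst (asm) AE_distr_iff) auto
qed

lemma integral_distr_transfer:
  fixes h :: "'b::topological_space \<Rightarrow> real"
  assumes "distr M borel T = distr M borel U" and [measurable]: "T \<in> borel_measurable M" "U \<in> borel_measurable M"
    and [measurable]: "h \<in> borel_measurable borel"
  shows "(\<integral>x. h (T x) \<partial>M) = (\<integral>x. h (U x) \<partial>M)"
  using arg_cong[OF assms(1), of "\<lambda>D. \<integral>y. h y \<partial>D"] by (simp add: integral_distr)

text \<open>Both marginals of the two plans agree, so a bounded function of the form \<open>a x + b y\<close> has the same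
  integral under both. Choosing \<open>a\<close> and \<open>b\<close> as arctangents of differences of potentials, this
  function is nonpositive on the first graph and nonnegative on the second, since the arctangent is
  odd and increasing. It therefore vanishes on the first graph, which then lies in the relation \<open>\<Gamma>\<close>
  where the second pair of potentials attains equality.\<close>
lemma cyclically_monotone_transport_unique:
  fixes T1 T2 :: "'a::euclidean_space \<Rightarrow> 'a"
  assumes "prob_space \<mu>" and sets[measurable_cong]: "sets \<mu> = sets borel" and ac: "null_sets lborel \<subseteq> null_sets \<mu>"
    and [measurable]: "T1 \<in> borel_measurable borel" "T2 \<in> borel_measurable borel"
    and marg: "distr \<mu> borel T1 = distr \<mu> borel T2"
    and cm: "cyclically_monotone \<Gamma>1" "cyclically_monotone \<Gamma>2"
    and on1: "AE x in \<mu>. (x, T1 x) \<in> \<Gamma>1" and on2: "AE x in \<mu>. (x, T2 x) \<in> \<Gamma>2"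
  shows "AE x in \<mu>. T1 x = T2 x"
proof -
  interpret prob_space \<mu> by fact
  obtain f1 g1 D1 E1 where [measurable]: "f1 \<in> borel_measurable borel" "g1 \<in> borel_measurable borel"
      "D1 \<in> sets borel" "E1 \<in> sets borel"
    and le1: "\<And>x y. x \<in> D1 \<Longrightarrow> y \<in> E1 \<Longrightarrow> x \<bullet> y \<le> f1 x + g1 y"
    and eq1: "\<And>x y. (x, y) \<in> \<Gamma>1 \<Longrightarrow> x \<in> D1 \<and> y \<in> E1 \<and> f1 x + g1 y = x \<bullet> y"
    by (rule cyclically_monotone_potentials[OF cm(1)]) blast
  obtain f2 g2 D2 E2 where [measurable]: "f2 \<in> borel_measurable borel" "g2 \<in> borel_measurable borel"
      "D2 \<in> sets borel" "E2 \<in> sets borel"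
    and le2: "\<And>x y. x \<in> D2 \<Longrightarrow> y \<in> E2 \<Longrightarrow> x \<bullet> y \<le> f2 x + g2 y"
    and eq2: "\<And>x y. (x, y) \<in> \<Gamma>2 \<Longrightarrow> x \<in> D2 \<and> y \<in> E2 \<and> f2 x + g2 y = x \<bullet> y"
    by (rule cyclically_monotone_potentials[OF cm(2)]) blast
  have [measurable]: "T1 \<in> borel_measurable \<mu>" "T2 \<in> borel_measurable \<mu>" by measurable
  have T1E2: "AE x in \<mu>. T1 x \<in> E2"
    by (rule AE_distr_transfer[OF marg]) (use on2 eq2 in \<open>auto elim: eventually_mono\<close>)
  have T2E1: "AE x in \<mu>. T2 x \<in> E1"
    by (rule AE_distr_transfer[OF marg[symmetric]]) (use on1 eq1 in \<open>auto elim: eventually_mono\<close>)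
  define a where "a = (\<lambda>x. arctan (f1 x - f2 x))"
  define b where "b = (\<lambda>y. arctan (g1 y - g2 y))"
  have [measurable]: "a \<in> borel_measurable borel" "b \<in> borel_measurable borel"
    unfolding a_def b_def by measurable
  have arctan_sum: "arctan s + arctan t \<le> 0 \<longleftrightarrow> s + t \<le> 0" "arctan s + arctan t = 0 \<longleftrightarrow> s + t = 0" for s t
    using arctan_le_iff[of s "-t"] arctan_eq_iff[of s "-t"] unfolding arctan_minus by linarith+
  have arctan_le: "\<bar>arctan t\<bar> \<le> pi / 2" for t
    using arctan_lbound[of t] arctan_ubound[of t] by linarith
  have inta: "integrable \<mu> a"
    by (rule integrable_const_bound[of _ "pi/2"]) (simp_all only: a_def real_norm_def arctan_le eventually_True, measurable)
  have intb: "integrable \<mu> (\<lambda>x. b (T x))" if [measurable]: "T \<in> borel_measurable \<mu>" for T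
    by (rule integrable_const_bound[of _ "pi/2"]) (simp_all only: b_def real_norm_def arctan_le eventually_True, measurable)
  have h1: "AE x in \<mu>. a x + b (T1 x) \<le> 0"
    using on1 on2 T1E2
  proof eventually_elim
    case (elim x)
    have "f1 x + g1 (T1 x) = x \<bullet> T1 x" "x \<bullet> T1 x \<le> f2 x + g2 (T1 x)"
      using elim eq1 eq2 le2 by blast+
    then show ?case unfolding a_def b_def arctan_sum by linarith
  qed
  have h2: "AE x in \<mu>. 0 \<le> a x + b (T2 x)"
    using on1 on2 T2E1
  proof eventually_elim
    case (elim x)
    have "f2 x + g2 (T2 x) = x \<bullet> T2 x" "x \<bullet> T2 x \<le> f1 x + g1 (T2 x)"
      using elim eq1 eq2 le1 by blast+
    then have "f2 x - f1 x + (g2 (T2 x) - g1 (T2 x)) \<le> 0" by linarith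
    then have "arctan (- (f1 x - f2 x)) + arctan (- (g1 (T2 x) - g2 (T2 x))) \<le> 0"
      unfolding arctan_sum by simp
    then show ?case unfolding a_def b_def arctan_minus by linarith
  qed
  have "(\<integral>x. a x + b (T1 x) \<partial>\<mu>) = (\<integral>x. a x + b (T2 x) \<partial>\<mu>)"
    using inta intb integral_distr_transfer[OF marg, of b] by simp
  also have "0 \<le> \<dots>" using h2 by (rule integral_nonneg_AE)
  finally have "(\<integral>x. - (a x + b (T1 x)) \<partial>\<mu>) \<le> 0" using inta intb by simp
  moreover have nn: "AE x in \<mu>. 0 \<le> - (a x + b (T1 x))" using h1 by eventually_elim simp
  then have "0 \<le> (\<integral>x. - (a x + b (T1 x)) \<partial>\<mu>)" by (rule integral_nonneg_AE)
  ultimately have "(\<integral>x. - (a x + b (T1 x)) \<partial>\<mu>) = 0" by simp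
  then have z: "AE x in \<mu>. - (a x + b (T1 x)) = 0"
    using inta intb by (subst (asm) integral_nonneg_eq_0_iff_AE[OF _ nn]) auto
  define \<Gamma> where "\<Gamma> = {(x, y). x \<in> D2 \<and> y \<in> E2 \<and> f2 x + g2 y = x \<bullet> y}"
  have "monotone_relation \<Gamma>"
    unfolding monotone_relation_def
  proof (intro allI impI)
    fix x y x' y' assume "(x, y) \<in> \<Gamma>" "(x', y') \<in> \<Gamma>"
    then have "f2 x + g2 y = x \<bullet> y" "f2 x' + g2 y' = x' \<bullet> y'" "x \<bullet> y' \<le> f2 x + g2 y'" "x' \<bullet> y \<le> f2 x' + g2 y"
      using le2 by (auto simp: \<Gamma>_def)
    then show "0 \<le> (y' - y) \<bullet> (x' - x)" by (simp add: inner_diff inner_commute)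
  qed
  then obtain N where N: "N \<in> null_sets lborel" and
    single: "\<And>x y y'. (x, y) \<in> \<Gamma> \<Longrightarrow> (x, y') \<in> \<Gamma> \<Longrightarrow> x \<notin> N \<Longrightarrow> y = y'"
    by (rule monotone_relation_single_valued) blast
  have "AE x in \<mu>. x \<notin> N" using N ac by (intro AE_not_in) auto
  then show ?thesis using on1 on2 T1E2 z
  proof eventually_elim
    case (elim x)
    have "(f1 x - f2 x) + (g1 (T1 x) - g2 (T1 x)) = 0"
      using elim(5) unfolding a_def b_def neg_equal_0_iff_equal arctan_sum(2) .
    then have "(x, T1 x) \<in> \<Gamma>" using eq1[OF elim(2)] eq2[OF elim(3)] elim(4) by (simp add: \<Gamma>_def)
    moreover have "(x, T2 x) \<in> \<Gamma>" using eq2[OF elim(3)] by (simp add: \<Gamma>_def)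
    ultimately show ?case using single elim(1) by blast
  qed
qed

text \<open>With \<open>p x = (norm x)\<^sup>2 - 2 * f x\<close> and \<open>q y = (norm y)\<^sup>2 - 2 * g y\<close> the inequality for the potentials
  reads \<open>p x + q y \<le> (norm (x - y))\<^sup>2\<close>. Neither \<open>p\<close> nor \<open>q\<close> need be integrable, but truncating both at
  the same level \<open>k\<close> preserves the upper bound by a nonnegative number and the nonnegativity of the
  sum, and the truncated sum has the same expectation for \<open>Y\<close> and for \<open>Z\<close>.\<close>
lemma cyclically_monotone_minimal_cost:
  fixes X Y Z :: "'p \<Rightarrow> 'a::euclidean_space"
  assumes "prob_space P"
    and [measurable]: "X \<in> borel_measurable P" "Y \<in> borel_measurable P" "Z \<in> borel_measurable P"
    and marg: "distr P borel Y = distr P borel Z"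
    and cm: "cyclically_monotone \<Gamma>" and on: "AE \<xi> in P. (X \<xi>, Y \<xi>) \<in> \<Gamma>"
  shows "(\<integral>\<^sup>+\<xi>. ennreal ((norm (X \<xi> - Y \<xi>))\<^sup>2) \<partial>P) \<le> (\<integral>\<^sup>+\<xi>. ennreal ((norm (X \<xi> - Z \<xi>))\<^sup>2) \<partial>P)"
proof -
  interpret prob_space P by fact
  obtain f g D E where [measurable]: "f \<in> borel_measurable borel" "g \<in> borel_measurable borel"
      "D \<in> sets borel" "E \<in> sets borel"
    and le: "\<And>x y. x \<in> D \<Longrightarrow> y \<in> E \<Longrightarrow> x \<bullet> y \<le> f x + g y"
    and eq: "\<And>x y. (x, y) \<in> \<Gamma> \<Longrightarrow> x \<in> D \<and> y \<in> E \<and> f x + g y = x \<bullet> y"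
    by (rule cyclically_monotone_potentials[OF cm]) blast
  define p where "p = (\<lambda>x. (norm x)\<^sup>2 - 2 * f x)"
  define q where "q = (\<lambda>y. (norm y)\<^sup>2 - 2 * g y)"
  have [measurable]: "p \<in> borel_measurable borel" "q \<in> borel_measurable borel"
    unfolding p_def q_def by measurable
  have norm_sq: "(norm (x - y))\<^sup>2 = (norm x)\<^sup>2 + (norm y)\<^sup>2 - 2 * (x \<bullet> y)" for x y :: 'a
    by (simp add: power2_norm_eq_inner inner_diff inner_commute)
  have YE: "AE \<xi> in P. Z \<xi> \<in> E"
    by (rule AE_distr_transfer[OF marg[symmetric]]) (use on eq in \<open>auto elim: eventually_mono\<close>)
  define c :: "nat \<Rightarrow> real \<Rightarrow> real" where "c = (\<lambda>k t. max (- real k) (min (real k) t))"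
  have [measurable]: "c k \<in> borel_measurable borel" for k unfolding c_def by measurable
  have int: "integrable P (\<lambda>\<xi>. c k (h \<xi>))" if [measurable]: "h \<in> borel_measurable P" for h k
    by (rule integrable_const_bound[of _ "real k"]) (auto simp: c_def)
  define hY where "hY = (\<lambda>k \<xi>. c k (p (X \<xi>)) + c k (q (Y \<xi>)))"
  define hZ where "hZ = (\<lambda>k \<xi>. c k (p (X \<xi>)) + c k (q (Z \<xi>)))"
  have [measurable]: "hY k \<in> borel_measurable P" "hZ k \<in> borel_measurable P" for k
    unfolding hY_def hZ_def by measurable
  have inth: "integrable P (hY k)" "integrable P (hZ k)" for k
    unfolding hY_def hZ_def by (intro Bochner_Integration.integrable_add int; measurable)+
  have same: "expectation (hY k) = expectation (hZ k)" for k
    unfolding hY_def hZ_def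
    using integral_distr_transfer[OF marg, of "\<lambda>y. c k (q y)"] int[of "\<lambda>\<xi>. p (X \<xi>)"] int[of "\<lambda>\<xi>. q (Y \<xi>)"] int[of "\<lambda>\<xi>. q (Z \<xi>)"]
    by simp
  have Y1: "AE \<xi> in P. p (X \<xi>) + q (Y \<xi>) = (norm (X \<xi> - Y \<xi>))\<^sup>2"
    using on by eventually_elim (use eq in \<open>fastforce simp: p_def q_def norm_sq\<close>)
  have Z1: "AE \<xi> in P. p (X \<xi>) + q (Z \<xi>) \<le> (norm (X \<xi> - Z \<xi>))\<^sup>2"
    using on YE by eventually_elim (use eq le in \<open>fastforce simp: p_def q_def norm_sq\<close>)
  have Ypos: "AE \<xi> in P. 0 \<le> hY k \<xi>" for k
    using Y1
  proof eventually_elim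
    case (elim \<xi>)
    then have "0 \<le> p (X \<xi>) + q (Y \<xi>)" by simp
    then show ?case unfolding hY_def c_def by linarith
  qed
  have Zle: "AE \<xi> in P. hZ k \<xi> \<le> (norm (X \<xi> - Z \<xi>))\<^sup>2" for k
    using Z1
  proof eventually_elim
    case (elim \<xi>)
    then show ?case unfolding hZ_def c_def using zero_le_power2[of "norm (X \<xi> - Z \<xi>)"] by linarith
  qed
  have lim: "AE \<xi> in P. ennreal ((norm (X \<xi> - Y \<xi>))\<^sup>2) = liminf (\<lambda>k. ennreal (hY k \<xi>))"
    using Y1
  proof eventually_elim
    case (elim \<xi>)
    have cl: "(\<lambda>k. c k t) \<longlonglongrightarrow> t" for t
    proof (rule tendsto_eventually)
      obtain K where "\<bar>t\<bar> \<le> real K" using real_arch_simple by blast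
      then show "\<forall>\<^sub>F k in sequentially. c k t = t"
        by (intro eventually_sequentiallyI[of K]) (auto simp: c_def)
    qed
    have "(\<lambda>k. hY k \<xi>) \<longlonglongrightarrow> p (X \<xi>) + q (Y \<xi>)" unfolding hY_def by (intro tendsto_add cl)
    then have "(\<lambda>k. ennreal (hY k \<xi>)) \<longlonglongrightarrow> ennreal ((norm (X \<xi> - Y \<xi>))\<^sup>2)"
      unfolding elim by (rule tendsto_ennrealI)
    then show ?case by (simp add: lim_imp_Liminf)
  qed
  have bound: "(\<integral>\<^sup>+\<xi>. ennreal (hY k \<xi>) \<partial>P) \<le> (\<integral>\<^sup>+\<xi>. ennreal ((norm (X \<xi> - Z \<xi>))\<^sup>2) \<partial>P)" for k
  proof -
    have "(\<integral>\<^sup>+\<xi>. ennreal (hY k \<xi>) \<partial>P) = ennreal (expectation (hZ k))"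
      unfolding same[symmetric] by (rule nn_integral_eq_integral[OF inth(1) Ypos])
    also have "\<dots> \<le> ennreal (expectation (\<lambda>\<xi>. max 0 (hZ k \<xi>)))"
      using inth(2)[of k] by (intro ennreal_leI integral_mono integrable_max) auto
    also have "\<dots> = (\<integral>\<^sup>+\<xi>. ennreal (max 0 (hZ k \<xi>)) \<partial>P)"
      using inth(2)[of k] by (intro nn_integral_eq_integral[symmetric] integrable_max) auto
    also have "\<dots> \<le> (\<integral>\<^sup>+\<xi>. ennreal ((norm (X \<xi> - Z \<xi>))\<^sup>2) \<partial>P)"
      using Zle[of k] by (intro nn_integral_mono_AE) (auto elim!: eventually_mono intro!: ennreal_leI)
    finally show ?thesis .
  qed
  have "(\<integral>\<^sup>+\<xi>. ennreal ((norm (X \<xi> - Y \<xi>))\<^sup>2) \<partial>P) = (\<integral>\<^sup>+\<xi>. liminf (\<lambda>k. ennreal (hY k \<xi>)) \<partial>P)"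
    by (rule nn_integral_cong_AE[OF lim])
  also have "\<dots> \<le> liminf (\<lambda>k. \<integral>\<^sup>+\<xi>. ennreal (hY k \<xi>) \<partial>P)"
    by (intro nn_integral_liminf) measurable
  also have "\<dots> \<le> liminf (\<lambda>k::nat. \<integral>\<^sup>+\<xi>. ennreal ((norm (X \<xi> - Z \<xi>))\<^sup>2) \<partial>P)"
    by (intro Liminf_mono always_eventually allI bound)
  also have "\<dots> = (\<integral>\<^sup>+\<xi>. ennreal ((norm (X \<xi> - Z \<xi>))\<^sup>2) \<partial>P)"
    by (simp add: Liminf_const)
  finally show ?thesis .
qed

section \<open>Optimal couplings of finite ensembles\<close>

text \<open>Rows of \<open>t\<close> belong to targets and columns to sources, hence the order of the pair.\<close>
definition coupling_support :: "nat \<Rightarrow> (nat \<Rightarrow> 'a) \<Rightarrow> (nat \<Rightarrow> nat \<Rightarrow> real) \<Rightarrow> ('a \<times> 'a) set" where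
  "coupling_support M x t = {(x j, x i) | i j. i < M \<and> j < M \<and> 0 < t i j}"

text \<open>Given a cycle in the support, rerouting a small amount \<open>e\<close> of mass from each source of the cycle to
  the target of its predecessor is again a coupling, and optimality bounds the change of
  cost. The terms \<open>(norm (x j))\<^sup>2\<close> cancel around the cycle.\<close>
lemma optimal_coupling_support_cyclically_monotone:
  fixes x :: "nat \<Rightarrow> 'a::real_inner"
  assumes opt: "optimal_coupling M w x t"
  shows "cyclically_monotone (coupling_support M x t)"
  unfolding cyclically_monotone_def
proof (intro allI impI, elim conjE)
  fix n :: nat and z :: "nat \<Rightarrow> 'a \<times> 'a"
  assume z: "\<forall>k\<le>n. z k \<in> coupling_support M x t" and closed: "z n = z 0"
  have cpl: "coupling M w t" using opt by (simp add: optimal_coupling_def)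
  show "(\<Sum>k<n. snd (z k) \<bullet> (fst (z (Suc k)) - fst (z k))) \<le> 0"
  proof (cases "n = 0")
    case False
    have "\<forall>k. \<exists>i j. k \<le> n \<longrightarrow> z k = (x j, x i) \<and> i < M \<and> j < M \<and> 0 < t i j"
      using z by (fastforce simp: coupling_support_def)
    then obtain I J where IJ: "\<And>k. k \<le> n \<Longrightarrow> z k = (x (J k), x (I k))"
      "\<And>k. k \<le> n \<Longrightarrow> I k < M" "\<And>k. k \<le> n \<Longrightarrow> J k < M" "\<And>k. k \<le> n \<Longrightarrow> 0 < t (I k) (J k)"
      by metis
    \<comment> \<open>The chain closes up as a chain of points; \<open>J'\<close> closes it up as a chain of indices, which may
      differ if ensemble members coincide.\<close>
    define J' where "J' = (\<lambda>k. if Suc k = n then J 0 else J (Suc k))"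
    have J'M: "J' k < M" if "k < n" for k using that IJ(3) by (auto simp: J'_def)
    have J'x: "fst (z (Suc k)) = x (J' k)" if "k < n" for k
      using that IJ(1)[of "Suc k"] IJ(1)[of 0] closed by (auto simp: J'_def)
    have cyc: "(\<Sum>k<n. h (J' k)) = (\<Sum>k<n. h (J k))" for h :: "nat \<Rightarrow> real"
    proof -
      obtain m where m: "n = Suc m" using False by (cases n) auto
      have "(\<Sum>k<n. h (J' k)) = (\<Sum>k<m. h (J (Suc k))) + h (J 0)"
        unfolding m by (simp add: J'_def m)
      also have "\<dots> = (\<Sum>k<n. h (J k))"
        unfolding m by (simp only: sum.lessThan_Suc_shift add.commute)
      finally show ?thesis .
    qed
    define d :: "nat \<Rightarrow> nat \<Rightarrow> real" where
      "d = (\<lambda>i j. \<Sum>k<n. of_bool (i = I k \<and> j = J' k) - of_bool (i = I k \<and> j = J k))"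
    have delta: "(\<Sum>i<M. \<Sum>j<M. of_bool (i = a \<and> j = b) * c i j) = c a b"
      if "a < M" "b < M" for a b and c :: "nat \<Rightarrow> nat \<Rightarrow> real"
    proof -
      have "(\<Sum>j<M. of_bool (i = a \<and> j = b) * c i j) = (if i = a then c a b else 0)" for i
        using that by (cases "i = a") (simp_all add: of_bool_def if_distrib[of "\<lambda>u. u * _"] sum.delta' cong: if_cong)
      then show ?thesis using that by (simp add: sum.delta')
    qed
    have d_sum: "(\<Sum>i<M. \<Sum>j<M. d i j * c i j) = (\<Sum>k<n. c (I k) (J' k) - c (I k) (J k))"
      for c :: "nat \<Rightarrow> nat \<Rightarrow> real"
    proof -
      have "(\<Sum>i<M. \<Sum>j<M. d i j * c i j) = (\<Sum>i<M. \<Sum>j<M. \<Sum>k<n.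
          of_bool (i = I k \<and> j = J' k) * c i j - of_bool (i = I k \<and> j = J k) * c i j)"
        by (simp add: d_def sum_distrib_right left_diff_distrib)
      also have "\<dots> = (\<Sum>k<n. \<Sum>i<M. \<Sum>j<M.
          of_bool (i = I k \<and> j = J' k) * c i j - of_bool (i = I k \<and> j = J k) * c i j)"
        by (subst sum.swap[of _ "{..<n}"], subst sum.swap[of _ "{..<n}"]) (rule refl)
      also have "\<dots> = (\<Sum>k<n. c (I k) (J' k) - c (I k) (J k))"
        using IJ J'M by (intro sum.cong refl) (simp add: sum_subtractf delta del: sum_mult_of_bool_eq sum_of_bool_mult_eq)
      finally show ?thesis .
    qed
    have row: "(\<Sum>j<M. d i j) = 0" if "i < M" for i
    proof -
      have "(\<Sum>i'<M. \<Sum>j<M. d i' j * of_bool (i' = i)) = (\<Sum>j<M. d i j)"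
        using that by (subst sum.swap) (simp add: of_bool_def if_distrib[of "\<lambda>u. _ * u"] sum.delta' cong: if_cong)
      then show ?thesis using d_sum[of "\<lambda>i' j. of_bool (i' = i)"] by simp
    qed
    have col: "(\<Sum>i<M. d i j) = 0" if "j < M" for j
    proof -
      have "(\<Sum>i<M. \<Sum>j'<M. d i j' * of_bool (j' = j)) = (\<Sum>i<M. d i j)"
        using that by (simp add: of_bool_def if_distrib[of "\<lambda>u. _ * u"] sum.delta' cong: if_cong)
      then show ?thesis
        using d_sum[of "\<lambda>i j'. of_bool (j' = j)"] cyc[of "\<lambda>j'. of_bool (j' = j)"] by (simp add: sum_subtractf)
    qed
    \<comment> \<open>An entry can occur up to \<open>n\<close> times in the cycle, so it loses at most \<open>n * e = m\<close>.\<close>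
    define m where "m = Min ((\<lambda>k. t (I k) (J k)) ` {..<n})"
    have m0: "0 < m" unfolding m_def using False IJ(4) by (subst Min_gr_iff) auto
    have mle: "m \<le> t (I k) (J k)" if "k < n" for k
      unfolding m_def using that by (intro Min_le) auto
    define e where "e = m / real n"
    have e: "0 < e" using m0 False by (simp add: e_def)
    define s where "s = (\<lambda>i j. t i j + e * d i j)"
    have "coupling M w s"
      unfolding coupling_def
    proof (intro conjI allI impI)
      fix i j assume ij: "i < M" "j < M"
      have t0: "0 \<le> t i j" using cpl ij by (simp add: coupling_def)
      show "0 \<le> s i j"
      proof (cases "\<exists>k<n. i = I k \<and> j = J k")
        case True
        then have "m \<le> t i j" using mle by auto
        have "d i j \<ge> (\<Sum>k<n. - 1)" unfolding d_def by (intro sum_mono) auto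
        then have "e * d i j \<ge> e * (- real n)" using e by (intro mult_left_mono) auto
        then show ?thesis using \<open>m \<le> t i j\<close> False by (simp add: s_def e_def)
      next
        case False
        then have "0 \<le> d i j" unfolding d_def by (intro sum_nonneg) auto
        then show ?thesis using t0 e by (simp add: s_def)
      qed
    next
      fix j assume "j < M"
      then show "(\<Sum>i<M. s i j) = 1 / real M"
        using cpl col by (simp add: s_def coupling_def sum.distrib sum_distrib_left[symmetric])
    next
      fix i assume "i < M"
      then show "(\<Sum>j<M. s i j) = w i"
        using cpl row by (simp add: s_def coupling_def sum.distrib sum_distrib_left[symmetric])
    qed
    then have "transport_cost M x t \<le> transport_cost M x s"
      using opt by (simp add: optimal_coupling_def)
    also have "transport_cost M x s = transport_cost M x t + e * (\<Sum>i<M. \<Sum>j<M. d i j * (norm (x i - x j))\<^sup>2)"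
      by (simp add: transport_cost_def s_def distrib_right sum.distrib sum_distrib_left mult.assoc)
    finally have "0 \<le> (\<Sum>i<M. \<Sum>j<M. d i j * (norm (x i - x j))\<^sup>2)"
      using e by (simp add: zero_le_mult_iff)
    also have "\<dots> = (\<Sum>k<n. (norm (x (I k) - x (J' k)))\<^sup>2 - (norm (x (I k) - x (J k)))\<^sup>2)"
      by (rule d_sum)
    also have "\<dots> = (\<Sum>k<n. ((norm (x (J' k)))\<^sup>2 - (norm (x (J k)))\<^sup>2) - 2 * (x (I k) \<bullet> (x (J' k) - x (J k))))"
      by (intro sum.cong refl) (simp add: power2_norm_eq_inner inner_diff inner_commute)
    also have "\<dots> = - 2 * (\<Sum>k<n. x (I k) \<bullet> (x (J' k) - x (J k)))"
      using cyc[of "\<lambda>j. (norm (x j))\<^sup>2"] by (simp add: sum_subtractf sum_distrib_left sum_negf)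
    also have "(\<Sum>k<n. x (I k) \<bullet> (x (J' k) - x (J k))) = (\<Sum>k<n. snd (z k) \<bullet> (fst (z (Suc k)) - fst (z k)))"
      using IJ(1) J'x by (intro sum.cong refl) simp
    finally show ?thesis by simp
  qed simp
qed

text \<open>Couplings, extended by zero outside the index range, form a compact set in the product topology.\<close>
lemma optimal_coupling_exists:
  fixes x :: "nat \<Rightarrow> 'a::real_normed_vector"
  assumes "coupling M w s0"
  shows "\<exists>t. optimal_coupling M w x t"
proof -
  define c where "c = (\<lambda>u :: nat \<times> nat \<Rightarrow> real. transport_cost M x (\<lambda>i j. u (i, j)))"
  define K where "K = {u \<in> (\<Pi>\<^sub>E p\<in>UNIV. {0..1::real}). coupling M w (\<lambda>i j. u (i, j))}"
  have coord: "continuous_on UNIV (\<lambda>u :: nat \<times> nat \<Rightarrow> real. u p)" for p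
    by (rule continuous_on_product_coordinates)
  have "compactin (product_topology (\<lambda>p :: nat \<times> nat. euclideanreal) UNIV) (\<Pi>\<^sub>E p\<in>UNIV. {0..1::real})"
    by (simp add: compactin_PiE)
  then have box: "compact (\<Pi>\<^sub>E p\<in>(UNIV :: (nat \<times> nat) set). {0..1::real})"
    by (simp add: euclidean_product_topology)
  have "closed {u :: nat \<times> nat \<Rightarrow> real. coupling M w (\<lambda>i j. u (i, j))}"
    unfolding coupling_def
    by (intro closed_Collect_conj closed_Collect_all closed_Collect_imp open_Collect_const
          closed_Collect_le closed_Collect_eq continuous_on_sum coord continuous_on_const)
  then have "compact K"
    using compact_Int_closed[OF box] unfolding K_def by (simp add: Collect_conj_eq)
  have cc: "continuous_on K c"
    unfolding c_def transport_cost_def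
    by (intro continuous_on_sum continuous_on_mult continuous_on_const continuous_on_subset[OF coord]) auto
  have normalise: "\<exists>u\<in>K. c u = transport_cost M x s" if s: "coupling M w s" for s
  proof -
    define u where "u = (\<lambda>(i, j). if i < M \<and> j < M then s i j else 0)"
    have "s i j \<le> 1" if ij: "i < M" "j < M" for i j
    proof -
      have "s i j \<le> (\<Sum>i<M. s i j)"
        using s ij by (intro member_le_sum) (auto simp: coupling_def)
      also have "\<dots> = 1 / real M" using s ij by (simp add: coupling_def)
      also have "\<dots> \<le> 1" using ij by simp
      finally show ?thesis .
    qed
    then have "u \<in> K" using s by (auto simp: K_def u_def coupling_def)
    moreover have "c u = transport_cost M x s"
      unfolding c_def transport_cost_def by (intro sum.cong refl) (simp add: u_def)
    ultimately show ?thesis by blast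
  qed
  have "K \<noteq> {}" using normalise[OF assms] by blast
  from continuous_attains_inf[OF \<open>compact K\<close> this cc]
  obtain u where u: "u \<in> K" "\<forall>v\<in>K. c u \<le> c v" by blast
  have "optimal_coupling M w x (\<lambda>i j. u (i, j))"
    unfolding optimal_coupling_def
  proof (intro conjI allI impI)
    show "coupling M w (\<lambda>i j. u (i, j))" using u by (simp add: K_def)
    fix s assume "coupling M w s"
    from normalise[OF this] obtain v where "v \<in> K" "c v = transport_cost M x s" by blast
    then show "transport_cost M x (\<lambda>i j. u (i, j)) \<le> transport_cost M x s"
      using u(2) by (auto simp: c_def)
  qed
  then show ?thesis by blast
qed

text \<open>The product coupling shows that there are couplings at all.\<close>
lemma importance_weight_coupling:
  assumes "\<And>x. 0 \<le> L x" and pos: "0 < (\<Sum>l<M. L (x l))"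
  shows "coupling M (importance_weight L x M) (\<lambda>i j. importance_weight L x M i / real M)"
proof -
  have "M > 0" using pos by (cases M) auto
  moreover have "(\<Sum>i<M. importance_weight L x M i) = 1"
    using pos by (simp add: importance_weight_def sum_divide_distrib[symmetric])
  ultimately show ?thesis
    using assms by (simp add: coupling_def importance_weight_def sum_divide_distrib[symmetric])
qed

section \<open>Kuratowski limits of monotone relations\<close>

text \<open>Set convergence in the sense of Kuratowski. The second clause admits every sequence of indices that tends
  to infinity, so that cluster points found through compactness can be used without first making their
  indices strictly increasing.\<close>
definition kuratowski_limit :: "(nat \<Rightarrow> 'a::topological_space set) \<Rightarrow> 'a set \<Rightarrow> bool" where
  "kuratowski_limit S \<Gamma> \<longleftrightarrow>
     (\<forall>z\<in>\<Gamma>. \<exists>p. p \<longlonglongrightarrow> z \<and> (\<forall>\<^sub>F k in sequentially. p k \<in> S k)) \<and>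
     (\<forall>q p z. filterlim q at_top sequentially \<longrightarrow> (\<forall>j. p j \<in> S (q j)) \<longrightarrow> p \<longlonglongrightarrow> z \<longrightarrow> z \<in> \<Gamma>)"

lemma kuratowski_limitD1:
  assumes "kuratowski_limit S \<Gamma>" "z \<in> \<Gamma>"
  obtains p where "p \<longlonglongrightarrow> z" "\<forall>\<^sub>F k in sequentially. p k \<in> S k"
  using assms unfolding kuratowski_limit_def by blast

lemma kuratowski_limitD2:
  assumes "kuratowski_limit S \<Gamma>" "filterlim q at_top sequentially" "\<And>j :: nat. p j \<in> S (q j)" "p \<longlonglongrightarrow> z"
  shows "z \<in> \<Gamma>"
  using assms unfolding kuratowski_limit_def by blast

lemma kuratowski_limit_const:
  fixes \<Gamma> :: "'a::metric_space set"
  assumes "closed \<Gamma>"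
  shows "kuratowski_limit (\<lambda>_. \<Gamma>) \<Gamma>"
  unfolding kuratowski_limit_def
proof (intro conjI ballI allI impI)
  fix z assume "z \<in> \<Gamma>"
  then show "\<exists>p. p \<longlonglongrightarrow> z \<and> (\<forall>\<^sub>F k in sequentially. p k \<in> \<Gamma>)"
    by (intro exI[of _ "\<lambda>_. z"]) auto
next
  fix p :: "nat \<Rightarrow> 'a" and z assume "\<forall>j. p j \<in> \<Gamma>" "p \<longlonglongrightarrow> z"
  then show "z \<in> \<Gamma>" using assms closed_sequentially by blast
qed

text \<open>Compactness of the closed sets: by a diagonal argument, along a subsequence every set of a countable
  base is either eventually hit or eventually missed by the \<open>S k\<close>. The limit consists of the points
  whose basic neighbourhoods are all eventually hit.\<close>
lemma kuratowski_subsequence: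
  fixes S :: "nat \<Rightarrow> 'a::{metric_space, second_countable_topology} set"
  obtains r \<Gamma> where "strict_mono (r :: nat \<Rightarrow> nat)" "closed \<Gamma>" "kuratowski_limit (S \<circ> r) \<Gamma>"
proof -
  obtain \<B> :: "'a set set" where \<B>: "countable \<B>" "topological_basis \<B>"
    using ex_countable_basis by blast
  have "\<B> \<noteq> {}" using topological_basisE[OF \<B>(2), of UNIV undefined] by auto
  define U where "U = from_nat_into \<B>"
  have U: "U n \<in> \<B>" for n unfolding U_def using \<open>\<B> \<noteq> {}\<close> by (rule from_nat_into)
  have Uopen: "open (U n)" for n using U topological_basis_open[OF \<B>(2)] by blast
  have Ubasis: "\<exists>n. z \<in> U n \<and> U n \<subseteq> W" if W: "open W" "z \<in> W" for z W
  proof -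
    obtain V where V: "V \<in> \<B>" "z \<in> V" "V \<subseteq> W" using topological_basisE[OF \<B>(2) W] by blast
    then obtain n where "U n = V" unfolding U_def using from_nat_into_surj[OF \<B>(1)] by blast
    with V show ?thesis by blast
  qed
  define P where "P = (\<lambda>n s. (\<forall>\<^sub>F k in sequentially. S (s k) \<inter> U n \<noteq> {}) \<or> (\<forall>\<^sub>F k in sequentially. S (s k) \<inter> U n = {}))"
  interpret subseqs P
  proof
    fix n and s :: "nat \<Rightarrow> nat" assume "strict_mono s"
    show "\<exists>r'. strict_mono r' \<and> P n (s \<circ> r')"
    proof (cases "\<forall>\<^sub>F k in sequentially. S (s k) \<inter> U n \<noteq> {}")
      case True
      then show ?thesis by (intro exI[of _ id]) (auto simp: P_def strict_mono_def)
    next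
      case False
      define E where "E = {k. S (s k) \<inter> U n = {}}"
      have "infinite E" using False
        by (auto simp: E_def not_eventually frequently_sequentially infinite_nat_iff_unbounded_le)
      then have "strict_mono (enumerate E)" "\<And>k. enumerate E k \<in> E"
        by (auto intro: strict_mono_enumerate enumerate_in_set)
      moreover from this have "S (s (enumerate E k)) \<inter> U n = {}" for k
        unfolding E_def by blast
      ultimately show ?thesis
        by (intro exI[of _ "enumerate E"]) (simp add: P_def)
    qed
  qed
  define r where "r = diagseq"
  have r: "strict_mono r" unfolding r_def by (rule subseq_diagseq)
  have Pr: "P n r" for n
  proof -
    have "P n (r \<circ> (+) (Suc n))"
      unfolding r_def
    proof (rule diagseq_holds)
      fix q s :: "nat \<Rightarrow> nat" and n assume q: "strict_mono q" and "P n s"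
      then show "P n (s \<circ> q)"
        unfolding P_def using eventually_subseq[OF q, of "\<lambda>k. S (s k) \<inter> U n \<noteq> {}"]
          eventually_subseq[OF q, of "\<lambda>k. S (s k) \<inter> U n = {}"] by auto
    qed
    then show ?thesis
      unfolding P_def comp_def add.commute[of "Suc n"]
      using eventually_sequentially_seg[of "\<lambda>k. S (r k) \<inter> U n \<noteq> {}" "Suc n"]
        eventually_sequentially_seg[of "\<lambda>k. S (r k) \<inter> U n = {}" "Suc n"] by blast
  qed
  define \<Gamma> where "\<Gamma> = {z. \<forall>n. z \<in> U n \<longrightarrow> (\<forall>\<^sub>F k in sequentially. S (r k) \<inter> U n \<noteq> {})}"
  have out: "\<exists>n. z \<in> U n \<and> (\<forall>\<^sub>F k in sequentially. S (r k) \<inter> U n = {})" if "z \<notin> \<Gamma>" for z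
    using that Pr unfolding \<Gamma>_def P_def by blast
  have "closed \<Gamma>"
  proof -
    have "- \<Gamma> = (\<Union>n\<in>{n. \<not> (\<forall>\<^sub>F k in sequentially. S (r k) \<inter> U n \<noteq> {})}. U n)"
      by (auto simp: \<Gamma>_def)
    also have "open \<dots>" using Uopen by blast
    finally show ?thesis by (simp add: closed_def)
  qed
  moreover have "kuratowski_limit (S \<circ> r) \<Gamma>"
    unfolding kuratowski_limit_def comp_def
  proof (intro conjI ballI allI impI)
    fix z assume z: "z \<in> \<Gamma>"
    have near: "\<forall>\<^sub>F k in sequentially. \<exists>p\<in>S (r k). dist p z < e" if e: "e > 0" for e
    proof -
      obtain n where n: "z \<in> U n" "U n \<subseteq> ball z e" using Ubasis[of "ball z e" z] e by auto
      then have "\<forall>\<^sub>F k in sequentially. S (r k) \<inter> U n \<noteq> {}" using z by (auto simp: \<Gamma>_def)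
      then show ?thesis by eventually_elim (use n in \<open>force simp: dist_commute\<close>)
    qed
    have "\<exists>p. S (r k) \<noteq> {} \<longrightarrow> p \<in> S (r k) \<and> dist p z < infdist z (S (r k)) + 1 / Suc k" for k
      using cInf_lessD[of "dist z ` S (r k)" "infdist z (S (r k)) + 1 / Suc k"]
      by (auto simp: infdist_notempty dist_commute)
    then obtain p where p: "\<And>k. S (r k) \<noteq> {} \<Longrightarrow> p k \<in> S (r k) \<and> dist (p k) z < infdist z (S (r k)) + 1 / Suc k"
      by metis
    have "p \<longlonglongrightarrow> z"
    proof (rule tendstoI)
      fix e :: real assume "e > 0"
      have "\<forall>\<^sub>F k in sequentially. 1 / real (Suc k) < e / 2"
        using LIMSEQ_inverse_real_of_nat \<open>e > 0\<close> by (intro order_tendstoD(2)[of _ 0]) (auto simp: inverse_eq_divide)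
      then show "\<forall>\<^sub>F k in sequentially. dist (p k) z < e"
        using near[OF half_gt_zero[OF \<open>e > 0\<close>]]
      proof eventually_elim
        case (elim k)
        then obtain a where a: "a \<in> S (r k)" "dist a z < e / 2" using \<open>e > 0\<close> by auto
        then have "infdist z (S (r k)) < e / 2" using infdist_le[of a "S (r k)" z] by (simp add: dist_commute)
        moreover have "dist (p k) z < infdist z (S (r k)) + 1 / real (Suc k)" using p a(1) by blast
        ultimately show ?case using elim(1) by linarith
      qed
    qed
    moreover have "\<forall>\<^sub>F k in sequentially. p k \<in> S (r k)"
      using near[OF zero_less_one] by eventually_elim (use p in blast)
    ultimately show "\<exists>p. p \<longlonglongrightarrow> z \<and> (\<forall>\<^sub>F k in sequentially. p k \<in> S (r k))" by blast
  next
    fix q :: "nat \<Rightarrow> nat" and p z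
    assume q: "filterlim q at_top sequentially" and p: "\<forall>j. p j \<in> S (r (q j))" "p \<longlonglongrightarrow> z"
    show "z \<in> \<Gamma>"
    proof (rule ccontr)
      assume "z \<notin> \<Gamma>"
      then obtain n where n: "z \<in> U n" "\<forall>\<^sub>F k in sequentially. S (r k) \<inter> U n = {}" using out by blast
      have "\<forall>\<^sub>F j in sequentially. p j \<in> U n" using p(2) Uopen n(1) by (rule topological_tendstoD)
      moreover have "\<forall>\<^sub>F j in sequentially. S (r (q j)) \<inter> U n = {}"
        using n(2) q by (rule eventually_compose_filterlim)
      ultimately have "\<forall>\<^sub>F j in sequentially. False" by eventually_elim (use p(1) in blast)
      then show False by simp
    qed
  qed
  ultimately show ?thesis using r that by blast
qed

lemma cyclically_monotone_kuratowski_limit: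
  fixes \<Gamma> :: "('a::euclidean_space \<times> 'a) set"
  assumes cm: "\<And>k. cyclically_monotone (S k)" and lim: "kuratowski_limit S \<Gamma>"
  shows "cyclically_monotone \<Gamma>"
  unfolding cyclically_monotone_def
proof (intro allI impI, elim conjE)
  fix n :: nat and z :: "nat \<Rightarrow> 'a \<times> 'a"
  assume z: "\<forall>i\<le>n. z i \<in> \<Gamma>" and closed: "z n = z 0"
  \<comment> \<open>The approximation depends on the point only, so approximating chains are closed again.\<close>
  have "\<forall>w. \<exists>p. w \<in> \<Gamma> \<longrightarrow> p \<longlonglongrightarrow> w \<and> (\<forall>\<^sub>F k in sequentially. p k \<in> S k)"
    using kuratowski_limitD1[OF lim] by blast
  then obtain a where a: "\<And>w. w \<in> \<Gamma> \<Longrightarrow> a w \<longlonglongrightarrow> w" "\<And>w. w \<in> \<Gamma> \<Longrightarrow> \<forall>\<^sub>F k in sequentially. a w k \<in> S k"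
    by metis
  define c where "c = (\<lambda>k. \<Sum>i<n. snd (a (z i) k) \<bullet> (fst (a (z (Suc i)) k) - fst (a (z i) k)))"
  have "c \<longlonglongrightarrow> (\<Sum>i<n. snd (z i) \<bullet> (fst (z (Suc i)) - fst (z i)))"
    unfolding c_def using z by (intro tendsto_intros a) auto
  moreover have "\<forall>\<^sub>F k in sequentially. \<forall>i\<in>{..n}. a (z i) k \<in> S k"
    using z a(2) by (intro eventually_ball_finite) auto
  then have "\<forall>\<^sub>F k in sequentially. c k \<le> 0"
  proof eventually_elim
    case (elim k)
    then show ?case
      using cm[of k, unfolded cyclically_monotone_def, rule_format, of n "\<lambda>i. a (z i) k"] closed
      by (simp add: c_def)
  qed
  ultimately show "(\<Sum>i<n. snd (z i) \<bullet> (fst (z (Suc i)) - fst (z i))) \<le> 0"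
    by (intro tendsto_upperbound) auto
qed

text \<open>Otherwise there are pairs in the \<open>S k\<close> whose first components tend to \<open>x\<close> and whose second components
  are unbounded. If \<open>v\<close> is a limit of the directions of the latter, dividing the monotonicity inequality by
  their length shows that the domain of \<open>\<Gamma>\<close> lies in the half-space \<open>v \<bullet> d \<le> v \<bullet> x\<close>, so \<open>x\<close> is
  not interior to its convex hull. A single number \<open>j\<close> serves as index, inverse radius and bound.\<close>
lemma monotone_locally_bounded:
  fixes \<Gamma> :: "('a::euclidean_space \<times> 'a) set"
  assumes mono: "\<And>k. monotone_relation (S k)" and lim: "kuratowski_limit S \<Gamma>"
    and x: "x \<in> interior (convex hull (fst ` \<Gamma>))"
  shows "\<exists>j :: nat. \<forall>k\<ge>j. \<forall>x' y'. (x', y') \<in> S k \<longrightarrow> dist x' x < 1 / Suc j \<longrightarrow> norm y' \<le> real j"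
proof (rule ccontr)
  assume "\<not> ?thesis"
  then have "\<forall>j :: nat. \<exists>k p. j \<le> k \<and> p \<in> S k \<and> dist (fst p) x < 1 / Suc j \<and> real j < norm (snd p)"
    by (force simp: not_le)
  then obtain K p where K: "\<And>j. j \<le> K j" and p: "\<And>j. p j \<in> S (K j)"
    and px: "\<And>j. dist (fst (p j)) x < 1 / Suc j" and py: "\<And>j. real j < norm (snd (p j))"
    by metis
  define u where "u = (\<lambda>j. snd (p j) /\<^sub>R norm (snd (p j)))"
  have "norm (u j) = 1" for j
  proof -
    have "norm (snd (p j)) \<noteq> 0" using py[of j] by linarith
    then show ?thesis by (simp add: u_def)
  qed
  then have "\<forall>j. u j \<in> sphere 0 1" by simp
  then obtain v l where v: "v \<in> sphere 0 1" and l: "strict_mono l" "(u \<circ> l) \<longlonglongrightarrow> v"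
    by (rule seq_compactE[OF compact_imp_seq_compact[OF compact_sphere]])
  have Kl: "filterlim (\<lambda>j. K (l j)) at_top sequentially"
  proof (rule filterlim_at_top_mono[OF filterlim_ident])
    show "\<forall>\<^sub>F j in sequentially. j \<le> K (l j)"
      using K seq_suble[OF l(1)] by (auto intro: order_trans always_eventually)
  qed
  have xl: "(\<lambda>j. fst (p (l j))) \<longlonglongrightarrow> x"
  proof -
    have "(\<lambda>j. fst (p j)) \<longlonglongrightarrow> x"
    proof (rule metric_tendsto_imp_tendsto[OF LIMSEQ_inverse_real_of_nat])
      have "dist (fst (p j)) x \<le> dist (inverse (real (Suc j))) 0" for j
        using px[of j] by (simp add: inverse_eq_divide)
      then show "\<forall>\<^sub>F j in sequentially. dist (fst (p j)) x \<le> dist (inverse (real (Suc j))) 0" by simp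
    qed
    from LIMSEQ_subseq_LIMSEQ[OF this l(1)] show ?thesis unfolding comp_def .
  qed
  have inv: "(\<lambda>j. inverse (norm (snd (p (l j))))) \<longlonglongrightarrow> 0"
  proof (rule tendsto_inverse_0_at_top, rule filterlim_at_top_mono[OF filterlim_real_sequentially])
    have "real j \<le> norm (snd (p (l j)))" for j
      using py[of "l j"] seq_suble[OF l(1), of j] by linarith
    then show "\<forall>\<^sub>F j in sequentially. real j \<le> norm (snd (p (l j)))" by simp
  qed
  have half: "v \<bullet> d \<le> v \<bullet> x" if d: "d \<in> fst ` \<Gamma>" for d
  proof -
    from d obtain e where "(d, e) \<in> \<Gamma>" by force
    then obtain a where a: "a \<longlonglongrightarrow> (d, e)" "\<forall>\<^sub>F k in sequentially. a k \<in> S k"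
      by (rule kuratowski_limitD1[OF lim])
    define a' where "a' = (\<lambda>j. a (K (l j)))"
    have a': "a' \<longlonglongrightarrow> (d, e)" "\<forall>\<^sub>F j in sequentially. a' j \<in> S (K (l j))"
      unfolding a'_def using filterlim_compose[OF a(1) Kl] eventually_compose_filterlim[OF a(2) Kl] by auto
    have "(\<lambda>j. (u (l j) - inverse (norm (snd (p (l j)))) *\<^sub>R snd (a' j)) \<bullet> (fst (p (l j)) - fst (a' j)))
        \<longlonglongrightarrow> (v - 0 *\<^sub>R snd (d, e)) \<bullet> (x - fst (d, e))"
      using l(2) unfolding comp_def by (intro tendsto_intros a' xl inv)
    moreover have "\<forall>\<^sub>F j in sequentially.
        0 \<le> (u (l j) - inverse (norm (snd (p (l j)))) *\<^sub>R snd (a' j)) \<bullet> (fst (p (l j)) - fst (a' j))"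
      using a'(2)
    proof eventually_elim
      case (elim j)
      have "0 \<le> (snd (p (l j)) - snd (a' j)) \<bullet> (fst (p (l j)) - fst (a' j))"
        using mono[of "K (l j)", unfolded monotone_relation_def, rule_format,
            of "fst (a' j)" "snd (a' j)" "fst (p (l j))" "snd (p (l j))"] elim p[of "l j"] by simp
      then have "0 \<le> inverse (norm (snd (p (l j)))) * ((snd (p (l j)) - snd (a' j)) \<bullet> (fst (p (l j)) - fst (a' j)))"
        by (intro mult_nonneg_nonneg) auto
      then show ?case by (simp add: u_def inner_diff_left right_diff_distrib)
    qed
    ultimately have "0 \<le> (v - 0 *\<^sub>R snd (d, e)) \<bullet> (x - fst (d, e))"
      by (intro tendsto_lowerbound) auto
    then show ?thesis by (simp add: inner_diff_right)
  qed
  have hull: "convex hull (fst ` \<Gamma>) \<subseteq> {d. v \<bullet> d \<le> v \<bullet> x}"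
    using half by (intro hull_minimal convex_halfspace_le) auto
  obtain e where e: "e > 0" "cball x e \<subseteq> convex hull (fst ` \<Gamma>)"
    using x by (auto simp: mem_interior_cball)
  have "norm v = 1" using v by simp
  then have "x + e *\<^sub>R v \<in> cball x e" using e by (simp add: dist_norm)
  then have "v \<bullet> (x + e *\<^sub>R v) \<le> v \<bullet> x" using e hull by blast
  then have "e * (v \<bullet> v) \<le> 0" by (simp add: inner_add_right)
  then show False using e \<open>norm v = 1\<close> by (simp add: dot_square_norm)
qed

text \<open>By local boundedness, pairs in the \<open>S k\<close> with first components tending to \<open>x\<close> have cluster points,
  and these lie in \<open>\<Gamma>\<close> above \<open>x\<close>.\<close>
lemma monotone_convergence_at_single_value:
  fixes \<Gamma> :: "('a::euclidean_space \<times> 'a) set"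
  assumes mono: "\<And>k. monotone_relation (S k)" and lim: "kuratowski_limit S \<Gamma>"
    and x: "x \<in> interior (convex hull (fst ` \<Gamma>))" and single: "\<And>y. (x, y) \<in> \<Gamma> \<Longrightarrow> y = y0"
    and e: "e > 0"
  shows "\<exists>d>0. \<exists>K. \<forall>k\<ge>K. \<forall>x' y'. (x', y') \<in> S k \<longrightarrow> dist x' x < d \<longrightarrow> dist y' y0 < e"
proof (rule ccontr)
  assume "\<not> ?thesis"
  then have neg: "\<exists>k p. K \<le> k \<and> p \<in> S k \<and> dist (fst p) x < d \<and> e \<le> dist (snd p) y0" if "d > 0" for d K
    using that by (force simp: not_less)
  obtain j0 where j0: "\<And>k x' y'. k \<ge> j0 \<Longrightarrow> (x', y') \<in> S k \<Longrightarrow> dist x' x < 1 / Suc j0 \<Longrightarrow> norm y' \<le> real j0"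
    using monotone_locally_bounded[OF mono lim x] by blast
  have "\<forall>j. \<exists>k p. j + j0 \<le> k \<and> p \<in> S k \<and> dist (fst p) x < 1 / Suc (j + j0) \<and> e \<le> dist (snd p) y0"
    by (intro allI neg) simp
  then obtain K p where K: "\<And>j. j + j0 \<le> K j" and p: "\<And>j. p j \<in> S (K j)"
    and px: "\<And>j. dist (fst (p j)) x < 1 / Suc (j + j0)" and py: "\<And>j. e \<le> dist (snd (p j)) y0"
    by metis
  have "\<forall>j. snd (p j) \<in> cball 0 (real j0)"
  proof
    fix j
    have "1 / real (Suc (j + j0)) \<le> 1 / real (Suc j0)" by (intro divide_left_mono) auto
    then have "dist (fst (p j)) x < 1 / Suc j0" using px[of j] by linarith
    then show "snd (p j) \<in> cball 0 (real j0)" using j0[of "K j" "fst (p j)" "snd (p j)"] p[of j] K[of j] by simp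
  qed
  then obtain y l where "y \<in> cball 0 (real j0)" and l: "strict_mono l" "((\<lambda>j. snd (p j)) \<circ> l) \<longlonglongrightarrow> y"
    by (rule seq_compactE[OF compact_imp_seq_compact[OF compact_cball]])
  have Kl: "filterlim (\<lambda>j. K (l j)) at_top sequentially"
  proof (rule filterlim_at_top_mono[OF filterlim_ident])
    have "j \<le> K (l j)" for j using K[of "l j"] seq_suble[OF l(1), of j] by linarith
    then show "\<forall>\<^sub>F j in sequentially. j \<le> K (l j)" by simp
  qed
  have "(\<lambda>j. fst (p j)) \<longlonglongrightarrow> x"
  proof (rule metric_tendsto_imp_tendsto[OF LIMSEQ_inverse_real_of_nat])
    have "dist (fst (p j)) x \<le> dist (inverse (real (Suc j))) 0" for j
    proof -
      have "1 / real (Suc (j + j0)) \<le> 1 / real (Suc j)" by (intro divide_left_mono) auto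
      then show ?thesis using px[of j] by (simp add: inverse_eq_divide)
    qed
    then show "\<forall>\<^sub>F j in sequentially. dist (fst (p j)) x \<le> dist (inverse (real (Suc j))) 0" by simp
  qed
  from LIMSEQ_subseq_LIMSEQ[OF this l(1)] have xl: "(\<lambda>j. fst (p (l j))) \<longlonglongrightarrow> x"
    unfolding comp_def .
  have "(\<lambda>j. (fst (p (l j)), snd (p (l j)))) \<longlonglongrightarrow> (x, y)"
    using l(2) xl unfolding comp_def by (intro tendsto_Pair)
  then have "(x, y) \<in> \<Gamma>"
    using p by (intro kuratowski_limitD2[OF lim Kl, of "\<lambda>j. p (l j)"]) auto
  then have "y = y0" by (rule single)
  have "(\<lambda>j. dist (snd (p (l j))) y0) \<longlonglongrightarrow> dist y y0"
    using l(2) unfolding comp_def by (intro tendsto_intros)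
  then have "e \<le> dist y y0" using py by (intro LIMSEQ_le_const) auto
  then show False using e \<open>y = y0\<close> by simp
qed

section \<open>Weak convergence and convergence of graphs\<close>

text \<open>It suffices to bound the upper limit, for \<open>F\<close> and for \<open>- F\<close>. The supremum \<open>U m x\<close> of
  \<open>F z - m * dist (fst z) x\<close> over all \<open>z\<close> in the \<open>S k\<close> with \<open>k \<ge> m\<close> is Lipschitz in \<open>x\<close> and dominates
  \<open>F z\<close> at \<open>x = fst z\<close>, so the integrals of \<open>F\<close> are controlled by integrals of \<open>U m\<close> against the
  first marginals, which converge. As \<open>m\<close> grows, the penalty confines the supremum to \<open>z\<close> with
  first component near \<open>x\<close>, where \<open>F z\<close> is near \<open>F (x, \<Psi> x)\<close>.\<close>
lemma weak_limit_of_convergent_graphs: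
  fixes \<pi> :: "nat \<Rightarrow> ('a::euclidean_space \<times> 'a) measure" and F :: "'a \<times> 'a \<Rightarrow> real"
  assumes \<mu>: "prob_space \<mu>" and sets[measurable_cong]: "sets \<mu> = sets borel"
    and \<pi>: "\<And>k. prob_space (\<pi> k)" and sets\<pi>: "\<And>k. sets (\<pi> k) = sets borel"
    and on: "\<And>k. AE z in \<pi> k. z \<in> S k"
    and marg: "\<And>g :: 'a \<Rightarrow> real. continuous_on UNIV g \<Longrightarrow> bounded (range g) \<Longrightarrow>
        (\<lambda>k. \<integral>z. g (fst z) \<partial>\<pi> k) \<longlonglongrightarrow> (\<integral>x. g x \<partial>\<mu>)"
    and \<Psi>[measurable]: "\<Psi> \<in> borel_measurable borel"
    and loc: "AE x in \<mu>. \<forall>e>0. \<exists>d>0. \<exists>K. \<forall>k\<ge>K. \<forall>x' y'. (x', y') \<in> S k \<longrightarrow> dist x' x < d \<longrightarrow> dist y' (\<Psi> x) < e"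
    and F: "continuous_on UNIV F" "bounded (range F)"
  shows "(\<lambda>k. \<integral>z. F z \<partial>\<pi> k) \<longlonglongrightarrow> (\<integral>x. F (x, \<Psi> x) \<partial>\<mu>)"
proof -
  interpret \<mu>: prob_space \<mu> by fact
  have upper: "\<forall>\<^sub>F k in sequentially. (\<integral>z. F z \<partial>\<pi> k) < c"
    if F: "continuous_on UNIV F" "bounded (range F)" and c: "(\<integral>x. F (x, \<Psi> x) \<partial>\<mu>) < c"
    for F :: "'a \<times> 'a \<Rightarrow> real" and c
  proof -
    have [measurable]: "F \<in> borel_measurable borel" using F(1) by (rule borel_measurable_continuous_onI)
    obtain B0 where B0: "\<And>z. \<bar>F z\<bar> \<le> B0" using F(2) by (auto simp: bounded_iff)
    define B where "B = max B0 0"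
    have B: "\<bar>F z\<bar> \<le> B" "0 \<le> B" for z using B0[of z] by (auto simp: B_def)
    have FB: "F z \<le> B" "- B \<le> F z" for z using B(1)[of z] by (auto simp: abs_le_iff)
    \<comment> \<open>The lower bound \<open>- B\<close> of \<open>F\<close> is inserted because there may be no pairs at all.\<close>
    define A where "A = (\<lambda>(m::nat) x. insert (- B) {F z - real m * dist (fst z) x | k z. m \<le> k \<and> z \<in> S k})"
    define U where "U = (\<lambda>m x. Sup (A m x))"
    have A_le: "a \<le> B" if "a \<in> A m x" for a m x
    proof -
      have "F z - real m * dist (fst z) x \<le> B" for z :: "'a \<times> 'a"
      proof -
        have "0 \<le> real m * dist (fst z) x" by simp
        then show ?thesis using FB(1)[of z] by linarith
      qed
      then show ?thesis using that B(2) by (auto simp: A_def)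
    qed
    have bdd: "bdd_above (A m x)" for m x using A_le by (auto intro!: bdd_aboveI)
    have A_ne: "A m x \<noteq> {}" for m x by (auto simp: A_def)
    have U_ge: "a \<le> U m x" if "a \<in> A m x" for a m x
      unfolding U_def by (rule cSup_upper[OF that bdd])
    have U_le: "U m x \<le> b" if "\<And>a. a \<in> A m x \<Longrightarrow> a \<le> b" for m x b
      unfolding U_def by (rule cSup_least[OF A_ne that])
    have UB: "\<bar>U m x\<bar> \<le> B" for m x
      using U_le[OF A_le] U_ge[of "- B" m x] by (auto simp: abs_le_iff A_def)
    have lip: "U m x \<le> U m x' + real m * dist x x'" for m x x'
    proof (rule U_le)
      fix a assume "a \<in> A m x"
      then consider "a = - B" | k z where "a = F z - real m * dist (fst z) x" "m \<le> k" "z \<in> S k"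
        by (auto simp: A_def)
      then show "a \<le> U m x' + real m * dist x x'"
      proof cases
        case 1
        then show ?thesis using U_ge[of "- B" m x'] by (simp add: A_def add_increasing2)
      next
        case 2
        have "F z - real m * dist (fst z) x' \<le> U m x'" by (rule U_ge) (use 2 in \<open>unfold A_def, blast\<close>)
        moreover have "real m * dist (fst z) x' \<le> real m * (dist (fst z) x + dist x x')"
          by (intro mult_left_mono dist_triangle) simp
        ultimately show ?thesis unfolding 2 by (simp add: distrib_left)
      qed
    qed
    have contU: "continuous_on UNIV (U m)" for m
    proof -
      have "\<bar>U m x - U m x'\<bar> \<le> real m * dist x x'" for x x'
        using lip[of m x x'] lip[of m x' x] by (simp add: abs_le_iff dist_commute)
      then have "(real m)-lipschitz_on UNIV (U m)" by (auto simp: lipschitz_on_def dist_real_def)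
      then show ?thesis by (rule lipschitz_on_continuous_on)
    qed
    have U_meas[measurable]: "U m \<in> borel_measurable borel" for m
      using contU by (rule borel_measurable_continuous_onI)
    \<comment> \<open>\<open>U m x\<close> need not approach \<open>F (x, \<Psi> x)\<close> from below if no pairs are near \<open>x\<close>; the maximum still converges.\<close>
    define V where "V = (\<lambda>m x. max (U m x) (F (x, \<Psi> x)))"
    have V_meas[measurable]: "V m \<in> borel_measurable borel" for m unfolding V_def by measurable
    have VB: "\<bar>V m x\<bar> \<le> B" for m x using UB[of m x] B(1)[of "(x, \<Psi> x)"] by (auto simp: V_def)
    have "(\<lambda>m. \<integral>x. V m x \<partial>\<mu>) \<longlonglongrightarrow> (\<integral>x. F (x, \<Psi> x) \<partial>\<mu>)"
    proof (rule integral_dominated_convergence[where w = "\<lambda>_. B"])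
      show "AE x in \<mu>. (\<lambda>m. V m x) \<longlonglongrightarrow> F (x, \<Psi> x)"
        using loc
      proof eventually_elim
        case (elim x)
        show ?case
        proof (rule tendstoI)
          fix e :: real assume e: "e > 0"
          have "isCont F (x, \<Psi> x)" using F(1) by (simp add: continuous_on_eq_continuous_at)
          then obtain \<eta> where \<eta>: "\<eta> > 0" "\<And>z. dist z (x, \<Psi> x) < \<eta> \<Longrightarrow> dist (F z) (F (x, \<Psi> x)) < e / 2"
            using e unfolding continuous_at_eps_delta by (meson half_gt_zero)
          obtain d0 K where d0: "d0 > 0"
            and K: "\<And>k x' y'. k \<ge> K \<Longrightarrow> (x', y') \<in> S k \<Longrightarrow> dist x' x < d0 \<Longrightarrow> dist y' (\<Psi> x) < \<eta> / 2"
            using elim[rule_format, OF half_gt_zero[OF \<eta>(1)]] by blast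
          define d where "d = min d0 (\<eta> / 2)"
          have d: "d > 0" using d0 \<eta> by (simp add: d_def)
          obtain L :: nat where L: "2 * B / d < real L" using reals_Archimedean2 by blast
          have bound: "U m x \<le> F (x, \<Psi> x) + e / 2" if m: "m \<ge> K" "m \<ge> L" for m
          proof (rule U_le)
            fix a assume "a \<in> A m x"
            then consider "a = - B" | k z where "a = F z - real m * dist (fst z) x" "m \<le> k" "z \<in> S k"
              by (auto simp: A_def)
            then show "a \<le> F (x, \<Psi> x) + e / 2"
            proof cases
              case 1
              then show ?thesis using FB(2)[of "(x, \<Psi> x)"] e by simp
            next
              case 2
              show ?thesis
              proof (cases "dist (fst z) x < d")
                case True
                have "dist (snd z) (\<Psi> x) < \<eta> / 2"
                  using K[of k "fst z" "snd z"] 2 m True by (simp add: d_def)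
                moreover have "dist z (x, \<Psi> x) \<le> dist (fst z) x + dist (snd z) (\<Psi> x)"
                  using norm_Pair_le[of "fst z - x" "snd z - \<Psi> x"] by (cases z) (simp add: dist_norm)
                ultimately have "dist z (x, \<Psi> x) < \<eta>" using True by (simp add: d_def)
                from \<eta>(2)[OF this] have "F z < F (x, \<Psi> x) + e / 2"
                  unfolding dist_real_def abs_less_iff by linarith
                moreover have "0 \<le> real m * dist (fst z) x" by simp
                ultimately show ?thesis using 2 by linarith
              next
                case False
                have "2 * B < real L * d" using L d by (simp add: field_simps)
                also have "\<dots> \<le> real m * dist (fst z) x" using False d m by (intro mult_mono) auto
                finally show ?thesis using 2 FB(1)[of z] FB(2)[of "(x, \<Psi> x)"] e by linarith
              qed
            qed
          qed
          have "dist (V m x) (F (x, \<Psi> x)) < e" if "m \<ge> max K L" for m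
            using bound[of m] that e by (auto simp: V_def dist_real_def)
          then show "\<forall>\<^sub>F m in sequentially. dist (V m x) (F (x, \<Psi> x)) < e"
            by (rule eventually_sequentiallyI)
        qed
      qed
      show "AE x in \<mu>. norm (V m x) \<le> B" for m using VB by simp
    qed (use sets in measurable)
    from eventually_happens'[OF sequentially_bot order_tendstoD(2)[OF this c]]
    obtain m where m: "(\<integral>x. V m x \<partial>\<mu>) < c" by blast
    have intU: "integrable \<mu> (U m)" by (rule \<mu>.integrable_const_bound[of _ B]) (use UB in auto)
    have intV: "integrable \<mu> (V m)" by (rule \<mu>.integrable_const_bound[of _ B]) (use VB in auto)
    have "(\<integral>x. U m x \<partial>\<mu>) \<le> (\<integral>x. V m x \<partial>\<mu>)"
      by (rule integral_mono[OF intU intV]) (simp add: V_def)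
    then have Uc: "(\<integral>x. U m x \<partial>\<mu>) < c" using m by linarith
    have "bounded (range (U m))" using UB by (auto simp: bounded_iff)
    from order_tendstoD(2)[OF marg[OF contU this] Uc]
    have "\<forall>\<^sub>F k in sequentially. (\<integral>z. U m (fst z) \<partial>\<pi> k) < c" .
    moreover have "\<forall>\<^sub>F k in sequentially. m \<le> k" by (rule eventually_ge_at_top)
    ultimately show ?thesis
    proof eventually_elim
      case (elim k)
      interpret p: prob_space "\<pi> k" by (rule \<pi>)
      have [measurable_cong]: "sets (\<pi> k) = sets (borel \<Otimes>\<^sub>M borel)" by (simp only: sets\<pi> borel_prod)
      have [measurable]: "F \<in> borel_measurable (\<pi> k)" using sets\<pi>[of k] by (simp cong: measurable_cong_sets)
      have "(\<integral>z. F z \<partial>\<pi> k) \<le> (\<integral>z. U m (fst z) \<partial>\<pi> k)"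
      proof (rule integral_mono_AE)
        show "integrable (\<pi> k) F" by (rule p.integrable_const_bound[of _ B]) (use B in auto)
        show "integrable (\<pi> k) (\<lambda>z. U m (fst z))" by (rule p.integrable_const_bound[of _ B]) (use UB in auto)
        show "AE z in \<pi> k. F z \<le> U m (fst z)"
          using on
        proof eventually_elim
          case (elim z)
          have "F z - real m * dist (fst z) (fst z) \<le> U m (fst z)"
            by (rule U_ge) (use elim \<open>m \<le> k\<close> in \<open>unfold A_def, blast\<close>)
          then show ?case by simp
        qed
      qed
      then show ?case using elim by linarith
    qed
  qed
  show ?thesis
  proof (rule order_tendstoI)
    fix c assume "(\<integral>x. F (x, \<Psi> x) \<partial>\<mu>) < c"
    then show "\<forall>\<^sub>F k in sequentially. (\<integral>z. F z \<partial>\<pi> k) < c" by (rule upper[OF F])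
  next
    fix c assume c: "c < (\<integral>x. F (x, \<Psi> x) \<partial>\<mu>)"
    have "\<forall>\<^sub>F k in sequentially. (\<integral>z. - F z \<partial>\<pi> k) < - c"
    proof (rule upper)
      show "continuous_on UNIV (\<lambda>z. - F z)" using F(1) by (intro continuous_intros)
      show "bounded (range (\<lambda>z. - F z))" using F(2) by (simp add: bounded_iff)
    qed (use c in simp)
    then show "\<forall>\<^sub>F k in sequentially. c < (\<integral>z. F z \<partial>\<pi> k)" by simp
  qed
qed

text \<open>Bounded continuous functions approximate the indicator of an open set from below, and open sets
  generate the Borel sets.\<close>
lemma measure_eqI_bounded_continuous:
  fixes M N :: "'a::metric_space measure"
  assumes M: "finite_measure M" "sets M = sets borel" and N: "finite_measure N" "sets N = sets borel"
    and eq: "\<And>g :: 'a \<Rightarrow> real. continuous_on UNIV g \<Longrightarrow> bounded (range g) \<Longrightarrow> (\<integral>x. g x \<partial>M) = (\<integral>x. g x \<partial>N)"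
  shows "M = N"
proof -
  have bnd: "\<bar>min 1 (real k * infdist x A)\<bar> \<le> 1" for k x and A :: "'a set"
  proof -
    have "0 \<le> real k * infdist x A" by (intro mult_nonneg_nonneg infdist_nonneg) simp
    then show ?thesis by linarith
  qed
  have lim: "(\<lambda>k. \<integral>x. min 1 (real k * infdist x (- U)) \<partial>L) \<longlonglongrightarrow> measure L U"
    if L: "finite_measure L" and sL: "sets L = sets borel" and U: "open U" "U \<noteq> UNIV" for L and U :: "'a set"
  proof -
    interpret L: finite_measure L by (rule L)
    have [measurable_cong]: "sets L = sets borel" by (rule sL)
    have [measurable]: "U \<in> sets borel" using U by simp
    have "(\<lambda>k. \<integral>x. min 1 (real k * infdist x (- U)) \<partial>L) \<longlonglongrightarrow> (\<integral>x. indicator U x \<partial>L)"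
    proof (rule integral_dominated_convergence[where w = "\<lambda>_. 1"])
      have "(\<lambda>k. min 1 (real k * infdist x (- U))) \<longlonglongrightarrow> indicator U x" for x
      proof (cases "x \<in> U")
        case True
        then have "infdist x (- U) \<noteq> 0"
          using U in_closed_iff_infdist_zero[of "- U" x] by (auto simp: closed_Compl)
        then have pos: "0 < infdist x (- U)" using infdist_nonneg[of x "- U"] by linarith
        obtain K where K: "1 < real K * infdist x (- U)" using reals_Archimedean3[OF pos] by blast
        have "min 1 (real k * infdist x (- U)) = indicator U x" if "k \<ge> K" for k
        proof -
          have "real K * infdist x (- U) \<le> real k * infdist x (- U)"
            using that pos by (intro mult_right_mono) auto
          then show ?thesis using K True by simp
        qed
        then show ?thesis by (intro tendsto_eventually eventually_sequentiallyI)
      next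
        case False
        then show ?thesis by simp
      qed
      then show "AE x in L. (\<lambda>k. min 1 (real k * infdist x (- U))) \<longlonglongrightarrow> indicator U x" by simp
      show "AE x in L. norm (min 1 (real k * infdist x (- U))) \<le> 1" for k
        using bnd by simp
      show "(\<lambda>x. min 1 (real k * infdist x (- U))) \<in> borel_measurable L" for k
        using borel_measurable_continuous_onI[of "\<lambda>x. min 1 (real k * infdist x (- U))"]
        by (simp add: continuous_intros sL cong: measurable_cong_sets)
    qed simp_all
    then show ?thesis using sL U by simp
  qed
  show ?thesis
  proof (rule measure_eqI_generator_eq[where E = "{U. open U}" and \<Omega> = UNIV and A = "\<lambda>_. UNIV"])
    show "Int_stable {U :: 'a set. open U}" by (auto simp: Int_stable_def)
    show "sets M = sigma_sets UNIV {U. open U}" "sets N = sigma_sets UNIV {U. open U}"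
      using M N by (simp_all add: sets_borel)
    show "emeasure M UNIV \<noteq> \<infinity>" using finite_measure.emeasure_finite[OF M(1)] by simp
    fix U :: "'a set" assume "U \<in> {U. open U}"
    then have U: "open U" by simp
    have "measure M U = measure N U"
    proof (cases "U = UNIV")
      case True
      have "measure M (space M) = measure N (space N)" using eq[of "\<lambda>_. 1"] by simp
      moreover have "space M = UNIV" "space N = UNIV" using M N by (auto dest: sets_eq_imp_space_eq)
      ultimately show ?thesis using True by simp
    next
      case False
      have "(\<integral>x. min 1 (real k * infdist x (- U)) \<partial>M) = (\<integral>x. min 1 (real k * infdist x (- U)) \<partial>N)" for k
      proof (rule eq)
        show "bounded (range (\<lambda>x. min 1 (real k * infdist x (- U))))"
          using bnd by (auto simp: bounded_iff)
      qed (intro continuous_intros)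
      then show ?thesis
        using LIMSEQ_unique[OF lim[OF M U False]] lim[OF N U False] by simp
    qed
    then show "emeasure M U = emeasure N U"
      using finite_measure.emeasure_eq_measure[OF M(1)] finite_measure.emeasure_eq_measure[OF N(1)] by simp
  qed auto
qed

section \<open>Stability of monotone transport plans\<close>

text \<open>Tightness of the second marginals. Since \<open>f \<le> \<rho>\<close>, the function \<open>f (fst z) - \<rho> * \<kappa> R (snd z)\<close> is
  positive only for \<open>z\<close> in a fixed compact set. Its integrals have a positive limit when the cutoff
  radius \<open>R\<close> is large, so eventually the \<open>S k\<close> meet this compact set, and cluster points of the
  points found there belong to \<open>\<Gamma>\<close>.\<close>
lemma limit_domain_meets_charged_balls:
  fixes \<pi> :: "nat \<Rightarrow> ('a::euclidean_space \<times> 'a) measure"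
  assumes \<mu>: "prob_space \<mu>" and sets\<mu>: "sets \<mu> = sets borel"
    and \<nu>: "prob_space \<nu>" and sets\<nu>: "sets \<nu> = sets borel"
    and \<pi>: "\<And>k. prob_space (\<pi> k)" and sets\<pi>: "\<And>k. sets (\<pi> k) = sets borel"
    and on: "\<And>k. AE z in \<pi> k. z \<in> S k"
    and marg1: "\<And>g :: 'a \<Rightarrow> real. continuous_on UNIV g \<Longrightarrow> bounded (range g) \<Longrightarrow>
        (\<lambda>k. \<integral>z. g (fst z) \<partial>\<pi> k) \<longlonglongrightarrow> (\<integral>x. g x \<partial>\<mu>)"
    and marg2: "\<And>g :: 'a \<Rightarrow> real. continuous_on UNIV g \<Longrightarrow> bounded (range g) \<Longrightarrow>
        (\<lambda>k. \<integral>z. g (snd z) \<partial>\<pi> k) \<longlonglongrightarrow> (\<integral>y. g y \<partial>\<nu>)"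
    and lim: "kuratowski_limit S \<Gamma>"
    and ball: "emeasure \<mu> (ball c \<rho>) \<noteq> 0"
  shows "\<exists>x\<in>fst ` \<Gamma>. x \<in> cball c \<rho>"
proof -
  interpret \<mu>: prob_space \<mu> by fact
  interpret \<nu>: prob_space \<nu> by fact
  note [measurable_cong] = sets\<mu> sets\<nu>
  have \<rho>: "\<rho> > 0" using ball ball_empty[of \<rho> c] by (cases "\<rho> > 0") (auto simp: not_less)
  define f :: "'a \<Rightarrow> real" where "f = (\<lambda>x. max 0 (\<rho> - dist x c))"
  have f: "0 \<le> f x" "f x \<le> \<rho>" for x using \<rho> by (auto simp: f_def)
  have f_cont: "continuous_on UNIV f" unfolding f_def by (intro continuous_intros)
  have f_bdd: "bounded (range f)" using f by (auto simp: bounded_iff intro!: exI[of _ \<rho>])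
  have f_meas[measurable]: "f \<in> borel_measurable borel" using f_cont by (rule borel_measurable_continuous_onI)
  have f_int: "integrable \<mu> f" by (rule \<mu>.integrable_const_bound[of _ \<rho>]) (use f in auto)
  have f_pos: "0 < (\<integral>x. f x \<partial>\<mu>)"
  proof (rule ccontr)
    assume "\<not> ?thesis"
    moreover have "0 \<le> (\<integral>x. f x \<partial>\<mu>)" using f by (intro integral_nonneg_AE) simp
    ultimately have "(\<integral>x. f x \<partial>\<mu>) = 0" by linarith
    then have "AE x in \<mu>. f x = 0"
      using f_int f by (subst (asm) integral_nonneg_eq_0_iff_AE) auto
    then have "AE x in \<mu>. x \<notin> ball c \<rho>"
      by eventually_elim (auto simp: f_def dist_commute max_def split: if_splits)
    moreover have "ball c \<rho> \<in> sets \<mu>" by (simp add: sets\<mu>)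
    ultimately have "emeasure \<mu> (ball c \<rho>) = 0" by (simp add: AE_iff_null_sets null_setsD1)
    then show False using ball by simp
  qed
  define \<kappa> :: "nat \<Rightarrow> 'a \<Rightarrow> real" where "\<kappa> = (\<lambda>R y. min 1 (max 0 (norm y - real R)))"
  have \<kappa>: "0 \<le> \<kappa> R y" "\<kappa> R y \<le> 1" for R y by (auto simp: \<kappa>_def)
  have \<kappa>_cont: "continuous_on UNIV (\<kappa> R)" for R unfolding \<kappa>_def by (intro continuous_intros)
  have \<kappa>_bdd: "bounded (range (\<kappa> R))" for R using \<kappa> by (auto simp: bounded_iff intro!: exI[of _ 1])
  have \<kappa>_meas[measurable]: "\<kappa> R \<in> borel_measurable borel" for R
    using \<kappa>_cont by (rule borel_measurable_continuous_onI)
  have "(\<lambda>R. \<integral>y. \<kappa> R y \<partial>\<nu>) \<longlonglongrightarrow> (\<integral>y. 0 \<partial>\<nu>)"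
  proof (rule integral_dominated_convergence[where w = "\<lambda>_. 1"])
    have "(\<lambda>R. \<kappa> R y) \<longlonglongrightarrow> 0" for y
    proof (rule tendsto_eventually)
      obtain R where "norm y \<le> real R" using real_arch_simple by blast
      then show "\<forall>\<^sub>F R in sequentially. \<kappa> R y = 0"
        by (intro eventually_sequentiallyI[of R]) (auto simp: \<kappa>_def)
    qed
    then show "AE y in \<nu>. (\<lambda>R. \<kappa> R y) \<longlonglongrightarrow> 0" by simp
    show "AE y in \<nu>. norm (\<kappa> R y) \<le> 1" for R using \<kappa> by simp
  qed simp_all
  then have tight: "(\<lambda>R. \<integral>y. \<kappa> R y \<partial>\<nu>) \<longlonglongrightarrow> 0" by simp
  have "0 < (\<integral>x. f x \<partial>\<mu>) / \<rho>" using f_pos \<rho> by simp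
  from eventually_happens'[OF sequentially_bot order_tendstoD(2)[OF tight this]]
  obtain R where R: "(\<integral>y. \<kappa> R y \<partial>\<nu>) < (\<integral>x. f x \<partial>\<mu>) / \<rho>" by blast
  have "(\<lambda>k. (\<integral>z. f (fst z) \<partial>\<pi> k) - \<rho> * (\<integral>z. \<kappa> R (snd z) \<partial>\<pi> k))
      \<longlonglongrightarrow> (\<integral>x. f x \<partial>\<mu>) - \<rho> * (\<integral>y. \<kappa> R y \<partial>\<nu>)"
    by (intro tendsto_intros marg1 marg2 f_cont f_bdd \<kappa>_cont \<kappa>_bdd)
  moreover have "0 < (\<integral>x. f x \<partial>\<mu>) - \<rho> * (\<integral>y. \<kappa> R y \<partial>\<nu>)"
    using R \<rho> by (simp add: field_simps)
  ultimately have "\<forall>\<^sub>F k in sequentially. 0 < (\<integral>z. f (fst z) \<partial>\<pi> k) - \<rho> * (\<integral>z. \<kappa> R (snd z) \<partial>\<pi> k)"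
    by (rule order_tendstoD)
  then have "\<forall>\<^sub>F k in sequentially. \<exists>z\<in>S k. z \<in> cball c \<rho> \<times> cball 0 (real R + 1)"
  proof eventually_elim
    case (elim k)
    interpret p: prob_space "\<pi> k" by (rule \<pi>)
    have [measurable_cong]: "sets (\<pi> k) = sets (borel \<Otimes>\<^sub>M borel)" by (simp only: sets\<pi> borel_prod)
    have i1: "integrable (\<pi> k) (\<lambda>z. f (fst z))"
      by (rule p.integrable_const_bound[of _ \<rho>]) (use f in auto)
    have i2: "integrable (\<pi> k) (\<lambda>z. \<rho> * \<kappa> R (snd z))"
      by (intro integrable_mult_right p.integrable_const_bound[of _ 1]) (use \<kappa> in auto)
    show ?case
    proof (rule ccontr)
      assume neg: "\<not> ?thesis"
      have "AE z in \<pi> k. f (fst z) \<le> \<rho> * \<kappa> R (snd z)"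
        using on
      proof eventually_elim
        case (elim z)
        then have "z \<notin> cball c \<rho> \<times> cball 0 (real R + 1)" using neg by blast
        then consider "\<rho> < dist c (fst z)" | "real R + 1 < norm (snd z)"
          by (cases z) (auto simp: not_le)
        then show ?case
        proof cases
          case 1
          then have "f (fst z) = 0" by (simp add: f_def dist_commute)
          then show ?thesis using \<rho> \<kappa>(1)[of R "snd z"] by simp
        next
          case 2
          then have "\<kappa> R (snd z) = 1" by (simp add: \<kappa>_def)
          then show ?thesis using f(2)[of "fst z"] by simp
        qed
      qed
      then have "(\<integral>z. f (fst z) \<partial>\<pi> k) \<le> (\<integral>z. \<rho> * \<kappa> R (snd z) \<partial>\<pi> k)"
        by (rule integral_mono_AE[OF i1 i2])
      then show False using elim by simp
    qed
  qed
  then obtain N where N: "\<And>k. k \<ge> N \<Longrightarrow> \<exists>z\<in>S k. z \<in> cball c \<rho> \<times> cball 0 (real R + 1)"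
    unfolding eventually_sequentially by blast
  have "\<forall>j. \<exists>z. z \<in> S (j + N) \<and> z \<in> cball c \<rho> \<times> cball 0 (real R + 1)"
    using N by (metis le_add2)
  then obtain z where z: "\<And>j. z j \<in> S (j + N)" "\<And>j. z j \<in> cball c \<rho> \<times> cball 0 (real R + 1)"
    by metis
  have "compact (cball c \<rho> \<times> cball (0 :: 'a) (real R + 1))" by (intro compact_Times compact_cball)
  moreover have "\<forall>j. z j \<in> cball c \<rho> \<times> cball 0 (real R + 1)" using z(2) by blast
  ultimately obtain w l where w: "w \<in> cball c \<rho> \<times> cball 0 (real R + 1)" and l: "strict_mono l" "(z \<circ> l) \<longlonglongrightarrow> w"
    by (rule seq_compactE[OF compact_imp_seq_compact])
  have "filterlim (\<lambda>j. l j + N) at_top sequentially"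
    using filterlim_subseq[OF l(1)] by (rule filterlim_at_top_mono) simp
  then have "w \<in> \<Gamma>" by (rule kuratowski_limitD2[OF lim]) (use z(1) l(2) in \<open>auto simp: comp_def\<close>)
  with w show ?thesis by force
qed

text \<open>The complement of \<open>closure D\<close> is covered by basic open sets of measure zero.\<close>
lemma AE_in_closure_of_charged:
  fixes \<mu> :: "'a::euclidean_space measure"
  assumes sets\<mu>: "sets \<mu> = sets borel"
    and meets: "\<And>c \<rho>. emeasure \<mu> (ball c \<rho>) \<noteq> 0 \<Longrightarrow> \<exists>x\<in>D. x \<in> cball c \<rho>"
  shows "AE x in \<mu>. x \<in> closure D"
proof -
  obtain \<B> :: "'a set set" where \<B>: "countable \<B>" "topological_basis \<B>"
    using ex_countable_basis by blast
  define \<N> where "\<N> = {U \<in> \<B>. emeasure \<mu> U = 0}"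
  have null: "U \<in> null_sets \<mu>" if "U \<in> \<N>" for U
    using that topological_basis_open[OF \<B>(2)] by (auto simp: \<N>_def null_sets_def sets\<mu>)
  have "countable \<N>" using \<B>(1) by (auto simp: \<N>_def)
  then have "\<Union>\<N> \<in> null_sets \<mu>" using null_sets_UN'[of \<N> "\<lambda>U. U"] null by simp
  then have "AE x in \<mu>. x \<notin> \<Union>\<N>" by (rule AE_not_in)
  then show ?thesis
  proof eventually_elim
    case (elim x)
    show ?case
    proof (rule ccontr)
      assume "x \<notin> closure D"
      then have "\<exists>e>0. cball x e \<subseteq> - closure D"
        using open_contains_cball[of "- closure D"] by auto
      then obtain e where e: "e > 0" "cball x e \<subseteq> - closure D" by blast
      then have "\<not> (\<exists>y\<in>D. y \<in> cball x e)" using closure_subset by blast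
      then have z: "emeasure \<mu> (ball x e) = 0" using meets by blast
      obtain U where U: "U \<in> \<B>" "x \<in> U" "U \<subseteq> ball x e"
        using topological_basisE[OF \<B>(2), of "ball x e" x] e by auto
      have "emeasure \<mu> U \<le> emeasure \<mu> (ball x e)" using U(3) by (rule emeasure_mono) (simp add: sets\<mu>)
      then have "U \<in> \<N>" using z U by (simp add: \<N>_def)
      then show False using elim U by blast
    qed
  qed
qed

lemma null_frontier_convex:
  fixes C :: "'a::euclidean_space set"
  assumes "convex C"
  shows "frontier C \<in> null_sets lborel"
  using negligible_convex_frontier[OF assms]
  by (simp add: negligible_iff_null_sets null_sets_completion_iff)

text \<open>Almost every \<open>x\<close> belongs to the set \<open>G\<close> of points of \<open>closure D\<close>, where \<open>D\<close> is the domain of the limit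
  \<open>\<Gamma>\<close> of the supports, that are interior to the convex hull \<open>C\<close> of \<open>D\<close> and outside the null set
  where \<open>\<Gamma>\<close> is multivalued: the closure has full measure by tightness and the frontier of the convex set \<open>C\<close>
  is a null set. On \<open>G\<close> the limit \<open>\<Gamma>\<close> is the graph of a continuous map, and the supports converge to it
  locally, which identifies the limit of the plans and hence the image of \<open>\<mu>\<close>.\<close>
lemma monotone_plans_converge_along_subsequence:
  fixes \<pi> :: "nat \<Rightarrow> ('a::euclidean_space \<times> 'a) measure"
  assumes \<mu>: "prob_space \<mu>" and sets\<mu>: "sets \<mu> = sets borel" and ac: "null_sets lborel \<subseteq> null_sets \<mu>"
    and \<nu>: "prob_space \<nu>" and sets\<nu>: "sets \<nu> = sets borel"
    and \<pi>: "\<And>k. prob_space (\<pi> k)" and sets\<pi>: "\<And>k. sets (\<pi> k) = sets borel"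
    and on: "\<And>k. AE z in \<pi> k. z \<in> S k" and cm: "\<And>k. cyclically_monotone (S k)"
    and marg1: "\<And>g :: 'a \<Rightarrow> real. continuous_on UNIV g \<Longrightarrow> bounded (range g) \<Longrightarrow>
        (\<lambda>k. \<integral>z. g (fst z) \<partial>\<pi> k) \<longlonglongrightarrow> (\<integral>x. g x \<partial>\<mu>)"
    and marg2: "\<And>g :: 'a \<Rightarrow> real. continuous_on UNIV g \<Longrightarrow> bounded (range g) \<Longrightarrow>
        (\<lambda>k. \<integral>z. g (snd z) \<partial>\<pi> k) \<longlonglongrightarrow> (\<integral>y. g y \<partial>\<nu>)"
  obtains r \<Psi> \<Gamma> where "strict_mono (r :: nat \<Rightarrow> nat)" "\<Psi> \<in> borel_measurable borel"
    "distr \<mu> borel \<Psi> = \<nu>" "cyclically_monotone \<Gamma>" "AE x in \<mu>. (x, \<Psi> x) \<in> \<Gamma>"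
    "AE x in \<mu>. \<forall>e>0. \<exists>d>0. \<exists>K. \<forall>k\<ge>K. \<forall>x' y'. (x', y') \<in> S (r k) \<longrightarrow> dist x' x < d \<longrightarrow> dist y' (\<Psi> x) < e"
proof -
  interpret \<mu>: prob_space \<mu> by fact
  note [measurable_cong] = sets\<mu> sets\<nu>
  obtain r \<Gamma> where r: "strict_mono (r :: nat \<Rightarrow> nat)" and closed: "closed \<Gamma>"
    and lim: "kuratowski_limit (S \<circ> r) \<Gamma>"
    by (rule kuratowski_subsequence)
  have sub1: "(\<lambda>k. \<integral>z. g (fst z) \<partial>\<pi> (r k)) \<longlonglongrightarrow> (\<integral>x. g x \<partial>\<mu>)"
    and sub2: "(\<lambda>k. \<integral>z. g (snd z) \<partial>\<pi> (r k)) \<longlonglongrightarrow> (\<integral>y. g y \<partial>\<nu>)"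
    if "continuous_on UNIV g" "bounded (range g)" for g :: "'a \<Rightarrow> real"
    using LIMSEQ_subseq_LIMSEQ[OF marg1[OF that] r] LIMSEQ_subseq_LIMSEQ[OF marg2[OF that] r]
    unfolding comp_def by blast+
  have cm\<Gamma>: "cyclically_monotone \<Gamma>"
    by (rule cyclically_monotone_kuratowski_limit[OF _ lim]) (simp add: cm)
  have mono: "monotone_relation ((S \<circ> r) k)" for k
    using cyclically_monotone_imp_monotone[OF cm] by simp
  have mono\<Gamma>: "monotone_relation \<Gamma>" by (rule cyclically_monotone_imp_monotone[OF cm\<Gamma>])
  obtain N where N: "N \<in> null_sets lborel" and
    single: "\<And>x y y'. (x, y) \<in> \<Gamma> \<Longrightarrow> (x, y') \<in> \<Gamma> \<Longrightarrow> x \<notin> N \<Longrightarrow> y = y'"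
    by (rule monotone_relation_single_valued[OF mono\<Gamma>]) blast
  define D where "D = fst ` \<Gamma>"
  define C where "C = convex hull D"
  have D: "AE x in \<mu>. x \<in> closure D"
  proof (rule AE_in_closure_of_charged[OF sets\<mu>])
    fix c \<rho> assume "emeasure \<mu> (ball c \<rho>) \<noteq> 0"
    then show "\<exists>x\<in>D. x \<in> cball c \<rho>"
      unfolding D_def
      by (rule limit_domain_meets_charged_balls[OF \<mu> sets\<mu> \<nu> sets\<nu>, where \<pi> = "\<lambda>k. \<pi> (r k)" and S = "S \<circ> r", rotated -1])
         (use \<pi> sets\<pi> on sub1 sub2 lim in auto)
  qed
  define G where "G = closure D \<inter> interior C - N"
  have N_sets[measurable]: "N \<in> sets borel" using N by (auto simp: null_sets_def)
  have G_sets[measurable]: "G \<in> sets borel" unfolding G_def by (intro sets.Diff sets.Int borel_closed borel_open N_sets) auto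
  have "AE x in \<mu>. x \<notin> frontier C"
    using null_frontier_convex[of C] ac by (intro AE_not_in) (auto simp: C_def convex_convex_hull)
  moreover have "AE x in \<mu>. x \<notin> N" using N ac by (intro AE_not_in) auto
  ultimately have AE_G: "AE x in \<mu>. x \<in> G"
    using D
  proof eventually_elim
    case (elim x)
    have "closure D \<subseteq> closure C" unfolding C_def by (intro closure_mono hull_subset)
    then show ?case using elim by (auto simp: G_def frontier_def)
  qed
  \<comment> \<open>\<open>D\<close> itself need not be closed; local boundedness of \<open>\<Gamma>\<close> supplies a limit of images.\<close>
  have ex: "\<exists>y. (x, y) \<in> \<Gamma>" if x: "x \<in> G" for x
  proof -
    have xi: "x \<in> interior (convex hull (fst ` \<Gamma>))" using x by (simp add: G_def C_def D_def)
    obtain j0 :: nat where j0: "\<And>x' y'. (x', y') \<in> \<Gamma> \<Longrightarrow> dist x' x < 1 / Suc j0 \<Longrightarrow> norm y' \<le> real j0"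
      using monotone_locally_bounded[OF mono\<Gamma> kuratowski_limit_const[OF closed] xi] by blast
    have "x \<in> closure D" using x by (simp add: G_def)
    then obtain a where a: "\<forall>n. a n \<in> D" "a \<longlonglongrightarrow> x" unfolding closure_sequential by (elim exE conjE)
    have "\<forall>\<^sub>F n in sequentially. dist (a n) x < 1 / Suc j0"
      using a(2) by (rule tendstoD) simp
    then obtain n0 where n0: "\<And>n. n \<ge> n0 \<Longrightarrow> dist (a n) x < 1 / Suc j0"
      unfolding eventually_sequentially by blast
    have "\<forall>n. \<exists>y. (a n, y) \<in> \<Gamma>" using a(1) by (force simp: D_def)
    then obtain y where y: "\<And>n. (a n, y n) \<in> \<Gamma>" by metis
    have "\<forall>n. y (n + n0) \<in> cball 0 (real j0)" using j0[OF y] n0 by simp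
    then obtain w l where "w \<in> cball 0 (real j0)" and l: "strict_mono l" "((\<lambda>n. y (n + n0)) \<circ> l) \<longlonglongrightarrow> w"
      by (rule seq_compactE[OF compact_imp_seq_compact[OF compact_cball]])
    have "(\<lambda>n. a (n + n0)) \<longlonglongrightarrow> x" using a(2) by (rule LIMSEQ_ignore_initial_segment)
    from LIMSEQ_subseq_LIMSEQ[OF this l(1)] have "(\<lambda>n. (a (l n + n0), y (l n + n0))) \<longlonglongrightarrow> (x, w)"
      using l(2) unfolding comp_def by (intro tendsto_Pair)
    from closed_sequentially[OF closed _ this] have "(x, w) \<in> \<Gamma>" using y by blast
    then show ?thesis ..
  qed
  define \<Psi> where "\<Psi> = (\<lambda>x. if x \<in> G then (SOME y. (x, y) \<in> \<Gamma>) else 0)"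
  have \<Psi>: "(x, \<Psi> x) \<in> \<Gamma>" if "x \<in> G" for x
    using someI_ex[OF ex[OF that]] that by (simp add: \<Psi>_def)
  have only: "y = \<Psi> x" if "x \<in> G" "(x, y) \<in> \<Gamma>" for x y
    using single[OF that(2) \<Psi>[OF that(1)]] that(1) by (simp add: G_def)
  have loc: "\<exists>d>0. \<exists>K. \<forall>k\<ge>K. \<forall>x' y'. (x', y') \<in> T k \<longrightarrow> dist x' x < d \<longrightarrow> dist y' (\<Psi> x) < e"
    if "x \<in> G" "e > 0" "\<And>k. monotone_relation (T k)" "kuratowski_limit T \<Gamma>" for x e and T :: "nat \<Rightarrow> ('a \<times> 'a) set"
    using that by (intro monotone_convergence_at_single_value[of T \<Gamma>] only) (simp_all add: G_def C_def D_def)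
  \<comment> \<open>Continuity is the convergence statement for the constant sequence with value \<open>\<Gamma>\<close>.\<close>
  have "continuous_on G \<Psi>"
    unfolding continuous_on_iff
  proof (intro ballI allI impI)
    fix x e assume x: "x \<in> G" and e: "(e :: real) > 0"
    obtain d where d: "d > 0" "\<And>x' y'. (x', y') \<in> \<Gamma> \<Longrightarrow> dist x' x < d \<Longrightarrow> dist y' (\<Psi> x) < e"
      using loc[OF x e mono\<Gamma> kuratowski_limit_const[OF closed]] by blast
    then show "\<exists>d>0. \<forall>x'\<in>G. dist x' x < d \<longrightarrow> dist (\<Psi> x') (\<Psi> x) < e" using \<Psi> by blast
  qed
  then have "(\<lambda>x. if x \<in> G then \<Psi> x else 0) \<in> borel_measurable borel"
    by (intro borel_measurable_continuous_on_if G_sets continuous_on_const)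
  also have "(\<lambda>x. if x \<in> G then \<Psi> x else 0) = \<Psi>" by (auto simp: \<Psi>_def)
  finally have \<Psi>_meas[measurable]: "\<Psi> \<in> borel_measurable borel" .
  have LOC: "AE x in \<mu>. \<forall>e>0. \<exists>d>0. \<exists>K. \<forall>k\<ge>K. \<forall>x' y'. (x', y') \<in> S (r k) \<longrightarrow> dist x' x < d \<longrightarrow> dist y' (\<Psi> x) < e"
    using AE_G by eventually_elim (use loc[OF _ _ mono lim] in \<open>simp add: comp_def\<close>)
  have "distr \<mu> borel \<Psi> = \<nu>"
  proof (rule measure_eqI_bounded_continuous)
    show "finite_measure (distr \<mu> borel \<Psi>)" by (intro \<mu>.finite_measure_distr) simp
    show "finite_measure \<nu>" using \<nu> by (simp add: prob_space_def)
    fix g :: "'a \<Rightarrow> real" assume g: "continuous_on UNIV g" "bounded (range g)"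
    have "(\<lambda>k. \<integral>z. g (snd z) \<partial>\<pi> (r k)) \<longlonglongrightarrow> (\<integral>x. g (snd (x, \<Psi> x)) \<partial>\<mu>)"
    proof (rule weak_limit_of_convergent_graphs[OF \<mu> sets\<mu>, where \<pi> = "\<lambda>k. \<pi> (r k)" and S = "\<lambda>k. S (r k)"])
      show "continuous_on UNIV (\<lambda>z :: 'a \<times> 'a. g (snd z))"
        using continuous_on_compose2[OF g(1) continuous_on_snd[OF continuous_on_id]] by simp
      show "bounded (range (\<lambda>z :: 'a \<times> 'a. g (snd z)))"
        using g(2) by (rule bounded_subset) auto
    qed (use \<pi> sets\<pi> on sub1 \<Psi>_meas LOC in auto)
    then have "(\<integral>x. g (\<Psi> x) \<partial>\<mu>) = (\<integral>y. g y \<partial>\<nu>)"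
      using LIMSEQ_unique[OF _ sub2[OF g]] by simp
    moreover have "g \<in> borel_measurable borel" using g(1) by (rule borel_measurable_continuous_onI)
    ultimately show "(\<integral>y. g y \<partial>distr \<mu> borel \<Psi>) = (\<integral>y. g y \<partial>\<nu>)"
      by (subst integral_distr) auto
  qed (simp_all add: sets\<nu>)
  moreover have "AE x in \<mu>. (x, \<Psi> x) \<in> \<Gamma>" using AE_G by eventually_elim (rule \<Psi>)
  ultimately show ?thesis using that r \<Psi>_meas cm\<Gamma> LOC by blast
qed

section \<open>Convergence of the ensemble transform\<close>

definition coupling_measure :: "nat \<Rightarrow> (nat \<Rightarrow> 'a::topological_space) \<Rightarrow> (nat \<Rightarrow> nat \<Rightarrow> real) \<Rightarrow> ('a \<times> 'a) measure" where
  "coupling_measure M x t =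
     distr (point_measure ({..<M} \<times> {..<M}) (\<lambda>(i, j). ennreal (t i j))) borel (\<lambda>(i, j). (x j, x i))"

lemma integral_coupling_measure:
  fixes x :: "nat \<Rightarrow> 'a::topological_space" and f :: "'a \<times> 'a \<Rightarrow> real"
  assumes "coupling M w t" and "f \<in> borel_measurable borel"
  shows "(\<integral>z. f z \<partial>coupling_measure M x t) = (\<Sum>i<M. \<Sum>j<M. t i j * f (x j, x i))"
proof -
  have "(\<integral>z. f z \<partial>coupling_measure M x t)
      = (\<integral>(i, j). f (x j, x i) \<partial>point_measure ({..<M} \<times> {..<M}) (\<lambda>(i, j). ennreal (t i j)))"
    unfolding coupling_measure_def using assms(2)
    by (subst integral_distr) (auto simp: measurable_point_measure_eq1 case_prod_unfold)
  also have "\<dots> = (\<integral>p. f (x (snd p), x (fst p)) \<partial>point_measure ({..<M} \<times> {..<M}) (\<lambda>p. ennreal (t (fst p) (snd p))))"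
    by (simp add: case_prod_unfold)
  also have "\<dots> = (\<Sum>p\<in>{..<M} \<times> {..<M}. t (fst p) (snd p) * f (x (snd p), x (fst p)))"
    using assms(1) by (subst lebesgue_integral_point_measure_finite) (auto simp: coupling_def)
  also have "\<dots> = (\<Sum>i<M. \<Sum>j<M. t i j * f (x j, x i))"
    by (simp add: sum.cartesian_product case_prod_unfold)
  finally show ?thesis .
qed

lemma integral_empirical_coupling:
  fixes x :: "nat \<Rightarrow> 'a::topological_space" and f :: "'a \<times> 'a \<Rightarrow> real"
  assumes "f \<in> borel_measurable borel"
  shows "(\<integral>z. f z \<partial>empirical_coupling M x psi) = (\<Sum>j<M. f (x j, psi (x j))) / real M"
  unfolding empirical_coupling_def using assms
  by (subst integral_distr) (auto simp: integral_uniform_count_measure measurable_def space_uniform_count_measure sets_uniform_count_measure)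

lemma prob_space_coupling_measure:
  fixes x :: "nat \<Rightarrow> 'a::topological_space"
  assumes "coupling M w t" "0 < M"
  shows "prob_space (coupling_measure M x t)"
proof -
  have "emeasure (point_measure ({..<M} \<times> {..<M}) (\<lambda>(i, j). ennreal (t i j))) ({..<M} \<times> {..<M})
      = (\<Sum>(i, j)\<in>{..<M} \<times> {..<M}. ennreal (t i j))"
    by (subst emeasure_point_measure_finite) (auto simp: case_prod_unfold)
  also have "\<dots> = (\<Sum>j<M. \<Sum>i<M. ennreal (t i j))"
    by (subst sum.swap) (simp add: sum.cartesian_product)
  also have "\<dots> = (\<Sum>j<M. ennreal (\<Sum>i<M. t i j))"
    using assms(1) by (intro sum.cong refl sum_ennreal) (auto simp: coupling_def)
  also have "\<dots> = (\<Sum>j<M. ennreal (1 / real M))"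
    using assms(1) by (intro sum.cong refl) (auto simp: coupling_def)
  also have "\<dots> = ennreal (\<Sum>j<M. 1 / real M)" by (rule sum_ennreal) simp
  also have "(\<Sum>j<M. 1 / real M) = 1" using assms(2) by simp
  finally have "prob_space (point_measure ({..<M} \<times> {..<M}) (\<lambda>(i, j). ennreal (t i j)))"
    by (intro prob_spaceI) (simp add: space_point_measure)
  then show ?thesis
    unfolding coupling_measure_def by (rule prob_space.prob_space_distr) auto
qed

lemma finite_coupling_support: "finite (coupling_support M x t)"
  by (rule finite_subset[of _ "(\<lambda>(i, j). (x j, x i)) ` ({..<M} \<times> {..<M})"])
     (auto simp: coupling_support_def)

lemma AE_coupling_measure:
  fixes x :: "nat \<Rightarrow> 'a::t2_space"
  shows "AE z in coupling_measure M x t. z \<in> coupling_support M x t"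
proof -
  have "AE p in point_measure ({..<M} \<times> {..<M}) (\<lambda>(i, j). ennreal (t i j)).
      (case p of (i, j) \<Rightarrow> (x j, x i)) \<in> coupling_support M x t"
    by (auto simp: AE_point_measure coupling_support_def)
  moreover have "coupling_support M x t \<in> sets borel"
    using finite_coupling_support by (intro borel_closed finite_imp_closed)
  ultimately show ?thesis
    unfolding coupling_measure_def by (subst AE_distr_iff) auto
qed

text \<open>The first marginal of the coupling of the first \<open>M\<close> terms is the empirical measure, the second one is
  weighted by the likelihood. The normalising sum, divided by \<open>M\<close>, tends to \<open>Z\<close>, the evidence.\<close>
lemma optimal_couplings_converge_along_subsequence:
  fixes x :: "nat \<Rightarrow> 'a::euclidean_space"
  assumes \<mu>: "prob_space \<mu>" and sets\<mu>: "sets \<mu> = sets borel" and ac: "null_sets lborel \<subseteq> null_sets \<mu>"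
    and \<nu>: "prob_space \<nu>" and sets\<nu>: "sets \<nu> = sets borel" and Z: "0 < Z"
    and emp1: "\<And>f :: 'a \<Rightarrow> real. continuous_on UNIV f \<Longrightarrow> bounded (range f) \<Longrightarrow>
        (\<lambda>n. (\<Sum>i<n. f (x i)) / real n) \<longlonglongrightarrow> (\<integral>x. f x \<partial>\<mu>)"
    and emp2: "\<And>f :: 'a \<Rightarrow> real. continuous_on UNIV f \<Longrightarrow> bounded (range f) \<Longrightarrow>
        (\<lambda>n. (\<Sum>i<n. L (x i) * f (x i)) / real n) \<longlonglongrightarrow> Z * (\<integral>y. f y \<partial>\<nu>)"
    and q: "strict_mono q" and q_pos: "\<And>k. 0 < (\<Sum>l<q k. L (x l))"
    and opt: "\<And>k. optimal_coupling (q k) (importance_weight L x (q k)) x (t k)"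
  obtains r \<Psi> \<Gamma> where "strict_mono (r :: nat \<Rightarrow> nat)" "\<Psi> \<in> borel_measurable borel"
    "distr \<mu> borel \<Psi> = \<nu>" "cyclically_monotone \<Gamma>" "AE x in \<mu>. (x, \<Psi> x) \<in> \<Gamma>"
    "AE a in \<mu>. \<forall>e>0. \<exists>d>0. \<exists>K. \<forall>k\<ge>K. \<forall>x' y'.
       (x', y') \<in> coupling_support (q (r k)) x (t (r k)) \<longrightarrow> dist x' a < d \<longrightarrow> dist y' (\<Psi> a) < e"
proof -
  interpret \<nu>: prob_space \<nu> by fact
  define w where "w = (\<lambda>k. importance_weight L x (q k))"
  have cpl: "coupling (q k) (w k) (t k)" for k using opt by (simp add: optimal_coupling_def w_def)
  have q0: "0 < q k" for k using q_pos[of k] by (cases "q k") auto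
  have q_top: "filterlim q at_top sequentially" using q by (rule filterlim_subseq)
  have m1: "(\<integral>z. g (fst z) \<partial>coupling_measure (q k) x (t k)) = (\<Sum>j<q k. g (x j)) / real (q k)"
    if [measurable]: "g \<in> borel_measurable borel" for g :: "'a \<Rightarrow> real" and k
  proof -
    have "(\<integral>z. g (fst z) \<partial>coupling_measure (q k) x (t k)) = (\<Sum>i<q k. \<Sum>j<q k. t k i j * g (x j))"
      by (subst integral_coupling_measure[OF cpl]) (auto simp: borel_prod[symmetric])
    also have "\<dots> = (\<Sum>j<q k. (\<Sum>i<q k. t k i j) * g (x j))"
      by (subst sum.swap) (simp add: sum_distrib_right)
    also have "\<dots> = (\<Sum>j<q k. 1 / real (q k) * g (x j))"
      using cpl[of k] by (intro sum.cong refl) (simp add: coupling_def)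
    finally show ?thesis by (simp add: sum_divide_distrib)
  qed
  have m2: "(\<integral>z. g (snd z) \<partial>coupling_measure (q k) x (t k))
      = ((\<Sum>i<q k. L (x i) * g (x i)) / real (q k)) / ((\<Sum>i<q k. L (x i) * 1) / real (q k))"
    if [measurable]: "g \<in> borel_measurable borel" for g :: "'a \<Rightarrow> real" and k
  proof -
    have "(\<integral>z. g (snd z) \<partial>coupling_measure (q k) x (t k)) = (\<Sum>i<q k. \<Sum>j<q k. t k i j * g (x i))"
      by (subst integral_coupling_measure[OF cpl]) (auto simp: borel_prod[symmetric])
    also have "\<dots> = (\<Sum>i<q k. w k i * g (x i))"
      using cpl[of k] by (intro sum.cong refl) (simp add: coupling_def sum_distrib_right[symmetric])
    also have "\<dots> = (\<Sum>i<q k. L (x i) * g (x i)) / (\<Sum>i<q k. L (x i))"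
      by (simp add: w_def importance_weight_def sum_divide_distrib)
    finally show ?thesis using q0[of k] by simp
  qed
  show ?thesis
  proof (rule monotone_plans_converge_along_subsequence[OF \<mu> sets\<mu> ac \<nu> sets\<nu>,
        where \<pi> = "\<lambda>k. coupling_measure (q k) x (t k)" and S = "\<lambda>k. coupling_support (q k) x (t k)"])
    show "prob_space (coupling_measure (q k) x (t k))" for k
      by (rule prob_space_coupling_measure[OF cpl q0])
    show "sets (coupling_measure (q k) x (t k)) = sets borel" for k
      by (simp add: coupling_measure_def)
    show "AE z in coupling_measure (q k) x (t k). z \<in> coupling_support (q k) x (t k)" for k
      by (rule AE_coupling_measure)
    show "cyclically_monotone (coupling_support (q k) x (t k))" for k
      by (rule optimal_coupling_support_cyclically_monotone[OF opt])
    fix g :: "'a \<Rightarrow> real" assume g: "continuous_on UNIV g" "bounded (range g)"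
    have gm: "g \<in> borel_measurable borel" using g(1) by (rule borel_measurable_continuous_onI)
    show "(\<lambda>k. \<integral>z. g (fst z) \<partial>coupling_measure (q k) x (t k)) \<longlonglongrightarrow> (\<integral>x. g x \<partial>\<mu>)"
      unfolding m1[OF gm] by (rule filterlim_compose[OF emp1[OF g] q_top])
    have "(\<lambda>n. (\<Sum>i<n. L (x i) * 1) / real n) \<longlonglongrightarrow> Z * (\<integral>y. 1 \<partial>\<nu>)"
      by (rule emp2) auto
    then have one: "(\<lambda>n. (\<Sum>i<n. L (x i) * 1) / real n) \<longlonglongrightarrow> Z" by (simp add: \<nu>.prob_space)
    have "(\<lambda>k. ((\<Sum>i<q k. L (x i) * g (x i)) / real (q k)) / ((\<Sum>i<q k. L (x i) * 1) / real (q k)))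
        \<longlonglongrightarrow> Z * (\<integral>y. g y \<partial>\<nu>) / Z"
      using Z by (intro tendsto_divide filterlim_compose[OF emp2[OF g] q_top] filterlim_compose[OF one q_top]) simp
    then show "(\<lambda>k. \<integral>z. g (snd z) \<partial>coupling_measure (q k) x (t k)) \<longlonglongrightarrow> (\<integral>y. g y \<partial>\<nu>)"
      unfolding m2[OF gm] using Z by simp
  qed (rule that)
qed

text \<open>A weighted mean of points of a ball lies in the ball.\<close>
lemma transformed_ensemble_near:
  fixes x :: "nat \<Rightarrow> 'a::real_normed_vector"
  assumes cpl: "coupling M w t" and j: "j < M"
    and near: "\<And>i. i < M \<Longrightarrow> 0 < t i j \<Longrightarrow> dist (x i) y < e"
  shows "dist (transformed_ensemble M x t j) y < e"
proof -
  define I where "I = {i \<in> {..<M}. 0 < t i j}"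
  have t0: "t i j = 0" if "i \<in> {..<M} - I" for i
    using that cpl j by (force simp: I_def coupling_def)
  have "(\<Sum>i\<in>I. real M * t i j) = (\<Sum>i<M. real M * t i j)"
    using t0 by (intro sum.mono_neutral_left) (auto simp: I_def)
  also have "\<dots> = 1" using cpl j by (simp add: coupling_def sum_distrib_left[symmetric])
  finally have one: "(\<Sum>i\<in>I. real M * t i j) = 1" .
  have "transformed_ensemble M x t j = (\<Sum>i\<in>I. (real M * t i j) *\<^sub>R x i)"
    unfolding transformed_ensemble_def using t0 by (intro sum.mono_neutral_right) (auto simp: I_def)
  also have "\<dots> \<in> ball y e"
    using one near by (intro convex_sum) (auto simp: I_def dist_commute)
  finally show ?thesis by (simp add: dist_commute)
qed

text \<open>The barycentric graph inherits the local convergence of the supports, as the barycentre is an average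
  of target points that are all close to \<open>\<Psi> a\<close>.\<close>
lemma empirical_couplings_converge:
  fixes x :: "nat \<Rightarrow> 'a::euclidean_space" and F :: "'a \<times> 'a \<Rightarrow> real"
  assumes \<mu>: "prob_space \<mu>" and sets\<mu>: "sets \<mu> = sets borel"
    and emp1: "\<And>f :: 'a \<Rightarrow> real. continuous_on UNIV f \<Longrightarrow> bounded (range f) \<Longrightarrow>
        (\<lambda>n. (\<Sum>i<n. f (x i)) / real n) \<longlonglongrightarrow> (\<integral>x. f x \<partial>\<mu>)"
    and q: "strict_mono q" and q0: "\<And>k. 0 < q k"
    and cpl: "\<And>k. coupling (q k) (w k) (t k)"
    and psi: "\<And>k j. j < q k \<Longrightarrow> psi k (x j) = transformed_ensemble (q k) x (t k) j"
    and \<Psi>: "\<Psi> \<in> borel_measurable borel"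
    and loc: "AE a in \<mu>. \<forall>e>0. \<exists>d>0. \<exists>K. \<forall>k\<ge>K. \<forall>x' y'.
       (x', y') \<in> coupling_support (q k) x (t k) \<longrightarrow> dist x' a < d \<longrightarrow> dist y' (\<Psi> a) < e"
    and F: "continuous_on UNIV F" "bounded (range F)"
  shows "(\<lambda>k. \<integral>z. F z \<partial>empirical_coupling (q k) x (psi k)) \<longlonglongrightarrow> (\<integral>a. F (a, \<Psi> a) \<partial>\<mu>)"
proof -
  define S where "S = (\<lambda>k. (\<lambda>j. (x j, psi k (x j))) ` {..<q k})"
  have rv: "(\<lambda>j. (x j, psi k (x j))) \<in> uniform_count_measure {..<q k} \<rightarrow>\<^sub>M borel" for k
    by (simp add: measurable_def space_uniform_count_measure sets_uniform_count_measure)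
  show ?thesis
  proof (rule weak_limit_of_convergent_graphs[OF \<mu> sets\<mu>, where S = S and \<Psi> = \<Psi> and F = F
        and \<pi> = "\<lambda>k. empirical_coupling (q k) x (psi k)"])
    show "prob_space (empirical_coupling (q k) x (psi k))" for k
      unfolding empirical_coupling_def
      by (rule prob_space.prob_space_distr[OF prob_space_uniform_count_measure rv]) (use q0[of k] in auto)
    show "sets (empirical_coupling (q k) x (psi k)) = sets borel" for k
      by (simp add: empirical_coupling_def)
    show "AE z in empirical_coupling (q k) x (psi k). z \<in> S k" for k
    proof -
      have "S k \<in> sets borel" unfolding S_def by (intro borel_closed finite_imp_closed finite_imageI) simp
      then show ?thesis unfolding empirical_coupling_def
        by (subst AE_distr_iff[OF rv]) (auto simp: S_def space_uniform_count_measure intro!: AE_I2)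
    qed
    show "(\<lambda>k. \<integral>z. g (fst z) \<partial>empirical_coupling (q k) x (psi k)) \<longlonglongrightarrow> (\<integral>x. g x \<partial>\<mu>)"
      if g: "continuous_on UNIV g" "bounded (range g)" for g :: "'a \<Rightarrow> real"
    proof -
      have [measurable]: "g \<in> borel_measurable borel" using g(1) by (rule borel_measurable_continuous_onI)
      have "(\<integral>z. g (fst z) \<partial>empirical_coupling (q k) x (psi k)) = (\<Sum>j<q k. g (x j)) / real (q k)" for k
        by (subst integral_empirical_coupling) (auto simp: borel_prod[symmetric])
      then show ?thesis using filterlim_compose[OF emp1[OF g] filterlim_subseq[OF q]] by simp
    qed
    show "AE a in \<mu>. \<forall>e>0. \<exists>d>0. \<exists>K. \<forall>k\<ge>K. \<forall>x' y'. (x', y') \<in> S k \<longrightarrow> dist x' a < d \<longrightarrow> dist y' (\<Psi> a) < e"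
      using loc
    proof eventually_elim
      case (elim a)
      show ?case
      proof (intro allI impI)
        fix e :: real assume e: "e > 0"
        from elim[THEN spec, THEN mp, OF e] obtain d K where d: "d > 0"
          and K: "\<forall>k\<ge>K. \<forall>x' y'. (x', y') \<in> coupling_support (q k) x (t k) \<longrightarrow>
            dist x' a < d \<longrightarrow> dist y' (\<Psi> a) < e"
          by (elim exE conjE)
        have "dist y' (\<Psi> a) < e" if k: "k \<ge> K" and S: "(x', y') \<in> S k" and near: "dist x' a < d" for k x' y'
        proof -
          obtain j where j: "j < q k" "x' = x j" "y' = transformed_ensemble (q k) x (t k) j"
            using S psi by (auto simp: S_def)
          show ?thesis unfolding j(3)
          proof (rule transformed_ensemble_near[OF cpl j(1)])
            fix i assume "i < q k" "0 < t k i j"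
            then have "(x', x i) \<in> coupling_support (q k) x (t k)" using j by (auto simp: coupling_support_def)
            then show "dist (x i) (\<Psi> a) < e" using K[rule_format, OF k] near by blast
          qed
        qed
        then show "\<exists>d>0. \<exists>K. \<forall>k\<ge>K. \<forall>x' y'. (x', y') \<in> S k \<longrightarrow> dist x' a < d \<longrightarrow> dist y' (\<Psi> a) < e"
          using d by blast
      qed
    qed
  qed (fact \<Psi> F)+
qed

lemma weakly_converges_if_subsequences:
  fixes \<mu> :: "nat \<Rightarrow> 'a::topological_space measure"
  assumes sub: "\<And>q f. strict_mono q \<Longrightarrow> (\<And>k. n0 \<le> q k) \<Longrightarrow> continuous_on UNIV f \<Longrightarrow> bounded (range f) \<Longrightarrow>
      \<exists>r. strict_mono (r :: nat \<Rightarrow> nat) \<and> (\<lambda>k. \<integral>z. f z \<partial>\<mu> (q (r k))) \<longlonglongrightarrow> (\<integral>z. (f z :: real) \<partial>\<nu>)"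
  shows "weakly_converges \<mu> \<nu>"
  unfolding weakly_converges_def
proof (intro allI impI, elim conjE, rule ccontr)
  fix f :: "'a \<Rightarrow> real" assume f: "continuous_on UNIV f" "bounded (range f)"
    and "\<not> (\<lambda>n. \<integral>z. f z \<partial>\<mu> n) \<longlonglongrightarrow> (\<integral>z. f z \<partial>\<nu>)"
  then obtain e where e: "e > 0" "\<exists>\<^sub>F n in sequentially. e \<le> dist (\<integral>z. f z \<partial>\<mu> n) (\<integral>z. f z \<partial>\<nu>)"
    unfolding tendsto_iff by (auto simp: not_eventually not_less)
  define E where "E = {n. n0 \<le> n \<and> e \<le> dist (\<integral>z. f z \<partial>\<mu> n) (\<integral>z. f z \<partial>\<nu>)}"
  have "\<exists>n>m. n \<in> E" for m
  proof -
    have "\<exists>n\<ge>max (Suc m) n0. e \<le> dist (\<integral>z. f z \<partial>\<mu> n) (\<integral>z. f z \<partial>\<nu>)"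
      using e(2) unfolding frequently_sequentially by blast
    then show ?thesis by (auto simp: E_def intro: less_le_trans[OF lessI])
  qed
  then have "infinite E" unfolding infinite_nat_iff_unbounded by blast
  then have q: "strict_mono (enumerate E)" and inE: "enumerate E k \<in> E" for k
    by (auto intro: strict_mono_enumerate enumerate_in_set)
  have E: "n0 \<le> enumerate E k" "e \<le> dist (\<integral>z. f z \<partial>\<mu> (enumerate E k)) (\<integral>z. f z \<partial>\<nu>)" for k
    using inE[of k] unfolding E_def by blast+
  obtain r where "(\<lambda>k. \<integral>z. f z \<partial>\<mu> (enumerate E (r k))) \<longlonglongrightarrow> (\<integral>z. f z \<partial>\<nu>)"
    using sub[OF q E(1) f] by blast
  from tendstoD[OF this e(1)] have "\<forall>\<^sub>F k in sequentially. False"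
    by (rule eventually_mono) (meson E(2) leD)
  then show False by simp
qed

theorem theorem1:
  fixes P :: "'p measure" and X :: "'p \<Rightarrow> real ^ 'n"
    and Q :: "'q measure" and Xs :: "nat \<Rightarrow> 'q \<Rightarrow> real ^ 'n"
    and prior :: "real ^ 'n \<Rightarrow> real"
    and lik :: "real ^ 'k \<Rightarrow> real ^ 'n \<Rightarrow> real"
    and y0 :: "real ^ 'k"
  assumes P: "prob_space P"
    and prior_nonneg: "\<And>x. 0 \<le> prior x"
    and X: "distributed P lborel X (\<lambda>x. ennreal (prior x))"
    and lik_nonneg: "\<And>y x. 0 \<le> lik y x"
    and lik_measurable: "\<And>y. lik y \<in> borel_measurable borel"
    and evidence_finite: "integrable lborel (\<lambda>x. lik y0 x * prior x)"
    and evidence_pos: "0 < (\<integral>x. lik y0 x * prior x \<partial>lborel)"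
    and Q: "prob_space Q"
    and Xs_indep: "prob_space.indep_vars Q (\<lambda>_. borel) Xs UNIV"
    and Xs_density: "\<And>i. distributed Q lborel (Xs i) (\<lambda>x. ennreal (prior x))"
  shows "\<exists>\<Psi> :: real ^ 'n \<Rightarrow> real ^ 'n.
     \<Psi> \<in> borel_measurable borel \<and>
     (AE \<omega> in Q. \<forall>\<Psi>M :: nat \<Rightarrow> real ^ 'n \<Rightarrow> real ^ 'n.
        (\<forall>M. 0 < (\<Sum>l<M. lik y0 (Xs l \<omega>)) \<longrightarrow>
             ensemble_transform_map (lik y0) M (\<lambda>i. Xs i \<omega>) (\<Psi>M M)) \<longrightarrow>
        weakly_converges (\<lambda>M. empirical_coupling M (\<lambda>i. Xs i \<omega>) (\<Psi>M M))
          (distr P borel (\<lambda>\<xi>. (X \<xi>, \<Psi> (X \<xi>))))) \<and>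
     distributed P lborel (\<lambda>\<xi>. \<Psi> (X \<xi>)) (\<lambda>x. ennreal (posterior_density lik prior y0 x)) \<and>
     (\<forall>\<Phi> :: real ^ 'n \<Rightarrow> real ^ 'n.
        distributed P lborel (\<lambda>\<xi>. \<Phi> (X \<xi>)) (\<lambda>x. ennreal (posterior_density lik prior y0 x)) \<longrightarrow>
        (\<integral>\<^sup>+\<xi>. ennreal ((norm (X \<xi> - \<Psi> (X \<xi>)))\<^sup>2) \<partial>P) \<le>
        (\<integral>\<^sup>+\<xi>. ennreal ((norm (X \<xi> - \<Phi> (X \<xi>)))\<^sup>2) \<partial>P))"
proof -
  interpret P: prob_space P by (rule P)
  interpret Q: prob_space Q by (rule Q)
  define L where "L = lik y0"
  define Z where "Z = (\<integral>x. L x * prior x \<partial>lborel)"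
  define post where "post = posterior_density lik prior y0"
  have L0: "0 \<le> L x" for x using lik_nonneg by (simp add: L_def)
  have L_meas[measurable]: "L \<in> borel_measurable borel" using lik_measurable by (simp add: L_def)
  have Z: "0 < Z" using evidence_pos by (simp add: Z_def L_def)
  have prior_meas[measurable]: "prior \<in> borel_measurable borel"
    using distributed_real_measurable[OF _ X] prior_nonneg by simp
  have post: "post x = L x * prior x / Z" for x
    by (simp add: post_def posterior_density_def L_def Z_def)
  have post_meas[measurable]: "post \<in> borel_measurable borel" unfolding post[abs_def] by measurable
  have post0: "0 \<le> post x" for x using L0 prior_nonneg Z by (simp add: post)
  have Lp: "integrable lborel (\<lambda>x. L x * prior x)" using evidence_finite by (simp add: L_def)

  define \<mu> where "\<mu> = density lborel (\<lambda>x. ennreal (prior x))"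
  define \<nu> where "\<nu> = density lborel (\<lambda>x. ennreal (post x))"
  have sets\<mu>: "sets \<mu> = sets borel" and sets\<nu>: "sets \<nu> = sets borel" by (simp_all add: \<mu>_def \<nu>_def)
  have distr_lborel: "distr M lborel f = distr M borel f" for M :: "'c measure" and f :: "'c \<Rightarrow> real ^ 'n"
    by (rule distr_cong) simp_all
  have X_meas[measurable]: "X \<in> borel_measurable P" using X by (simp add: distributed_def)
  have law_X: "distr P borel X = \<mu>" using X by (simp add: distributed_def distr_lborel \<mu>_def)
  have law_Xs: "distr Q borel (Xs i) = \<mu>" for i
    using Xs_density[of i] by (simp add: distributed_def distr_lborel \<mu>_def)
  have \<mu>: "prob_space \<mu>" unfolding law_X[symmetric] by (rule P.prob_space_distr) simp
  have ac: "null_sets lborel \<subseteq> null_sets \<mu>"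
    using absolutely_continuousI_density[of "\<lambda>x. ennreal (prior x)" lborel]
    by (simp add: absolutely_continuous_def \<mu>_def)
  have \<nu>: "prob_space \<nu>"
  proof
    have "integrable lborel post" unfolding post[abs_def] using Lp by simp
    moreover have "(\<integral>x. post x \<partial>lborel) = 1" unfolding post using Z by (simp add: Z_def)
    ultimately have "(\<integral>\<^sup>+x. ennreal (post x) \<partial>lborel) = 1"
      using post0 by (subst nn_integral_eq_integral) auto
    then show "emeasure \<nu> (space \<nu>) = 1" by (simp add: \<nu>_def emeasure_density)
  qed
  have L_int: "integrable \<mu> L"
    unfolding \<mu>_def using Lp prior_nonneg by (subst integrable_real_density) (auto simp: mult.commute)
  have post_int: "(\<integral>x. L x * f x \<partial>\<mu>) = Z * (\<integral>y. f y \<partial>\<nu>)"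
    if [measurable]: "f \<in> borel_measurable borel" for f :: "real ^ 'n \<Rightarrow> real"
  proof -
    have "(\<integral>y. f y \<partial>\<nu>) = (\<integral>x. post x * f x \<partial>lborel)"
      unfolding \<nu>_def using post0 by (subst integral_real_density) auto
    also have "\<dots> = (\<integral>x. (prior x * (L x * f x)) / Z \<partial>lborel)"
      by (intro Bochner_Integration.integral_cong) (auto simp: post)
    also have "\<dots> = (\<integral>x. prior x * (L x * f x) \<partial>lborel) / Z" by simp
    also have "(\<integral>x. prior x * (L x * f x) \<partial>lborel) = (\<integral>x. L x * f x \<partial>\<mu>)"
      unfolding \<mu>_def using prior_nonneg by (subst integral_real_density) auto
    finally show ?thesis using Z by simp
  qed

  \<comment> \<open>A realisation is good if its plain and its weighted empirical averages converge for all test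
    functions; the rest of the argument is deterministic.\<close>
  define good where "good = (\<lambda>x :: nat \<Rightarrow> real ^ 'n. \<forall>f. continuous_on UNIV f \<longrightarrow> bounded (range f) \<longrightarrow>
      (\<lambda>n. (\<Sum>i<n. f (x i)) / real n) \<longlonglongrightarrow> (\<integral>a. f a \<partial>\<mu>) \<and>
      (\<lambda>n. (\<Sum>i<n. L (x i) * f (x i)) / real n) \<longlonglongrightarrow> Z * (\<integral>y. f y \<partial>\<nu>))"
  have AE_good: "AE \<omega> in Q. good (\<lambda>i. Xs i \<omega>)"
  proof -
    have "integrable \<mu> (\<lambda>_. 1 :: real)" by (intro finite_measure.integrable_const prob_space.finite_measure \<mu>)
    from Q.AE_weighted_empirical_convergence[OF Xs_indep law_Xs this zero_le_one]
      Q.AE_weighted_empirical_convergence[OF Xs_indep law_Xs L_int L0]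
    show ?thesis unfolding good_def
      by eventually_elim (simp add: post_int borel_measurable_continuous_onI)
  qed
  have ev_pos: "\<exists>n0. \<forall>n\<ge>n0. 0 < (\<Sum>l<n. L (x l))" if "good x" for x
  proof -
    interpret \<nu>: prob_space \<nu> by (rule \<nu>)
    have "(\<lambda>n. (\<Sum>i<n. L (x i) * 1) / real n) \<longlonglongrightarrow> Z * (\<integral>y. 1 \<partial>\<nu>)"
      using that unfolding good_def by (elim allE[of _ "\<lambda>_. 1"]) simp
    then have "(\<lambda>n. (\<Sum>i<n. L (x i)) / real n) \<longlonglongrightarrow> Z" by (simp add: \<nu>.prob_space)
    from order_tendstoD(1)[OF this Z] show ?thesis
      unfolding eventually_sequentially by (auto simp: zero_less_divide_iff)
  qed
  note limit_along = optimal_couplings_converge_along_subsequence[OF \<mu> sets\<mu> ac \<nu> sets\<nu> Z, where L = L]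

  \<comment> \<open>One good realisation provides the limit map. The shift by \<open>n0\<close> skips the ensembles without
    defined weights.\<close>
  obtain \<omega>0 where \<omega>0: "good (\<lambda>i. Xs i \<omega>0)"
    using eventually_happens'[OF Q.ae_filter_bot AE_good] by blast
  define x0 where "x0 = (\<lambda>i. Xs i \<omega>0)"
  have x0: "good x0" using \<omega>0 by (simp add: x0_def)
  obtain n0 where n0: "\<And>n. n \<ge> n0 \<Longrightarrow> 0 < (\<Sum>l<n. L (x0 l))" using ev_pos[OF x0] by blast
  have "\<forall>k. \<exists>t. optimal_coupling (k + n0) (importance_weight L x0 (k + n0)) x0 t"
    by (intro allI optimal_coupling_exists[OF importance_weight_coupling] L0 n0) simp
  then obtain t0 where t0: "\<And>k. optimal_coupling (k + n0) (importance_weight L x0 (k + n0)) x0 (t0 k)"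
    by metis
  obtain \<Psi> \<Gamma> where \<Psi>[measurable]: "\<Psi> \<in> borel_measurable borel"
    and push: "distr \<mu> borel \<Psi> = \<nu>" and cm: "cyclically_monotone \<Gamma>" and on: "AE x in \<mu>. (x, \<Psi> x) \<in> \<Gamma>"
    by (rule limit_along[where x = x0 and q = "\<lambda>k. k + n0" and t = t0])
       (use x0 n0 t0 in \<open>auto simp: good_def strict_mono_def\<close>)

  have pushP: "distr P borel (\<lambda>\<xi>. \<Psi> (X \<xi>)) = \<nu>"
    unfolding push[symmetric] law_X[symmetric] by (subst distr_distr) (auto simp: comp_def)
  have dist\<Psi>: "distributed P lborel (\<lambda>\<xi>. \<Psi> (X \<xi>)) (\<lambda>x. ennreal (post x))"
    unfolding distributed_def using pushP by (simp add: distr_lborel \<nu>_def)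
  have minimal: "(\<integral>\<^sup>+\<xi>. ennreal ((norm (X \<xi> - \<Psi> (X \<xi>)))\<^sup>2) \<partial>P) \<le> (\<integral>\<^sup>+\<xi>. ennreal ((norm (X \<xi> - \<Phi> (X \<xi>)))\<^sup>2) \<partial>P)"
    if \<Phi>: "distributed P lborel (\<lambda>\<xi>. \<Phi> (X \<xi>)) (\<lambda>x. ennreal (post x))" for \<Phi> :: "real ^ 'n \<Rightarrow> real ^ 'n"
  proof (rule cyclically_monotone_minimal_cost[OF P X_meas _ _ _ cm])
    show "(\<lambda>\<xi>. \<Psi> (X \<xi>)) \<in> borel_measurable P" by measurable
    show "(\<lambda>\<xi>. \<Phi> (X \<xi>)) \<in> borel_measurable P" using \<Phi> by (simp add: distributed_def)
    show "distr P borel (\<lambda>\<xi>. \<Psi> (X \<xi>)) = distr P borel (\<lambda>\<xi>. \<Phi> (X \<xi>))"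
      using \<Phi> pushP by (simp add: distributed_def distr_lborel \<nu>_def)
    show "AE \<xi> in P. (X \<xi>, \<Psi> (X \<xi>)) \<in> \<Gamma>"
      using on unfolding law_X[symmetric] by (rule AE_distrD[OF X_meas])
  qed

  have weak: "weakly_converges (\<lambda>M. empirical_coupling M x (\<Psi>M M)) (distr P borel (\<lambda>\<xi>. (X \<xi>, \<Psi> (X \<xi>))))"
    if x: "good x" and etm: "\<And>M. 0 < (\<Sum>l<M. L (x l)) \<Longrightarrow> ensemble_transform_map L M x (\<Psi>M M)"
    for x :: "nat \<Rightarrow> real ^ 'n" and \<Psi>M
  proof -
    obtain n1 where n1: "\<And>n. n \<ge> n1 \<Longrightarrow> 0 < (\<Sum>l<n. L (x l))" using ev_pos[OF x] by blast
    show ?thesis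
    proof (rule weakly_converges_if_subsequences)
      fix q :: "nat \<Rightarrow> nat" and f :: "(real ^ 'n) \<times> (real ^ 'n) \<Rightarrow> real"
      assume q: "strict_mono q" "\<And>k. n1 \<le> q k" and f: "continuous_on UNIV f" "bounded (range f)"
      have pos: "0 < (\<Sum>l<q k. L (x l))" for k using n1 q(2) by blast
      have "\<forall>k. \<exists>t. optimal_coupling (q k) (importance_weight L x (q k)) x t \<and>
          (\<forall>j<q k. \<Psi>M (q k) (x j) = transformed_ensemble (q k) x t j)"
        using etm[OF pos] unfolding ensemble_transform_map_def by blast
      then obtain t where t: "\<And>k. optimal_coupling (q k) (importance_weight L x (q k)) x (t k)"
        and tr: "\<And>k j. j < q k \<Longrightarrow> \<Psi>M (q k) (x j) = transformed_ensemble (q k) x (t k) j"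
        by metis
      obtain r \<Psi>' \<Gamma>' where r: "strict_mono (r :: nat \<Rightarrow> nat)" and \<Psi>': "\<Psi>' \<in> borel_measurable borel"
        and push': "distr \<mu> borel \<Psi>' = \<nu>" and cm': "cyclically_monotone \<Gamma>'" and on': "AE x in \<mu>. (x, \<Psi>' x) \<in> \<Gamma>'"
        and loc: "AE a in \<mu>. \<forall>e>0. \<exists>d>0. \<exists>K. \<forall>k\<ge>K. \<forall>x' y'.
          (x', y') \<in> coupling_support (q (r k)) x (t (r k)) \<longrightarrow> dist x' a < d \<longrightarrow> dist y' (\<Psi>' a) < e"
        by (rule limit_along[where x = x and q = q and t = t]) (use x pos q(1) t in \<open>auto simp: good_def\<close>)
      \<comment> \<open>This is where the limit becomes independent of the realisation and the subsequence.\<close>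
      have same: "AE a in \<mu>. \<Psi>' a = \<Psi> a"
        by (rule cyclically_monotone_transport_unique[OF \<mu> sets\<mu> ac \<Psi>' \<Psi> _ cm' cm on' on]) (simp add: push push')
      have fm[measurable]: "f \<in> borel_measurable borel" using f(1) by (rule borel_measurable_continuous_onI)
      have [measurable]: "f \<in> borel_measurable (borel \<Otimes>\<^sub>M borel)" using fm by (simp add: borel_prod)
      have q0: "0 < q (r k)" for k using pos[of "r k"] by (cases "q (r k)") auto
      have "(\<lambda>k. \<integral>z. f z \<partial>empirical_coupling ((q \<circ> r) k) x (\<Psi>M (q (r k)))) \<longlonglongrightarrow> (\<integral>a. f (a, \<Psi>' a) \<partial>\<mu>)"
      proof (rule empirical_couplings_converge[OF \<mu> sets\<mu> _ _ _ _ _ \<Psi>' _ f])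
        show "strict_mono (q \<circ> r)" using q(1) r by (rule strict_mono_o)
        show "coupling ((q \<circ> r) k) (importance_weight L x (q (r k))) (t (r k))" for k
          using t[of "r k"] by (simp add: optimal_coupling_def)
      qed (use x q0 tr loc in \<open>auto simp: good_def\<close>)
      also have "(\<integral>a. f (a, \<Psi>' a) \<partial>\<mu>) = (\<integral>a. f (a, \<Psi> a) \<partial>\<mu>)"
        using same \<Psi>' sets\<mu> by (intro integral_cong_AE) (auto cong: measurable_cong_sets)
      also have "\<dots> = (\<integral>z. f z \<partial>distr P borel (\<lambda>\<xi>. (X \<xi>, \<Psi> (X \<xi>))))"
        unfolding law_X[symmetric] by (subst (1 2) integral_distr) (auto simp: borel_prod[symmetric])
      finally show "\<exists>r. strict_mono r \<and> (\<lambda>k. \<integral>z. f z \<partial>empirical_coupling (q (r k)) x (\<Psi>M (q (r k))))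
          \<longlonglongrightarrow> (\<integral>z. f z \<partial>distr P borel (\<lambda>\<xi>. (X \<xi>, \<Psi> (X \<xi>))))"
        using r by (auto simp: comp_def)
    qed
  qed

  show ?thesis
  proof (intro exI[of _ \<Psi>] conjI)
    show "\<Psi> \<in> borel_measurable borel" by (rule \<Psi>)
    show "AE \<omega> in Q. \<forall>\<Psi>M. (\<forall>M. 0 < (\<Sum>l<M. lik y0 (Xs l \<omega>)) \<longrightarrow>
             ensemble_transform_map (lik y0) M (\<lambda>i. Xs i \<omega>) (\<Psi>M M)) \<longrightarrow>
        weakly_converges (\<lambda>M. empirical_coupling M (\<lambda>i. Xs i \<omega>) (\<Psi>M M))
          (distr P borel (\<lambda>\<xi>. (X \<xi>, \<Psi> (X \<xi>))))"
      using AE_good by eventually_elim (use weak in \<open>simp add: L_def\<close>)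
    show "distributed P lborel (\<lambda>\<xi>. \<Psi> (X \<xi>)) (\<lambda>x. ennreal (posterior_density lik prior y0 x))"
      using dist\<Psi> unfolding post_def .
    show "\<forall>\<Phi>. distributed P lborel (\<lambda>\<xi>. \<Phi> (X \<xi>)) (\<lambda>x. ennreal (posterior_density lik prior y0 x)) \<longrightarrow>
        (\<integral>\<^sup>+\<xi>. ennreal ((norm (X \<xi> - \<Psi> (X \<xi>)))\<^sup>2) \<partial>P) \<le>
        (\<integral>\<^sup>+\<xi>. ennreal ((norm (X \<xi> - \<Phi> (X \<xi>)))\<^sup>2) \<partial>P)"
      using minimal unfolding post_def by blast
  qed
qed

end
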